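(* For fixed real $a,b$, as $\varepsilon\downarrow0$, $$F_{a,b}(e^{-\varepsilon})\sim\kappa\,\rho^a\sigma^{b/13}e^{\Lambda/\varepsilon},\qquad \kappa=\frac{\rho^2(\alpha+1)}{\sqrt{13}},\qquad \Lambda=\frac{2\pi^2}{39}.$$ The three functions $$F_{0,0}(q)+qF_{2,13}(q),\qquad F_{0,0}(q)+q^6F_{7,26}(q),\qquad F_{4,13}(q)+q^4F_{6,26}(q)$$ have respective leading amplitudes $\alpha/\sqrt{13}$, $\beta/\sqrt{13}$, $\gamma/\sqrt{13}$, agreeing exactly with the leading amplitudes of $P_0(q)$, $P_1(q)$, $P_2(q)$ respectively.
   Context: $F_{a,b}(q)=\sum_{r,s\ge0}\dfrac{q^{2r^2+13rs+26s^2+ar+bs}}{(q;q)_r(q^{13};q^{13})_s}$ with $(x;q)_n=\prod_{j=0}^{n-1}(1-xq^j)$. A function $G(q)$ has leading amplitude $K$ if $G(e^{-\varepsilon})\sim Ke^{\Lambda/\varepsilon}$ as $\varepsilon\downarrow0$, with $\Lambda=2\pi^2/39$. $\rho$ is the unique root in $(0,1)$ of $X^3-4X^2+X+1$, and $\sigma=(1-\rho)/\rho^4\in(0,1)$. With $\zeta=e^{2\pi i/13}$, $C_0=\{\pm1,\pm5\}$, $C_1=\{\pm2,\pm3\}$, $C_2=\{\pm4,\pm6\}$ (residues modulo $13$) and $\eta_j=\sum_{a\in C_j}\zeta^a$, put $\alpha=\eta_1-\eta_2$, $\beta=\eta_0-\eta_2$, $\gamma=\eta_1-\eta_0$. With $(a_1,\dots,a_k;q)_\infty=\prod_{i=1}^k\prod_{n\ge0}(1-a_iq^n)$,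 $$P_0=(q,q^5,q^8,q^{12};q^{13})_\infty^{-1},\quad P_1=(q^2,q^3,q^{10},q^{11};q^{13})_\infty^{-1},\quad P_2=(q^4,q^6,q^7,q^9;q^{13})_\infty^{-1}.$$ *)

theory Defs
  imports "HOL-Complex_Analysis.Complex_Analysis" "HOL-Library.Landau_Symbols"
begin

text \<open>Only \<open>0 < q < 1\<close> matters below (\<open>q = exp (-\<epsilon>)\<close>), so everything is a function of a real \<open>q\<close>.\<close>

definition qpoch :: "real \<Rightarrow> real \<Rightarrow> nat \<Rightarrow> real" where
  "qpoch x q n = (\<Prod>j<n. 1 - x * q ^ j)"

definition qpoch_inf :: "real list \<Rightarrow> real \<Rightarrow> real" where
  "qpoch_inf as q = (\<Prod>x\<leftarrow>as. \<Prod>n. 1 - x * q ^ n)"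

definition F :: "real \<Rightarrow> real \<Rightarrow> real \<Rightarrow> real" where
  "F a b q = (\<Sum>\<^sub>\<infinity>(r, s)\<in>(UNIV :: (nat \<times> nat) set).
     q powr (2 * real r ^ 2 + 13 * real r * real s + 26 * real s ^ 2 + a * real r + b * real s)
       / (qpoch q q r * qpoch (q ^ 13) (q ^ 13) s))"

definition P0 :: "real \<Rightarrow> real" where
  "P0 q = inverse (qpoch_inf [q, q ^ 5, q ^ 8, q ^ 12] (q ^ 13))"

definition P1 :: "real \<Rightarrow> real" where
  "P1 q = inverse (qpoch_inf [q ^ 2, q ^ 3, q ^ 10, q ^ 11] (q ^ 13))"

definition P2 :: "real \<Rightarrow> real" where
  "P2 q = inverse (qpoch_inf [q ^ 4, q ^ 6, q ^ 7, q ^ 9] (q ^ 13))"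

definition Lam :: real where
  "Lam = 2 * pi ^ 2 / 39"

definition leading_amplitude :: "(real \<Rightarrow> real) \<Rightarrow> real \<Rightarrow> bool" where
  "leading_amplitude G K \<longleftrightarrow>
     (\<lambda>\<epsilon>. G (exp (- \<epsilon>))) \<sim>[at_right 0] (\<lambda>\<epsilon>. K * exp (Lam / \<epsilon>))"

definition rho :: real where
  "rho = (THE x. 0 < x \<and> x < 1 \<and> x ^ 3 - 4 * x ^ 2 + x + 1 = 0)"

lemma rho_unique: "\<exists>!x::real. 0 < x \<and> x < 1 \<and> x ^ 3 - 4 * x ^ 2 + x + 1 = 0"
proof -
  let ?f = "\<lambda>x::real. x ^ 3 - 4 * x ^ 2 + x + 1"
  have "\<exists>x\<ge>0. x \<le> 1 \<and> ?f x = 0"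
    by (rule IVT2') (auto intro!: continuous_intros)
  then obtain x where x: "0 \<le> x" "x \<le> 1" "?f x = 0" by blast
  have "x \<noteq> 0" "x \<noteq> 1" using x(3) by auto
  with x have ex: "0 < x \<and> x < 1 \<and> ?f x = 0" by auto
  have "y = z" if y: "0 < y \<and> y < 1 \<and> ?f y = 0" and z: "0 < z \<and> z < 1 \<and> ?f z = 0" for y z :: real
  proof (rule ccontr)
    assume "y \<noteq> z"
    have "(y - z) * (y^2 + y*z + z^2 - 4*(y+z) + 1) = ?f y - ?f z"
      by (simp add: algebra_simps power2_eq_square power3_eq_cube)
    with y z \<open>y \<noteq> z\<close> have h: "y^2 + y*z + z^2 - 4*(y+z) + 1 = 0" by simp
    have *: "4 * w - w^2 > 1" if w: "0 < w \<and> w < 1 \<and> ?f w = 0" for w :: real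
    proof -
      have "w * (4 * w - w^2) = w + 1"
        using w by (simp add: algebra_simps power2_eq_square power3_eq_cube)
      moreover have "w + 1 > w * 1" by simp
      ultimately have "w * (4 * w - w^2) > w * 1" by linarith
      thus ?thesis using w by (simp only: mult_less_cancel_left_pos)
    qed
    have "y * z < 1 * 1" using y z by (intro mult_strict_mono) auto
    with *[OF y] *[OF z] h show False by simp
  qed
  with ex show ?thesis by blast
qed

lemma rho: "0 < rho" "rho < 1" "rho ^ 3 - 4 * rho ^ 2 + rho + 1 = 0"
  using theI'[OF rho_unique] unfolding rho_def by auto

definition sigma0 :: real where
  "sigma0 = (1 - rho) / rho ^ 4"

definition zeta :: complex where
  "zeta = exp (2 * of_real pi * \<i> / 13)"

definition C0 :: "int set" where "C0 = {1, -1, 5, -5}"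
definition C1 :: "int set" where "C1 = {2, -2, 3, -3}"
definition C2 :: "int set" where "C2 = {4, -4, 6, -6}"

definition eta :: "int set \<Rightarrow> complex" where
  "eta C = (\<Sum>a\<in>C. zeta powi a)"

text \<open>The periods are real numbers, see \<open>eta_real\<close>; taking the real part just changes the type.\<close>

definition alpha :: real where "alpha = Re (eta C1 - eta C2)"
definition beta :: real where "beta = Re (eta C0 - eta C2)"
definition gamma :: real where "gamma = Re (eta C1 - eta C0)"

lemma zeta_powi: "zeta powi n = cis (2 * pi * of_int n / 13)"
proof -
  have "zeta = cis (2 * pi / 13)"
    by (simp add: zeta_def cis_conv_exp mult_ac)
  thus ?thesis using cis_power_int[of "2 * pi / 13" n] by (simp add: mult_ac)
qed

lemma eta_real: "eta C0 \<in> \<real>" "eta C1 \<in> \<real>" "eta C2 \<in> \<real>"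
  by (simp_all add: eta_def C0_def C1_def C2_def zeta_powi complex_is_Real_iff)

lemma of_real_alpha: "of_real alpha = eta C1 - eta C2"
  and of_real_beta: "of_real beta = eta C0 - eta C2"
  and of_real_gamma: "of_real gamma = eta C1 - eta C0"
  using eta_real by (simp_all add: alpha_def beta_def gamma_def complex_eq_iff complex_is_Real_iff)

definition kappa :: real where
  "kappa = rho ^ 2 * (alpha + 1) / sqrt 13"

end

theory Submission
  imports Defs "HOL-Probability.Probability" "HOL-Real_Asymp.Real_Asymp"
begin

text \<open>Put \<open>q = exp (-\<epsilon>)\<close>. All terms of the double series are positive and the general term is, to leading order,
\<open>exp (\<Phi>(\<epsilon> r, 13 \<epsilon> s) / \<epsilon>)\<close> for a strictly concave function \<open>\<Phi>\<close>, because
\<open>(q^(r+1); q)\<^sub>\<infinity> = exp (- Li(q^r) / \<epsilon> + O(1))\<close> as long as \<open>q^r\<close> stays away from 1, with \<open>Li\<close> the dilogarithm. The critical point of \<open>\<Phi>\<close> is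
\<open>(U, V) = (- ln \<rho>, - ln \<sigma>)\<close>: its two equations are \<open>\<rho>^4 \<sigma> = 1 - \<rho>\<close> and
\<open>\<rho>^13 \<sigma>^4 = 1 - \<sigma>\<close>, which is how the cubic equation for \<open>\<rho>\<close> enters. Laplace's method at this point gives
the whole statement about \<open>F\<close> once four things are known.

The value \<open>\<Phi>(U, V)\<close> equals \<open>\<Lambda>\<close>. In terms of Rogers' dilogarithm \<open>L\<close> this says
\<open>13 L(\<rho>) + L(\<sigma>) = 10 L(1)\<close> (\<open>rogers_identity\<close>). It is an integer combination of nine instances of the five-term
relation whose arguments lie in the cubic field generated by \<open>\<rho>\<close>, together with reflections \<open>L(x) + L(1 - x) = L(1)\<close>.

The products \<open>(q; q)\<^sub>\<infinity>\<close> and \<open>(q^13; q^13)\<^sub>\<infinity>\<close> are known up to a factor \<open>1 + o(1)\<close>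
(\<open>ln_euler_product_tendsto\<close>). Expanding the logarithm as a Lambert series leaves a Riemann sum, so a constant exists; the
duplication \<open>(q; q) = (q; q^2)(q^2; q^2)\<close> determines it, since \<open>(q; q^2) / (q^2; q^2)\<close> is controlled by Euler's product
for the sine (\<open>tendsto_qinf_sine\<close>). The sine product also gives the amplitudes of \<open>P\<^sub>0, P\<^sub>1, P\<^sub>2\<close>, each being
\<open>1 / (4 sin (\<pi> i / 13) sin (\<pi> j / 13))\<close>.

Summation and limit can be exchanged. The double sum is the integral over the plane of a step function, rescaled around the
critical point by \<open>\<surd>\<epsilon>\<close>. Convexity of \<open>u \<mapsto> Li(exp (-u))\<close> bounds each infinite product by its tangent
at the critical point; the linear terms then cancel exactly and a fixed Gaussian dominates (\<open>summand_dominated\<close>), while the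
second-order Taylor expansion gives the pointwise limit (\<open>summand_tendsto\<close>).

Finally the constants are algebraic. With the Gaussian periods of conductor 13 one finds \<open>\<beta> = \<rho> \<alpha>\<close>,
\<open>\<gamma> = (1 - \<rho>) \<alpha>\<close>, \<open>(\<alpha> + 1) \<rho> (1 - \<rho>) = 1\<close>, and
\<open>\<alpha>, \<beta>, \<gamma>\<close> times the denominators \<open>4 sin (\<pi> i / 13) sin (\<pi> j / 13)\<close> are \<open>\<surd>13\<close>. These identify the Hessian determinant with
\<open>\<kappa>\<close> and the three combinations of the \<open>F\<close> with the amplitudes of the products.\<close>

section \<open>The cubic field of the thirteenth roots of unity\<close>

definition two_cos13 :: "int \<Rightarrow> real" where
  "two_cos13 k = 2 * cos (2 * pi * of_int k / 13)"

lemma two_cos13_mult: "two_cos13 i * two_cos13 j = two_cos13 (i + j) + two_cos13 (i - j)"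
  by (simp add: two_cos13_def cos_times_cos ring_distribs add_divide_distrib diff_divide_distrib)

lemma two_cos13_fold: "two_cos13 (13 - k) = two_cos13 k" "two_cos13 (- k) = two_cos13 k" "two_cos13 0 = 2"
proof -
  have "2 * pi * real_of_int (13 - k) / 13 = 2 * pi - 2 * pi * of_int k / 13"
    by (simp add: field_simps)
  then show "two_cos13 (13 - k) = two_cos13 k"
    by (simp only: two_cos13_def cos_2pi_minus)
qed (simp_all add: two_cos13_def)

text \<open>Multiplying by \<open>sin (\<pi> / 13)\<close> makes the sum telescope.\<close>

lemma two_cos13_sum: "two_cos13 1 + two_cos13 2 + two_cos13 3 + two_cos13 4 + two_cos13 5 + two_cos13 6 = -1"
proof -
  let ?s = "sin (pi / 13)"
  have step: "two_cos13 k * ?s = sin ((2 * of_int k + 1) * pi / 13) - sin ((2 * of_int k - 1) * pi / 13)" for k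
    using sin_add[of "2 * pi * of_int k / 13" "pi / 13"] sin_diff[of "2 * pi * of_int k / 13" "pi / 13"]
    by (simp add: two_cos13_def ring_distribs add_divide_distrib diff_divide_distrib mult_ac)
  have "(two_cos13 1 + two_cos13 2 + two_cos13 3 + two_cos13 4 + two_cos13 5 + two_cos13 6) * ?s = - ?s"
    using step[of 1] step[of 2] step[of 3] step[of 4] step[of 5] step[of 6]
    by (simp add: distrib_right)
  moreover have "?s > 0" by (intro sin_gt_zero) (use pi_gt_zero in auto)
  ultimately show ?thesis by (metis mult_minus1 mult_right_cancel less_irrefl)
qed

definition period0 :: real where "period0 = two_cos13 1 + two_cos13 5"
definition period1 :: real where "period1 = two_cos13 2 + two_cos13 3"
definition period2 :: real where "period2 = two_cos13 4 + two_cos13 6"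

lemma two_cos13_reduce:
  "two_cos13 7 = two_cos13 6" "two_cos13 8 = two_cos13 5" "two_cos13 9 = two_cos13 4"
  "two_cos13 10 = two_cos13 3" "two_cos13 11 = two_cos13 2" "two_cos13 12 = two_cos13 1"
  using two_cos13_fold(1)[of 6] two_cos13_fold(1)[of 5] two_cos13_fold(1)[of 4]
    two_cos13_fold(1)[of 3] two_cos13_fold(1)[of 2] two_cos13_fold(1)[of 1] by simp_all

text \<open>The multiplication table of the Gaussian periods. Together with \<open>two_cos13_mult\<close> and the symmetries of the index it reduces
every polynomial identity between the periods to linear algebra, and all later identities for \<open>\<alpha>, \<beta>, \<gamma>\<close> are consequences of it.\<close>

lemma period_relations:
  "period0 + period1 + period2 = -1"
  "period0 ^ 2 = 4 + period1 + 2 * period2"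
  "period1 ^ 2 = 4 + period2 + 2 * period0"
  "period2 ^ 2 = 4 + period0 + 2 * period1"
  "period0 * period1 = period1 - 1"
  "period1 * period2 = period2 - 1"
  "period0 * period2 = period0 - 1"
  using two_cos13_sum two_cos13_fold(2)[of 1] two_cos13_fold(2)[of 2] two_cos13_fold(2)[of 3] two_cos13_fold(2)[of 4] two_cos13_fold(2)[of 5]
  by (simp_all add: period0_def period1_def period2_def power2_eq_square algebra_simps
      two_cos13_mult two_cos13_reduce two_cos13_fold(3))

lemma Re_eta: "Re (eta C0) = period0" "Re (eta C1) = period1" "Re (eta C2) = period2"
  by (simp_all add: eta_def C0_def C1_def C2_def zeta_powi period0_def period1_def period2_def two_cos13_def)

lemma period_differences:
  "alpha = period1 - period2" "beta = period0 - period2" "gamma = period1 - period0"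
  by (simp_all add: alpha_def beta_def gamma_def Re_eta)

lemma sin13_squared: "(4 * sin (of_int i * pi / 13) * sin (of_int j * pi / 13)) ^ 2
   = (2 - two_cos13 i) * (2 - two_cos13 j)"
proof -
  have "(2 * sin (of_int i * pi / 13)) ^ 2 = 2 - two_cos13 i" for i
    using cos_double_sin[of "of_int i * pi / 13"]
    by (simp add: two_cos13_def power_mult_distrib mult_ac)
  from this[of i] this[of j]
  have "(2 * sin (of_int i * pi / 13)) ^ 2 * (2 * sin (of_int j * pi / 13)) ^ 2
      = (2 - two_cos13 i) * (2 - two_cos13 j)" by simp
  then show ?thesis by (simp add: power2_eq_square algebra_simps)
qed

text \<open>The square of \<open>2 sin (\<pi> k / 13)\<close> is \<open>2 - 2 cos (2 \<pi> k / 13)\<close>, and the product of the two such factors that belong to one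
coset of the cubic residues is again a combination of periods.\<close>

lemma period_difference_norms:
  "alpha ^ 2 * (4 * sin (pi / 13) * sin (5 * pi / 13)) ^ 2 = 13"
  "beta ^ 2 * (4 * sin (2 * pi / 13) * sin (3 * pi / 13)) ^ 2 = 13"
  "gamma ^ 2 * (4 * sin (4 * pi / 13) * sin (6 * pi / 13)) ^ 2 = 13"
proof -
  have s: "(2 - two_cos13 1) * (2 - two_cos13 5) = 4 - 2 * period0 + period2"
    "(2 - two_cos13 2) * (2 - two_cos13 3) = 4 - 2 * period1 + period0"
    "(2 - two_cos13 4) * (2 - two_cos13 6) = 4 - 2 * period2 + period1"
    using two_cos13_fold(2)[of 4] two_cos13_fold(2)[of 1] two_cos13_fold(2)[of 2]
    by (simp_all add: algebra_simps two_cos13_mult two_cos13_reduce period0_def period1_def period2_def)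
  note r = period_relations
  show "alpha ^ 2 * (4 * sin (pi / 13) * sin (5 * pi / 13)) ^ 2 = 13"
    using sin13_squared[of 1 5] s(1) r unfolding period_differences
    by simp algebra
  show "beta ^ 2 * (4 * sin (2 * pi / 13) * sin (3 * pi / 13)) ^ 2 = 13"
    using sin13_squared[of 2 3] s(2) r unfolding period_differences
    by simp algebra
  show "gamma ^ 2 * (4 * sin (4 * pi / 13) * sin (6 * pi / 13)) ^ 2 = 13"
    using sin13_squared[of 4 6] s(3) r unfolding period_differences
    by simp algebra
qed

lemma two_cos13_antimono: "0 \<le> i \<Longrightarrow> i < j \<Longrightarrow> j \<le> 6 \<Longrightarrow> two_cos13 j < two_cos13 i"
  unfolding two_cos13_def using pi_gt_zero
  by (auto intro!: cos_monotone_0_pi simp: field_simps)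

text \<open>Comparing cosines settles \<open>\<beta> > 0\<close> and \<open>\<alpha> > 0\<close>, but not \<open>\<alpha> > \<beta>\<close>; this follows because the right-hand
side of \<open>\<alpha> \<beta> (\<alpha> - \<beta>) = \<beta>^2 - \<alpha> \<beta> + \<alpha>^2\<close> is positive.\<close>

lemma beta_less_alpha: "0 < beta" "beta < alpha"
proof -
  show b: "0 < beta"
    using two_cos13_antimono[of 1 4] two_cos13_antimono[of 5 6]
    by (simp add: period_differences period0_def period2_def)
  have a: "0 < alpha"
    using two_cos13_antimono[of 2 4] two_cos13_antimono[of 3 6]
    by (simp add: period_differences period1_def period2_def)
  have "alpha * beta * (alpha - beta) = beta ^ 2 - alpha * beta + alpha ^ 2"
    unfolding period_differences using period_relations by algebra
  also have "\<dots> = (beta - alpha / 2) ^ 2 + 3 / 4 * alpha ^ 2"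
    by (simp add: power2_eq_square algebra_simps)
  also have "\<dots> > 0" using a by (intro add_nonneg_pos) auto
  finally have "0 < alpha * beta * (alpha - beta)" .
  then have "0 < alpha - beta" by (rule zero_less_mult_pos) (use a b in simp)
  then show "beta < alpha" by simp
qed

text \<open>The quotient \<open>\<beta> / \<alpha>\<close> lies in \<open>(0, 1)\<close> and satisfies the cubic equation that characterises \<open>\<rho>\<close>.\<close>

lemma rho_eq: "beta = rho * alpha"
proof -
  have a: "0 < alpha" using beta_less_alpha by linarith
  have "beta ^ 3 - 4 * beta ^ 2 * alpha + beta * alpha ^ 2 + alpha ^ 3 = 0"
    unfolding period_differences using period_relations by algebra
  then have "(beta / alpha) ^ 3 - 4 * (beta / alpha) ^ 2 + beta / alpha + 1 = 0"
    using a by (simp add: field_simps power2_eq_square power3_eq_cube)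
  moreover have "0 < beta / alpha" "beta / alpha < 1" using a beta_less_alpha by simp_all
  ultimately have "beta / alpha = rho" using rho_unique rho by blast
  then show ?thesis using a by (simp add: field_simps)
qed

lemma gamma_eq: "gamma = (1 - rho) * alpha"
  using rho_eq by (simp add: period_differences algebra_simps)

lemma alpha_plus_1: "(alpha + 1) * (rho * (1 - rho)) = 1"
proof -
  have a: "0 < alpha" using beta_less_alpha by linarith
  have "alpha * beta * (alpha - beta) = beta ^ 2 - alpha * beta + alpha ^ 2"
    unfolding period_differences using period_relations by algebra
  then have "alpha ^ 2 * (alpha * (rho * (1 - rho))) = alpha ^ 2 * (rho ^ 2 - rho + 1)"
    unfolding rho_eq by (simp add: algebra_simps power2_eq_square)
  then have "alpha * (rho * (1 - rho)) = rho ^ 2 - rho + 1" using a by simp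
  then show ?thesis by algebra
qed

text \<open>The quotient of the difference \<open>f(y) - f(\<rho>)\<close> of values of the cubic by \<open>\<rho> - y\<close> is
\<open>1 / \<rho> + y (4 - \<rho> - y) > 0\<close>, so numerical bounds for \<open>\<rho>\<close> reduce to signs of the cubic.\<close>

lemma rho_compare:
  assumes "0 < y" "y < 1"
  shows "y < rho \<longleftrightarrow> y ^ 3 - 4 * y ^ 2 + y + 1 > 0" "rho < y \<longleftrightarrow> y ^ 3 - 4 * y ^ 2 + y + 1 < 0"
proof -
  define B where "B = 1 / rho + y * (4 - rho - y)"
  have "B > 0" unfolding B_def
    using assms rho by (intro add_pos_nonneg mult_nonneg_nonneg) auto
  have "1 / rho = - (rho ^ 2 - 4 * rho + 1)"
    using rho by (simp add: field_simps power2_eq_square power3_eq_cube)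
  then have "(rho - y) * B = y ^ 3 - 4 * y ^ 2 + y + 1"
    unfolding B_def using rho(3) by algebra
  then have "y ^ 3 - 4 * y ^ 2 + y + 1 > 0 \<longleftrightarrow> (rho - y) * B > 0"
    "y ^ 3 - 4 * y ^ 2 + y + 1 < 0 \<longleftrightarrow> (rho - y) * B < 0" by simp_all
  with \<open>B > 0\<close> show "y < rho \<longleftrightarrow> y ^ 3 - 4 * y ^ 2 + y + 1 > 0"
    "rho < y \<longleftrightarrow> y ^ 3 - 4 * y ^ 2 + y + 1 < 0"
    by (auto simp: zero_less_mult_iff mult_less_0_iff)
qed

lemma rho_bounds: "7261 / 10000 < rho" "rho < 72611 / 100000"
proof -
  show "7261 / 10000 < rho"
    by (rule rho_compare(1)[THEN iffD2]) (simp_all add: power2_eq_square power3_eq_cube)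
  show "rho < 72611 / 100000"
    by (rule rho_compare(2)[THEN iffD2]) (simp_all add: power2_eq_square power3_eq_cube)
qed

lemma rho_4_sigma0: "rho ^ 4 * sigma0 = 1 - rho"
  using rho by (simp add: sigma0_def)

lemma one_minus_sigma0: "rho ^ 3 * (1 - sigma0) = (1 - rho) ^ 4"
proof -
  have "rho ^ 4 * (rho ^ 3 * (1 - sigma0)) = rho ^ 4 * (1 - rho) ^ 4"
    using rho_4_sigma0 rho(3) by algebra
  then show ?thesis using rho(1) by (simp only: mult_cancel_left) auto
qed

lemma sigma0_bounds: "0 < sigma0" "sigma0 < 1"
proof -
  show "0 < sigma0" using rho by (simp add: sigma0_def)
  have "0 < rho ^ 3 * (1 - sigma0)" unfolding one_minus_sigma0 using rho by simp
  then show "sigma0 < 1" using rho by (simp add: zero_less_mult_iff)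
qed

text \<open>With \<open>\<rho>^4 \<sigma> = 1 - \<rho>\<close> this is the second of the two equations for the critical point.\<close>

lemma rho_13_sigma0: "rho ^ 13 * sigma0 ^ 4 = 1 - sigma0"
proof -
  have "rho ^ 3 * (rho ^ 13 * sigma0 ^ 4) = (rho ^ 4 * sigma0) ^ 4"
    by (simp add: power_mult_distrib flip: power_mult power_add)
  also have "\<dots> = rho ^ 3 * (1 - sigma0)" unfolding rho_4_sigma0 one_minus_sigma0 ..
  finally show ?thesis using rho(1) by (simp only: mult_cancel_left) auto
qed

text \<open>The left-hand factor is the Hessian determinant at the critical point up to elementary factors, see \<open>hessian_constant\<close>.\<close>

lemma kappa_hessian: "rho ^ 2 * ((4 - 3 * rho) * (4 - 3 * sigma0) - 13 * (1 - rho) * (1 - sigma0)) = 13 * (1 - rho) ^ 2"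
proof -
  have "rho ^ 4 * (rho ^ 2 * ((4 - 3 * rho) * (4 - 3 * sigma0) - 13 * (1 - rho) * (1 - sigma0)))
     = rho ^ 4 * (13 * (1 - rho) ^ 2)"
    using rho_4_sigma0 rho(3) by algebra
  then show ?thesis using rho(1) by (simp only: mult_cancel_left) auto
qed

lemma kappa_eq: "kappa = rho / ((1 - rho) * sqrt 13)"
proof -
  have "rho * ((alpha + 1) * (rho * (1 - rho))) = rho" using alpha_plus_1 by simp
  then have "rho ^ 2 * (alpha + 1) * (1 - rho) = rho" by (simp add: power2_eq_square mult_ac)
  then have "rho ^ 2 * (alpha + 1) = rho / (1 - rho)" using rho by (simp add: nonzero_eq_divide_eq)
  then show ?thesis by (simp add: kappa_def)
qed

text \<open>A factor \<open>q^n\<close> has limit 1, so these are the amplitudes of the three combinations. Each follows from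
\<open>\<rho>^4 \<sigma> = 1 - \<rho>\<close> and \<open>(\<alpha> + 1) \<rho> (1 - \<rho>) = 1\<close>.\<close>

lemma amplitude_identities:
  "kappa * (1 + rho ^ 2 * sigma0) = alpha / sqrt 13"
  "kappa * (1 + rho ^ 7 * sigma0 ^ 2) = beta / sqrt 13"
  "kappa * (rho ^ 4 * sigma0 + rho ^ 6 * sigma0 ^ 2) = gamma / sqrt 13"
proof -
  have "rho ^ 2 * (alpha + 1) * (1 + rho ^ 2 * sigma0) = alpha"
    using rho_4_sigma0 alpha_plus_1 by algebra
  then show "kappa * (1 + rho ^ 2 * sigma0) = alpha / sqrt 13" by (simp add: kappa_def)
  have "rho * (rho ^ 2 * (alpha + 1) * (1 + rho ^ 7 * sigma0 ^ 2)) = rho * beta"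
    unfolding rho_eq using rho_4_sigma0 alpha_plus_1 by algebra
  then have "rho ^ 2 * (alpha + 1) * (1 + rho ^ 7 * sigma0 ^ 2) = beta"
    using rho(1) by (simp only: mult_cancel_left) auto
  then show "kappa * (1 + rho ^ 7 * sigma0 ^ 2) = beta / sqrt 13" by (simp add: kappa_def)
  have "rho ^ 2 * (alpha + 1) * (rho ^ 4 * sigma0 + rho ^ 6 * sigma0 ^ 2) = gamma"
    unfolding gamma_eq using rho_4_sigma0 alpha_plus_1 by algebra
  then show "kappa * (rho ^ 4 * sigma0 + rho ^ 6 * sigma0 ^ 2) = gamma / sqrt 13" by (simp add: kappa_def)
qed

section \<open>The dilogarithm and its five-term relation\<close>

text \<open>The term for \<open>n = 0\<close> is \<open>1 / 0 = 0\<close>. Starting the sum at 0 makes the series a power series to which termwise differentiation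
applies directly.\<close>

definition dilog :: "real \<Rightarrow> real" where
  "dilog x = (\<Sum>n. x ^ n / real n ^ 2)"

lemma summable_inverse_squares_real: "summable (\<lambda>n. 1 / real n ^ 2)"
  using inverse_power_summable[of 2, where ?'a = real] by (simp add: divide_inverse)

lemma dilog_term_le: "\<bar>x\<bar> \<le> 1 \<Longrightarrow> norm (x ^ n / real n ^ 2) \<le> 1 / real n ^ 2"
  by (auto simp: power_abs divide_right_mono power_le_one)

lemma summable_dilog: "\<bar>x\<bar> \<le> 1 \<Longrightarrow> summable (\<lambda>n. x ^ n / real n ^ 2)"
  by (rule summable_comparison_test'[OF summable_inverse_squares_real dilog_term_le])

lemma continuous_on_dilog: "continuous_on {-1..1} dilog"
proof -
  have "uniform_limit {-1..1} (\<lambda>n x. \<Sum>i<n. x ^ i / real i ^ 2) (\<lambda>x. \<Sum>i. x ^ i / real i ^ 2) sequentially"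
    by (rule Weierstrass_m_test[OF dilog_term_le summable_inverse_squares_real]) auto
  then show ?thesis unfolding dilog_def
    by (rule uniform_limit_theorem[rotated]) (auto simp: divide_inverse intro!: always_eventually continuous_intros)
qed

lemma dilog_0 [simp]: "dilog 0 = 0"
proof -
  have "(\<lambda>n. 0 ^ n / real n ^ 2) = (\<lambda>n. 0)"
    by (auto simp: fun_eq_iff power_0_left)
  then show ?thesis by (simp add: dilog_def)
qed

lemma dilog_1: "dilog 1 = pi ^ 2 / 6"
proof -
  have "(\<lambda>n. 1 ^ Suc n / real (Suc n) ^ 2) sums (pi ^ 2 / 6)"
    using inverse_squares_sums by (simp add: add.commute)
  then have "(\<lambda>n. 1 ^ n / real n ^ 2) sums (pi ^ 2 / 6)"
    by (subst (asm) sums_Suc_iff) simp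
  then show ?thesis by (simp add: dilog_def sums_iff)
qed

lemma ln_1_minus_sums: "\<bar>x\<bar> < 1 \<Longrightarrow> (\<lambda>n. x ^ n / real n) sums (- ln (1 - x))"
  using sums_minus[OF ln_series'[of "- x"]] by simp

lemma has_field_derivative_dilog:
  assumes "\<bar>x\<bar> < 1" "x \<noteq> 0"
  shows "(dilog has_field_derivative - ln (1 - x) / x) (at x)"
proof -
  have "((\<lambda>z. \<Sum>n. (1 / real n ^ 2) * z ^ n) has_field_derivative
      (\<Sum>n. diffs (\<lambda>n. 1 / real n ^ 2) n * x ^ n)) (at x)"
    using assms by (intro termdiffs_strong'[where K = 1])
      (use summable_dilog in \<open>auto simp: real_norm_def\<close>)
  moreover have "(\<lambda>n. diffs (\<lambda>n. 1 / real n ^ 2) n * x ^ n) sums (- ln (1 - x) / x)"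
  proof -
    have "(\<lambda>n. x ^ Suc n / real (Suc n)) sums (- ln (1 - x))"
      using ln_1_minus_sums[OF assms(1)] by (subst sums_Suc_iff) simp
    from sums_divide[OF this, of x] have "(\<lambda>n. x ^ Suc n / real (Suc n) / x) sums (- ln (1 - x) / x)" .
    moreover have "diffs (\<lambda>n. 1 / real n ^ 2) n * x ^ n = x ^ Suc n / real (Suc n) / x" for n
    proof -
      have "r * (1 / r ^ 2) = 1 / r" for r :: real
        by (cases "r = 0") (simp_all add: power2_eq_square)
      from this[of "real (Suc n)"] show ?thesis
        using assms(2) by (simp add: diffs_def del: of_nat_Suc)
    qed
    ultimately show ?thesis by simp
  qed
  ultimately show ?thesis by (simp add: dilog_def[abs_def] sums_iff)
qed

lemma has_field_derivative_dilog' [derivative_intros]: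
  assumes "(f has_field_derivative f') (at x within S)" "0 < f x" "f x < 1"
  shows "((\<lambda>x. dilog (f x)) has_field_derivative (- ln (1 - f x) / f x) * f') (at x within S)"
  by (rule DERIV_chain2[OF has_field_derivative_dilog assms(1)]) (use assms in auto)

text \<open>Since \<open>ln 0 = 0\<close>, this also gives the usual values at 0 and 1.\<close>

definition rogers :: "real \<Rightarrow> real" where
  "rogers x = dilog x + ln x * ln (1 - x) / 2"

lemma has_field_derivative_rogers [derivative_intros]:
  assumes "(f has_field_derivative f') (at x within S)" "0 < f x" "f x < 1"
  shows "((\<lambda>x. rogers (f x)) has_field_derivative
           (- (ln (1 - f x) / f x + ln (f x) / (1 - f x)) / 2) * f') (at x within S)"
  unfolding rogers_def using assms
  by (auto intro!: derivative_eq_intros simp: field_simps)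

lemma isCont_rogers: "0 < x \<Longrightarrow> x < 1 \<Longrightarrow> isCont rogers x"
  by (rule DERIV_isCont[OF has_field_derivative_rogers[OF DERIV_ident, of x]]) auto

lemma tendsto_rogers_0: "(rogers \<longlongrightarrow> 0) (at_right 0)"
proof -
  have "(dilog \<longlongrightarrow> dilog 0) (at 0 within {-1..1})"
    using continuous_on_dilog unfolding continuous_on_def by (rule bspec) simp
  then have "(dilog \<longlongrightarrow> dilog 0) (at 0 within {0<..1})"
    by (rule tendsto_within_subset) auto
  moreover have "((\<lambda>x::real. ln x * ln (1 - x)) \<longlongrightarrow> 0) (at_right 0)" by real_asymp
  moreover have "at (0::real) within {0<..1} = at_right 0"
    by (rule at_within_nhd[of _ "{..<1}"]) auto
  ultimately have "((\<lambda>x. dilog x + ln x * ln (1 - x) / 2) \<longlongrightarrow> dilog 0 + 0 / 2) (at_right 0)"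
    by (intro tendsto_intros) auto
  then show ?thesis by (simp add: rogers_def[abs_def])
qed

lemma tendsto_rogers_1: "((\<lambda>x. rogers (1 - x)) \<longlongrightarrow> pi ^ 2 / 6) (at_right 0)"
proof -
  have "continuous_on {0..1} (\<lambda>x. dilog (1 - x))"
    by (rule continuous_on_compose2[OF continuous_on_dilog]) (auto intro!: continuous_intros)
  then have "((\<lambda>x. dilog (1 - x)) \<longlongrightarrow> dilog (1 - 0)) (at 0 within {0..1})"
    unfolding continuous_on_def by fastforce
  then have "((\<lambda>x. dilog (1 - x)) \<longlongrightarrow> dilog (1 - 0)) (at 0 within {0<..1})"
    by (rule tendsto_within_subset) auto
  moreover have "((\<lambda>x::real. ln (1 - x) * ln x) \<longlongrightarrow> 0) (at_right 0)" by real_asymp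
  moreover have "at (0::real) within {0<..1} = at_right 0"
    by (rule at_within_nhd[of _ "{..<1}"]) auto
  ultimately have "((\<lambda>x. dilog (1 - x) + ln (1 - x) * ln x / 2) \<longlongrightarrow> dilog (1 - 0) + 0 / 2) (at_right 0)"
    by (intro tendsto_intros) auto
  then show ?thesis by (simp add: rogers_def[abs_def] dilog_1)
qed

text \<open>Functional equations of the dilogarithm are proved by differentiation; the constant of integration is read off at the left
endpoint.\<close>

lemma eq_limit_of_DERIV_0:
  fixes f :: "real \<Rightarrow> real"
  assumes "\<And>x. 0 < x \<Longrightarrow> x < 1 \<Longrightarrow> (f has_field_derivative 0) (at x)"
    and "(f \<longlongrightarrow> L) (at_right 0)" "0 < x" "x < 1"
  shows "f x = L"
proof -
  have "f y = f x" if "0 < y" "y < 1" for y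
    using DERIV_isconst3[of 0 1 y x f] assms that by auto
  then have "eventually (\<lambda>y. f y = f x) (at_right 0)"
    by (auto intro!: eventually_at_rightI[of _ 1])
  then have "(f \<longlongrightarrow> f x) (at_right 0)" by (rule tendsto_eventually)
  then show ?thesis using assms(2) by (rule tendsto_unique[OF trivial_limit_at_right_real])
qed

lemma rogers_reflection: "0 < x \<Longrightarrow> x < 1 \<Longrightarrow> rogers x + rogers (1 - x) = pi ^ 2 / 6"
  by (rule eq_limit_of_DERIV_0[where f = "\<lambda>x. rogers x + rogers (1 - x)"])
    (auto intro!: derivative_eq_intros tendsto_eq_intros tendsto_rogers_0 tendsto_rogers_1 simp: field_simps)

text \<open>The derivative of the five-term relation in \<open>x\<close>, with the logarithms of \<open>x, 1 - x, y, 1 - y, 1 - x y\<close> replaced by independent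
variables \<open>a, b, c, d, e\<close>: it vanishes coefficient by coefficient.\<close>

lemma rogers_derivative_cancel:
  fixes x y a b c d e :: real
  assumes ne: "x \<noteq> 0" "1 - x \<noteq> 0" "y \<noteq> 0" "1 - y \<noteq> 0" "1 - x * y \<noteq> 0"
  shows "- (b / x + a / (1 - x)) / 2 * 1
      - (- (e / (x * y) + (a + c) / (1 - x * y)) / 2) * y
      - (- ((b - e) / (x * (1 - y) / (1 - x * y)) + (a + d - e) / ((1 - x) / (1 - x * y))) / 2) * ((1 - y) / (1 - x * y) ^ 2)
      - (- ((d - e) / (y * (1 - x) / (1 - x * y)) + (c + b - e) / ((1 - y) / (1 - x * y))) / 2) * (- (y * (1 - y) / (1 - x * y) ^ 2)) = 0"
proof -
  define X Y Z p q where "X = 1 - x" and "Y = 1 - y" and "Z = 1 - x * y" and "p = inverse x" and "q = inverse y"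
  define iX iY iZ where "iX = inverse X" and "iY = inverse Y" and "iZ = inverse Z"
  have inv: "x * p = 1" "y * q = 1" "X * iX = 1" "Y * iY = 1" "Z * iZ = 1"
    using ne by (simp_all add: X_def Y_def Z_def p_def q_def iX_def iY_def iZ_def)
  have r: "X = 1 - x" "Y = 1 - y" "Z = 1 - x * y" by (simp_all add: X_def Y_def Z_def)
  have t1: "(e * (q * p) + (a + c) * iZ) * y = e * p + (a + c) * (y * iZ)"
  proof -
    have "(e * (q * p) + (a + c) * iZ) * y = e * p * (y * q) + (a + c) * (y * iZ)"
      by (simp only: ring_distribs mult_ac)
    then show ?thesis by (simp add: inv(2))
  qed
  have t2: "((b - e) * (p * iY * Z) + (a + d - e) * (iX * Z)) * (Y * iZ ^ 2)
      = (b - e) * (p * iZ) + (a + d - e) * (iX * Y * iZ)"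
  proof -
    have "((b - e) * (p * iY * Z) + (a + d - e) * (iX * Z)) * (Y * iZ ^ 2)
      = (b - e) * (p * iZ) * ((Y * iY) * (Z * iZ)) + (a + d - e) * (iX * Y * iZ) * (Z * iZ)"
      by (simp add: power2_eq_square algebra_simps)
    then show ?thesis by (simp add: inv(4,5))
  qed
  have t3: "((d - e) * (q * iX * Z) + (c + b - e) * (iY * Z)) * (y * Y * iZ ^ 2)
      = (d - e) * (iX * Y * iZ) + (c + b - e) * (y * iZ)"
  proof -
    have "((d - e) * (q * iX * Z) + (c + b - e) * (iY * Z)) * (y * Y * iZ ^ 2)
      = (d - e) * (iX * Y * iZ) * ((y * q) * (Z * iZ)) + (c + b - e) * (y * iZ) * ((Y * iY) * (Z * iZ))"
      by (simp add: power2_eq_square algebra_simps)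
    then show ?thesis by (simp add: inv(2,4,5))
  qed
  \<comment> \<open>The coefficient of \<open>e - b\<close> vanishes by \<open>k1\<close> and that of \<open>a\<close> by \<open>k2\<close>; those of \<open>c\<close> and \<open>d\<close> cancel outright.\<close>
  have k1: "p = p * iZ - y * iZ"
  proof -
    have "p * iZ - y * iZ = p * iZ * (1 - y * x) + (p * x - 1) * y * iZ"
      by (simp add: algebra_simps)
    also have "\<dots> = p * (Z * iZ)" using inv(1) by (simp add: r(3) mult_ac)
    finally show ?thesis by (simp add: inv(5))
  qed
  have k2: "iX = y * iZ + iX * Y * iZ"
  proof -
    have "y * iZ + iX * Y * iZ = iX * iZ * (y * X + Y) - (X * iX - 1) * y * iZ"
      by (simp add: algebra_simps)
    also have "y * X + Y = Z" by (simp add: r algebra_simps)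
    also have "iX * iZ * Z - (X * iX - 1) * y * iZ = iX * (Z * iZ)" using inv(3) by simp
    finally show ?thesis by (simp add: inv(5))
  qed
  have half: "- A / 2 * 1 - (- B / 2) * y - (- C / 2) * D - (- E / 2) * (- G) = (- A + B * y + C * D - E * G) / 2"
    for A B C D E G :: real by (simp add: add_divide_distrib diff_divide_distrib)
  have S: "- (b * p + a * iX) + (e * p + (a + c) * (y * iZ))
      + ((b - e) * (p * iZ) + (a + d - e) * (iX * Y * iZ))
      - ((d - e) * (iX * Y * iZ) + (c + b - e) * (y * iZ)) = 0"
  proof -
    have "- (b * p + a * iX) + (e * p + (a + c) * (y * iZ))
      + ((b - e) * (p * iZ) + (a + d - e) * (iX * Y * iZ))
      - ((d - e) * (iX * Y * iZ) + (c + b - e) * (y * iZ))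
      = (e - b) * (p - (p * iZ - y * iZ)) - a * (iX - (y * iZ + iX * Y * iZ))"
      by (simp add: algebra_simps)
    then show ?thesis using k1 k2 by simp
  qed
  have d: "b / x + a / (1 - x) = b * p + a * iX" "e / (x * y) + (a + c) / (1 - x * y) = e * (q * p) + (a + c) * iZ"
    "(b - e) / (x * (1 - y) / (1 - x * y)) + (a + d - e) / ((1 - x) / (1 - x * y)) = (b - e) * (p * iY * Z) + (a + d - e) * (iX * Z)"
    "(d - e) / (y * (1 - x) / (1 - x * y)) + (c + b - e) / ((1 - y) / (1 - x * y)) = (d - e) * (q * iX * Z) + (c + b - e) * (iY * Z)"
    "(1 - y) / (1 - x * y) ^ 2 = Y * iZ ^ 2" "y * (1 - y) / (1 - x * y) ^ 2 = y * Y * iZ ^ 2"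
    unfolding X_def[symmetric] Y_def[symmetric] Z_def[symmetric]
    by (simp_all only: p_def q_def iX_def iY_def iZ_def divide_inverse inverse_mult_distrib
        inverse_inverse_eq power_inverse mult.commute[of "inverse y" "inverse x"])
  show ?thesis unfolding d half t1 t2 t3 S by simp
qed

text \<open>As \<open>x\<close> tends to 0 the first three arguments tend to 0 and the last one to \<open>y\<close>, which fixes the constant.\<close>

lemma rogers_five_term_aux:
  assumes x: "0 < x" "x < 1" and y: "0 < y" "y < 1"
  shows "rogers x - rogers (x * y) - rogers (x * (1 - y) / (1 - x * y))
     - rogers (y * (1 - x) / (1 - x * y)) = - rogers y"
proof (rule eq_limit_of_DERIV_0[OF _ _ x, where f = "\<lambda>x. rogers x - rogers (x * y)
     - rogers (x * (1 - y) / (1 - x * y)) - rogers (y * (1 - x) / (1 - x * y))"])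
  fix x :: real assume x: "0 < x" "x < 1"
  have xy: "0 < x * y" "x * y < 1" using x y mult_strict_mono[of x 1 y 1] by auto
  let ?d = "1 - x * y"
  have d: "?d > 0" using xy by simp
  have ne: "?d \<noteq> 0" using d by simp
  have u1: "1 - x * (1 - y) / ?d = (1 - x) / ?d" and w1: "1 - y * (1 - x) / ?d = (1 - y) / ?d"
    using ne by (simp_all add: diff_divide_eq_iff) (simp_all add: algebra_simps)
  have u: "0 < x * (1 - y) / ?d" "x * (1 - y) / ?d < 1"
    using divide_pos_pos[OF mult_pos_pos d, of x "1 - y"] divide_pos_pos[OF _ d, of "1 - x"] u1 x y by simp_all
  have w: "0 < y * (1 - x) / ?d" "y * (1 - x) / ?d < 1"
    using divide_pos_pos[OF mult_pos_pos d, of y "1 - x"] divide_pos_pos[OF _ d, of "1 - y"] w1 x y by simp_all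
  have dxy: "((\<lambda>x. x * y) has_field_derivative y) (at x)"
    by (auto intro!: derivative_eq_intros)
  have dd: "((\<lambda>x. 1 - x * y) has_field_derivative - y) (at x)"
    by (auto intro!: derivative_eq_intros)
  have "((\<lambda>x. x * (1 - y)) has_field_derivative 1 - y) (at x)"
    by (auto intro!: derivative_eq_intros)
  from DERIV_divide[OF this dd ne]
  have du: "((\<lambda>x. x * (1 - y) / (1 - x * y)) has_field_derivative (1 - y) / ?d ^ 2) (at x)"
    by (rule DERIV_cong) (simp add: power2_eq_square algebra_simps)
  have "((\<lambda>x. y * (1 - x)) has_field_derivative - y) (at x)"
    by (auto intro!: derivative_eq_intros)
  from DERIV_divide[OF this dd ne]
  have dw: "((\<lambda>x. y * (1 - x) / (1 - x * y)) has_field_derivative - (y * (1 - y) / ?d ^ 2)) (at x)"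
    by (rule DERIV_cong) (simp add: power2_eq_square minus_divide_left algebra_simps)
  have ln_eqs: "ln (x * y) = ln x + ln y" "ln (x * (1 - y) / ?d) = ln x + ln (1 - y) - ln ?d"
    "ln (y * (1 - x) / ?d) = ln y + ln (1 - x) - ln ?d"
    "ln ((1 - x) / ?d) = ln (1 - x) - ln ?d" "ln ((1 - y) / ?d) = ln (1 - y) - ln ?d"
    using x y d by (simp_all add: ln_mult ln_div)
  show "((\<lambda>x. rogers x - rogers (x * y) - rogers (x * (1 - y) / (1 - x * y))
     - rogers (y * (1 - x) / (1 - x * y))) has_field_derivative 0) (at x)"
  proof (rule DERIV_cong)
    show "((\<lambda>x. rogers x - rogers (x * y) - rogers (x * (1 - y) / (1 - x * y))
     - rogers (y * (1 - x) / (1 - x * y))) has_field_derivative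
     (- (ln (1 - x) / x + ln x / (1 - x)) / 2 * 1
      - (- (ln ?d / (x * y) + ln (x * y) / ?d) / 2) * y
      - (- (ln (1 - x * (1 - y) / ?d) / (x * (1 - y) / ?d) + ln (x * (1 - y) / ?d) / (1 - x * (1 - y) / ?d)) / 2) * ((1 - y) / ?d ^ 2)
      - (- (ln (1 - y * (1 - x) / ?d) / (y * (1 - x) / ?d) + ln (y * (1 - x) / ?d) / (1 - y * (1 - x) / ?d)) / 2) * (- (y * (1 - y) / ?d ^ 2)))) (at x)"
      by (rule DERIV_diff[OF DERIV_diff[OF DERIV_diff[OF
            has_field_derivative_rogers[OF DERIV_ident x]
            has_field_derivative_rogers[OF dxy xy]]
            has_field_derivative_rogers[OF du u]] has_field_derivative_rogers[OF dw w]])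
    define a b c d' e where "a = ln x" and "b = ln (1 - x)" and "c = ln y" and "d' = ln (1 - y)" and "e = ln ?d"
    have "- (b / x + a / (1 - x)) / 2 * 1
      - (- (e / (x * y) + (a + c) / ?d) / 2) * y
      - (- ((b - e) / (x * (1 - y) / ?d) + (a + d' - e) / ((1 - x) / ?d)) / 2) * ((1 - y) / ?d ^ 2)
      - (- ((d' - e) / (y * (1 - x) / ?d) + (c + b - e) / ((1 - y) / ?d)) / 2) * (- (y * (1 - y) / ?d ^ 2)) = 0"
      by (rule rogers_derivative_cancel) (use x y d in auto)
    then show "- (ln (1 - x) / x + ln x / (1 - x)) / 2 * 1
      - (- (ln ?d / (x * y) + ln (x * y) / ?d) / 2) * y
      - (- (ln (1 - x * (1 - y) / ?d) / (x * (1 - y) / ?d) + ln (x * (1 - y) / ?d) / (1 - x * (1 - y) / ?d)) / 2) * ((1 - y) / ?d ^ 2)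
      - (- (ln (1 - y * (1 - x) / ?d) / (y * (1 - x) / ?d) + ln (y * (1 - x) / ?d) / (1 - y * (1 - x) / ?d)) / 2) * (- (y * (1 - y) / ?d ^ 2)) = 0"
      unfolding u1 w1 ln_eqs a_def b_def c_def d'_def e_def .
  qed
next
  have fl0: "filterlim f (at_right 0) (at_right 0)"
    if "(f \<longlongrightarrow> 0) (at_right 0)" "\<And>x. 0 < x \<Longrightarrow> x < 1 \<Longrightarrow> f x > 0" for f :: "real \<Rightarrow> real"
  proof -
    have "eventually (\<lambda>x. 0 < f x) (at_right 0)"
      using that(2) by (auto intro!: eventually_at_rightI[of _ 1])
    then show ?thesis by (auto simp: filterlim_at that(1) elim!: eventually_mono)
  qed
  have xy: "0 < x * y" "x * y < 1" if "0 < x" "x < 1" for x :: real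
    using that y mult_strict_mono[of x 1 y 1] by auto
  have "((\<lambda>x. rogers (x * y)) \<longlongrightarrow> 0) (at_right 0)"
    by (rule filterlim_compose[OF tendsto_rogers_0 fl0])
      (use xy in \<open>auto intro!: tendsto_eq_intros\<close>)
  moreover have "((\<lambda>x. rogers (x * (1 - y) / (1 - x * y))) \<longlongrightarrow> 0) (at_right 0)"
  proof (rule filterlim_compose[OF tendsto_rogers_0 fl0])
    show "((\<lambda>x. x * (1 - y) / (1 - x * y)) \<longlongrightarrow> 0) (at_right 0)"
      by (auto intro!: tendsto_eq_intros)
  qed (use xy y in auto)
  moreover have "((\<lambda>x. rogers (y * (1 - x) / (1 - x * y))) \<longlongrightarrow> rogers y) (at_right 0)"
    by (rule isCont_tendsto_compose[OF isCont_rogers[OF y]]) (auto intro!: tendsto_eq_intros)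
  ultimately show "((\<lambda>x. rogers x - rogers (x * y) - rogers (x * (1 - y) / (1 - x * y))
     - rogers (y * (1 - x) / (1 - x * y))) \<longlongrightarrow> - rogers y) (at_right 0)"
    using tendsto_rogers_0 by (auto intro!: tendsto_eq_intros)
qed

text \<open>Stating the arguments by polynomial equations leaves only ring identities to check when they are elements of a number field.\<close>

lemma rogers_five_term:
  assumes "0 < x" "x < 1" "0 < y" "y < 1" "x * y = z"
    and "u * (1 - z) = x * (1 - y)" "w * (1 - z) = y * (1 - x)"
  shows "rogers x + rogers y = rogers z + rogers u + rogers w"
proof -
  have "1 - z \<noteq> 0" using assms mult_strict_mono[of x 1 y 1] by auto
  then have "u = x * (1 - y) / (1 - x * y)" "w = y * (1 - x) / (1 - x * y)"
    using assms(5-7) by (simp_all add: nonzero_eq_divide_eq)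
  then show ?thesis using rogers_five_term_aux[OF assms(1-4)] assms(5) by simp
qed

section \<open>The dilogarithm identity in the cubic field\<close>

text \<open>Elements of the cubic field in coordinates, so that products are computed on rational coefficients by \<open>cubic_elem_mult\<close>.\<close>

definition cubic_elem :: "real \<Rightarrow> real \<Rightarrow> real \<Rightarrow> real" where
  "cubic_elem a b c = a + b * rho + c * rho ^ 2"

lemma cubic_elem_mult:
  "cubic_elem a b c * cubic_elem a' b' c' =
    cubic_elem (a * a' - (b * c' + c * b') - 4 * c * c')
      (a * b' + b * a' - (b * c' + c * b') - 5 * c * c')
      (a * c' + b * b' + c * a' + 4 * (b * c' + c * b') + 15 * c * c')"
proof -
  have 3: "rho ^ 3 = 4 * rho ^ 2 - rho - 1" using rho(3) by simp
  have 4: "rho ^ 4 = 15 * rho ^ 2 - 5 * rho - 4" using rho(3) by algebra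
  have "cubic_elem a b c * cubic_elem a' b' c' =
      a * a' + (a * b' + b * a') * rho + (a * c' + b * b' + c * a') * rho ^ 2
      + (b * c' + c * b') * rho ^ 3 + c * c' * rho ^ 4"
    by (simp add: cubic_elem_def algebra_simps power2_eq_square power3_eq_cube power4_eq_xxxx)
  then show ?thesis unfolding 3 4 by (simp add: cubic_elem_def algebra_simps)
qed

lemma one_minus_cubic_elem: "1 - cubic_elem a b c = cubic_elem (1 - a) (- b) (- c)"
  by (simp add: cubic_elem_def)

lemma rho_squared_bounds: "5272 / 10000 < rho ^ 2" "rho ^ 2 < 52724 / 100000"
proof -
  have "(7261 / 10000) * (7261 / 10000) < rho * rho"
    using rho_bounds by (intro mult_strict_mono) auto
  then show "5272 / 10000 < rho ^ 2" by (simp add: power2_eq_square)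
  have "rho * rho < (72611 / 100000) * (72611 / 100000)"
    using rho_bounds rho by (intro mult_strict_mono) auto
  then show "rho ^ 2 < 52724 / 100000" by (simp add: power2_eq_square)
qed

lemma sigma0_eq_cubic_elem: "sigma0 = cubic_elem 41 (- 66) 15"
proof -
  have "rho ^ 4 * sigma0 = rho ^ 4 * cubic_elem 41 (- 66) 15"
    unfolding rho_4_sigma0 cubic_elem_def using rho(3) by algebra
  then show ?thesis using rho(1) by (simp only: mult_cancel_left) auto
qed

text \<open>In the exterior square of the unit group one has
\<open>13 (1 - \<rho>) \<and> \<rho> + (1 - \<sigma>) \<and> \<sigma> = 0\<close>, because
\<open>\<sigma> = (1 - \<rho>) / \<rho>^4\<close> and \<open>1 - \<sigma> = (1 - \<rho>)^4 / \<rho>^3\<close>. Over a totally real field this makes the corresponding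
element of the Bloch group a torsion element, so that some multiple of the identity is a combination of five-term relations. All arguments used
here, and their complements to 1, are products of powers of \<open>\<rho>\<close>, \<open>1 - \<rho>\<close>, \<open>1 + \<rho>\<close> and
\<open>2 - \<rho>\<close>; the last two have norm \<open>\<pm>5\<close>, and the units alone admit too few relations. The relations
\<open>r1, ..., r9\<close> enter with coefficients \<open>1, -1, -1, 2, 2, 2, -2, 2, 1\<close>. The term that involves \<open>\<sigma>\<close> is in \<open>r1\<close>.\<close>

lemma rogers_identity: "13 * rogers rho + rogers sigma0 = 10 * (pi ^ 2 / 6)"
proof -
  note bounds = rho_bounds rho_squared_bounds
  have r1: "rogers (cubic_elem 0 0 1) + rogers (cubic_elem 41 (-66) 15)
      = rogers (cubic_elem 6 (-9) 2) + rogers (cubic_elem (2 / 5) (-7 / 5) (6 / 5)) + rogers (cubic_elem (-18 / 5) (38 / 5) (-9 / 5))"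
    by (rule rogers_five_term; (simp only: cubic_elem_mult one_minus_cubic_elem, simp)?;
        use bounds in \<open>simp add: cubic_elem_def\<close>)
  have r2: "rogers (cubic_elem (4 / 25) (-9 / 25) (7 / 25)) + rogers (cubic_elem 14 (-22) 5)
      = rogers (cubic_elem (23 / 5) (-38 / 5) (9 / 5)) + rogers (cubic_elem (2 / 5) (-7 / 5) (6 / 5)) + rogers (cubic_elem (-1) 3 (-1))"
    by (rule rogers_five_term; (simp only: cubic_elem_mult one_minus_cubic_elem, simp)?;
        use bounds in \<open>simp add: cubic_elem_def\<close>)
  have r3: "rogers (cubic_elem (2 / 5) (-2 / 5) (1 / 5)) + rogers (cubic_elem (2 / 5) (-2 / 5) (1 / 5))
      = rogers (cubic_elem (4 / 25) (-9 / 25) (7 / 25)) + rogers (cubic_elem (7 / 25) (-1 / 5) (2 / 25)) + rogers (cubic_elem (7 / 25) (-1 / 5) (2 / 25))"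
    by (rule rogers_five_term; (simp only: cubic_elem_mult one_minus_cubic_elem, simp)?;
        use bounds in \<open>simp add: cubic_elem_def\<close>)
  have r4: "rogers (cubic_elem (-4 / 5) (9 / 5) (-2 / 5)) + rogers (cubic_elem 0 1 0)
      = rogers (cubic_elem (2 / 5) (-2 / 5) (1 / 5)) + rogers (cubic_elem (-3) 5 (-1)) + rogers (cubic_elem (-1) 3 (-1))"
    by (rule rogers_five_term; (simp only: cubic_elem_mult one_minus_cubic_elem, simp)?;
        use bounds in \<open>simp add: cubic_elem_def\<close>)
  have r5: "rogers (cubic_elem (-3) 5 (-1)) + rogers (cubic_elem 0 1 0)
      = rogers (cubic_elem 1 (-2) 1) + rogers (cubic_elem (23 / 5) (-38 / 5) (9 / 5)) + rogers (cubic_elem (9 / 5) (-9 / 5) (2 / 5))"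
    by (rule rogers_five_term; (simp only: cubic_elem_mult one_minus_cubic_elem, simp)?;
        use bounds in \<open>simp add: cubic_elem_def\<close>)
  have r6: "rogers (cubic_elem 0 1 0) + rogers (cubic_elem 0 1 0)
      = rogers (cubic_elem 0 0 1) + rogers (cubic_elem (-1 / 5) 1 (-1 / 5)) + rogers (cubic_elem (-1 / 5) 1 (-1 / 5))"
    by (rule rogers_five_term; (simp only: cubic_elem_mult one_minus_cubic_elem, simp)?;
        use bounds in \<open>simp add: cubic_elem_def\<close>)
  have r7: "rogers (cubic_elem (3 / 5) (2 / 5) (-1 / 5)) + rogers (cubic_elem 0 2 (-1))
      = rogers (cubic_elem 0 1 0) + rogers (cubic_elem (2 / 5) (-2 / 5) (1 / 5)) + rogers (cubic_elem 0 1 0)"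
    by (rule rogers_five_term; (simp only: cubic_elem_mult one_minus_cubic_elem, simp)?;
        use bounds in \<open>simp add: cubic_elem_def\<close>)
  have r8: "rogers (cubic_elem (-1 / 5) 1 (-1 / 5)) + rogers (cubic_elem (-1 / 5) 1 (-1 / 5))
      = rogers (cubic_elem (7 / 25) (-1 / 5) (2 / 25)) + rogers (cubic_elem (-4 / 5) (9 / 5) (-2 / 5)) + rogers (cubic_elem (-4 / 5) (9 / 5) (-2 / 5))"
    by (rule rogers_five_term; (simp only: cubic_elem_mult one_minus_cubic_elem, simp)?;
        use bounds in \<open>simp add: cubic_elem_def\<close>)
  have r9: "rogers (cubic_elem (-1) 3 (-1)) + rogers (cubic_elem 0 1 0)
      = rogers (cubic_elem 1 0 (-1)) + rogers (cubic_elem (-13) 22 (-5)) + rogers (cubic_elem (-5) 9 (-2))"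
    by (rule rogers_five_term; (simp only: cubic_elem_mult one_minus_cubic_elem, simp)?;
        use bounds in \<open>simp add: cubic_elem_def\<close>)
  \<comment> \<open>Each of the remaining seven pairs of arguments adds up to 1.\<close>
  have c1: "rogers (cubic_elem 1 0 (-1)) + rogers (cubic_elem 0 0 1) = pi ^ 2 / 6"
    using rogers_reflection[of "cubic_elem 1 0 (-1)"] bounds by (simp add: one_minus_cubic_elem) (simp add: cubic_elem_def)
  have c2: "rogers (cubic_elem (23 / 5) (-38 / 5) (9 / 5)) + rogers (cubic_elem (-18 / 5) (38 / 5) (-9 / 5)) = pi ^ 2 / 6"
    using rogers_reflection[of "cubic_elem (23 / 5) (-38 / 5) (9 / 5)"] bounds by (simp add: one_minus_cubic_elem) (simp add: cubic_elem_def)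
  have c3: "rogers (cubic_elem (-4 / 5) (9 / 5) (-2 / 5)) + rogers (cubic_elem (9 / 5) (-9 / 5) (2 / 5)) = pi ^ 2 / 6"
    using rogers_reflection[of "cubic_elem (-4 / 5) (9 / 5) (-2 / 5)"] bounds by (simp add: one_minus_cubic_elem) (simp add: cubic_elem_def)
  have c4: "rogers (cubic_elem 1 (-2) 1) + rogers (cubic_elem 0 2 (-1)) = pi ^ 2 / 6"
    using rogers_reflection[of "cubic_elem 1 (-2) 1"] bounds by (simp add: one_minus_cubic_elem) (simp add: cubic_elem_def)
  have c5: "rogers (cubic_elem (-5) 9 (-2)) + rogers (cubic_elem 6 (-9) 2) = pi ^ 2 / 6"
    using rogers_reflection[of "cubic_elem (-5) 9 (-2)"] bounds by (simp add: one_minus_cubic_elem) (simp add: cubic_elem_def)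
  have c6: "rogers (cubic_elem (2 / 5) (-2 / 5) (1 / 5)) + rogers (cubic_elem (3 / 5) (2 / 5) (-1 / 5)) = pi ^ 2 / 6"
    using rogers_reflection[of "cubic_elem (2 / 5) (-2 / 5) (1 / 5)"] bounds by (simp add: one_minus_cubic_elem) (simp add: cubic_elem_def)
  have c7: "rogers (cubic_elem (-13) 22 (-5)) + rogers (cubic_elem 14 (-22) 5) = pi ^ 2 / 6"
    using rogers_reflection[of "cubic_elem (-13) 22 (-5)"] bounds by (simp add: one_minus_cubic_elem) (simp add: cubic_elem_def)
  have "rogers rho = rogers (cubic_elem 0 1 0)" by (simp add: cubic_elem_def)
  then show ?thesis
    unfolding sigma0_eq_cubic_elem
    using r1 r2 r3 r4 r5 r6 r7 r8 r9 c1 c2 c3 c4 c5 c6 c7 by linarith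
qed

section \<open>Limits, step functions and Gaussian integrals\<close>

lemma tendsto_transfer:
  "(f \<longlongrightarrow> l) A \<Longrightarrow> l = l' \<Longrightarrow> \<forall>\<^sub>F x in A. f x = g x \<Longrightarrow> (g \<longlongrightarrow> l') A"
  by (simp add: Lim_transform_eventually)

lemma filterlim_scale_at_right_0: "0 < c \<Longrightarrow> filterlim (\<lambda>e::real. c * e) (at_right 0) (at_right 0)"
  by (auto simp: filterlim_at intro!: tendsto_eq_intros eventually_at_rightI[of _ 1])

lemma floor_scaled_bounds:
  fixes e :: real assumes "0 < e"
  shows "z - e < e * of_int \<lfloor>z / e\<rfloor>" "e * of_int \<lfloor>z / e\<rfloor> \<le> z"
proof -
  have "z / e - 1 < of_int \<lfloor>z / e\<rfloor>" by linarith
  then have "e * (z / e - 1) < e * of_int \<lfloor>z / e\<rfloor>" using assms by (intro mult_strict_left_mono)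
  then show "z - e < e * of_int \<lfloor>z / e\<rfloor>" using assms by (simp add: algebra_simps)
  have "e * of_int \<lfloor>z / e\<rfloor> \<le> e * (z / e)" using assms by (intro mult_left_mono) auto
  then show "e * of_int \<lfloor>z / e\<rfloor> \<le> z" using assms by simp
qed

lemma tendsto_floor_scaled: "((\<lambda>e. e * of_int \<lfloor>v / e\<rfloor>) \<longlongrightarrow> (v :: real)) (at_right 0)"
proof (rule real_tendsto_sandwich)
  show "\<forall>\<^sub>F e in at_right 0. v - e \<le> e * of_int \<lfloor>v / e\<rfloor>"
    using eventually_at_right_less by eventually_elim (intro less_imp_le floor_scaled_bounds)
  show "\<forall>\<^sub>F e in at_right 0. e * of_int \<lfloor>v / e\<rfloor> \<le> v"
    using eventually_at_right_less by eventually_elim (rule floor_scaled_bounds)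
  have "((\<lambda>e. v - e) \<longlongrightarrow> v - 0) (at_right 0)" by (intro tendsto_intros)
  then show "((\<lambda>e. v - e) \<longlongrightarrow> v) (at_right 0)" by simp
qed auto

text \<open>Every unit square has area 1, so pushing Lebesgue measure forward along the floor map gives counting measure. This turns
lattice sums into integrals of step functions.\<close>

lemma distr_floor_prod:
  "distr lborel (count_space UNIV) (\<lambda>z::real \<times> real. (\<lfloor>fst z\<rfloor>, \<lfloor>snd z\<rfloor>)) = count_space UNIV"
proof (rule measure_eqI_countable)
  fix p :: "int \<times> int"
  let ?f = "\<lambda>z::real \<times> real. (\<lfloor>fst z\<rfloor>, \<lfloor>snd z\<rfloor>)"
  obtain m n where p: "p = (m, n)" by (cases p)
  have floor_vimage: "(floor -` {k} :: real set) = {of_int k..<of_int k + 1}" for k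
    by (auto simp: floor_eq_iff)
  have "?f -` {p} = {of_int m..<of_int m + 1} \<times> {of_int n..<of_int n + 1}"
    using floor_vimage[of m] floor_vimage[of n] by (auto simp: p)
  then have "emeasure lborel (?f -` {p}) = emeasure lborel {real_of_int m..<of_int m + 1} * emeasure lborel {real_of_int n..<of_int n + 1}"
    by (simp add: lborel_prod[symmetric] lborel.emeasure_pair_measure_Times)
  also have "\<dots> = 1" by simp
  finally show "emeasure (distr lborel (count_space UNIV) ?f) {p} = emeasure (count_space UNIV) {p}"
    by (subst emeasure_distr) (auto simp: borel_prod[symmetric] space_pair_measure)
qed auto

lemma measurable_floor_prod [measurable]:
  "(\<lambda>z::real \<times> real. (\<lfloor>fst z\<rfloor>, \<lfloor>snd z\<rfloor>)) \<in> measurable borel (count_space UNIV)"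
  by (simp add: borel_prod[symmetric])

lemma distr_floor: "distr lborel (count_space UNIV) (floor :: real \<Rightarrow> int) = count_space UNIV"
proof (rule measure_eqI_countable)
  fix n :: int
  have "(floor -` {n} :: real set) = {of_int n..<of_int n + 1}"
    by (auto simp: floor_eq_iff)
  then show "emeasure (distr lborel (count_space UNIV) (floor :: real \<Rightarrow> int)) {n} = emeasure (count_space UNIV) {n}"
    by (subst emeasure_distr) auto
qed auto

lemma has_sum_of_integrable_count_space:
  fixes f :: "'a \<Rightarrow> real"
  assumes "integrable (count_space A) f"
  shows "(f has_sum integral\<^sup>L (count_space A) f) A"
proof -
  have "Infinite_Set_Sum.abs_summable_on f A" using assms by (simp add: Infinite_Set_Sum.abs_summable_on_def)
  then have "(\<lambda>x. norm (f x)) summable_on A" "infsetsum f A = infsum f A"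
    using abs_summable_equivalent infsetsum_infsum by blast+
  then show ?thesis
    by (metis Infinite_Set_Sum.infsetsum_def abs_summable_summable has_sum_infsum)
qed

lemma has_sum_floor_integral:
  fixes f :: "int \<Rightarrow> real"
  assumes "integrable lborel (\<lambda>x::real. f \<lfloor>x\<rfloor>)"
  shows "(f has_sum (\<integral>x. f \<lfloor>x::real\<rfloor> \<partial>lborel)) UNIV"
proof -
  have "integrable (count_space UNIV) f"
    using assms by (subst distr_floor[symmetric], subst integrable_distr_eq) auto
  moreover have "integral\<^sup>L (count_space UNIV) f = (\<integral>x. f \<lfloor>x::real\<rfloor> \<partial>lborel)"
    by (subst distr_floor[symmetric], subst integral_distr) auto
  ultimately show ?thesis using has_sum_of_integrable_count_space by metis
qed

lemma has_sum_floor_integral_prod: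
  fixes f :: "int \<times> int \<Rightarrow> real"
  assumes "integrable lborel (\<lambda>z::real \<times> real. f (\<lfloor>fst z\<rfloor>, \<lfloor>snd z\<rfloor>))"
  shows "(f has_sum (\<integral>z. f (\<lfloor>fst (z::real \<times> real)\<rfloor>, \<lfloor>snd z\<rfloor>) \<partial>lborel)) UNIV"
proof -
  have "integrable (count_space UNIV) f"
    using assms by (subst distr_floor_prod[symmetric], subst integrable_distr_eq) auto
  moreover have "integral\<^sup>L (count_space UNIV) f = (\<integral>z. f (\<lfloor>fst (z::real \<times> real)\<rfloor>, \<lfloor>snd z\<rfloor>) \<partial>lborel)"
    by (subst distr_floor_prod[symmetric], subst integral_distr) auto
  ultimately show ?thesis using has_sum_of_integrable_count_space by metis
qed

lemma lborel_integral_affine: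
  fixes f :: "'a::euclidean_space \<Rightarrow> real"
  assumes "c > 0" and [measurable]: "f \<in> borel_measurable borel"
    and "integrable lborel (\<lambda>z. f (t + c *\<^sub>R z))"
  shows "integrable lborel f" "(\<integral>z. f z \<partial>lborel) = c ^ DIM('a) * (\<integral>z. f (t + c *\<^sub>R z) \<partial>lborel)"
proof -
  have eq: "lborel = density (distr lborel borel (\<lambda>x::'a. t + c *\<^sub>R x)) (\<lambda>_. ennreal (c ^ DIM('a)))"
    using lborel_affine[of c t] assms(1) by (simp add: ennreal_power)
  show "integrable lborel f"
    by (subst eq, subst integrable_density, simp_all add: assms(1) less_imp_le)
      (subst integrable_distr_eq, use assms in auto)
  show "(\<integral>z. f z \<partial>lborel) = c ^ DIM('a) * (\<integral>z. f (t + c *\<^sub>R z) \<partial>lborel)"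
    by (subst eq, subst integral_density) (use assms in \<open>auto simp: integral_distr\<close>)
qed

text \<open>Dominated convergence along the filter \<open>at_right 0\<close>.\<close>

lemma tendsto_integral_at_right_0:
  fixes s :: "real \<Rightarrow> 'a \<Rightarrow> real"
  assumes "f \<in> borel_measurable M" "\<And>e. s e \<in> borel_measurable M" "integrable M w"
    and "AE x in M. ((\<lambda>e. s e x) \<longlongrightarrow> f x) (at_right 0)"
    and "\<And>e x. 0 < e \<Longrightarrow> e < e0 \<Longrightarrow> \<bar>s e x\<bar> \<le> w x" and "0 < e0"
  shows "((\<lambda>e. integral\<^sup>L M (s e)) \<longlongrightarrow> integral\<^sup>L M f) (at_right 0)"
    and "0 < e \<Longrightarrow> e < e0 \<Longrightarrow> integrable M (s e)"
    and "integrable M f"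
proof -
  have lim: "AE x in M. ((\<lambda>t. s (inverse t) x) \<longlongrightarrow> f x) at_top"
    using assms(4)
  proof eventually_elim
    case (elim x)
    then show ?case by (rule filterlim_compose[OF _ filterlim_inverse_at_right_top])
  qed
  have bound: "\<forall>\<^sub>F t in at_top. AE x in M. norm (s (inverse t) x) \<le> w x"
    using eventually_gt_at_top[of "inverse e0"]
  proof eventually_elim
    case (elim t)
    have "0 < inverse e0" using assms(6) by simp
    with elim have "0 < t" by linarith
    with elim assms(6) have "0 < inverse t" "inverse t < e0"
      by (auto simp: field_simps)
    then show ?case using assms(5) by auto
  qed
  show "integrable M f"
    by (rule integrable_dominated_convergence_at_top[OF assms(1) _ assms(3) lim bound]) (use assms(2) in auto)
  have "((\<lambda>t. integral\<^sup>L M (s (inverse t))) \<longlongrightarrow> integral\<^sup>L M f) at_top"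
    by (rule integral_dominated_convergence_at_top[OF assms(1) _ assms(3) lim bound]) (use assms(2) in auto)
  from filterlim_compose[OF this filterlim_inverse_at_top_right]
  show "((\<lambda>e. integral\<^sup>L M (s e)) \<longlongrightarrow> integral\<^sup>L M f) (at_right 0)" by simp
  show "integrable M (s e)" if "0 < e" "e < e0"
    by (rule Bochner_Integration.integrable_bound[OF assms(3)])
      (use assms(2,5) that in \<open>auto intro!: AE_I2 order_trans[OF assms(5)]\<close>)
qed

lemma has_sum_int_imp_sums:
  fixes f :: "int \<Rightarrow> real"
  assumes "(f has_sum S) UNIV" "\<And>n. n < 0 \<Longrightarrow> f n = 0"
  shows "(\<lambda>n. f (int n)) sums S"
proof -
  have "f n = 0" if "n \<notin> range int" for n
  proof -
    have "n < 0" using that zero_le_imp_eq_int[of n] by (cases "0 \<le> n") auto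
    then show ?thesis by (rule assms(2))
  qed
  then have "(f has_sum S) (range int)"
    using assms(1) by (subst has_sum_cong_neutral[where T = UNIV and g = f]) auto
  then have "((f \<circ> int) has_sum S) UNIV"
    by (subst (asm) has_sum_reindex) (auto simp: inj_on_def)
  then show ?thesis using has_sum_imp_sums by (fastforce simp: o_def)
qed

lemma has_sum_int_prod_imp_nat:
  fixes f :: "int \<times> int \<Rightarrow> real"
  assumes "(f has_sum S) UNIV" "\<And>m n. m < 0 \<or> n < 0 \<Longrightarrow> f (m, n) = 0"
  shows "((\<lambda>(r, s). f (int r, int s)) has_sum S) UNIV"
proof -
  have "f p = 0" if "p \<notin> range (map_prod int int)" for p
  proof -
    obtain m n where p: "p = (m, n)" by (cases p)
    have "m < 0 \<or> n < 0"
    proof (rule ccontr)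
      assume "\<not> (m < 0 \<or> n < 0)"
      then have "p = map_prod int int (nat m, nat n)" by (simp add: p)
      with that show False by blast
    qed
    then show ?thesis unfolding p by (rule assms(2))
  qed
  then have "(f has_sum S) (range (map_prod int int))"
    using assms(1) by (subst has_sum_cong_neutral[where T = UNIV and g = f]) auto
  then have "((f \<circ> map_prod int int) has_sum S) UNIV"
    by (subst (asm) has_sum_reindex) (auto simp: inj_on_def)
  then show ?thesis by (simp add: o_def case_prod_unfold map_prod_def)
qed

lemma gaussian_integral:
  assumes k: "0 < (k::real)"
  shows "integrable lborel (\<lambda>x. exp (- k * (x - m) ^ 2))"
    and "(\<integral>x. exp (- k * (x - m) ^ 2) \<partial>lborel) = sqrt (pi / k)"
proof -
  let ?s = "sqrt (1 / (2 * k))"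
  have s: "0 < ?s" "?s ^ 2 = 1 / (2 * k)" using k by auto
  have eq: "(\<lambda>x. exp (- k * (x - m) ^ 2)) = (\<lambda>x. sqrt (pi / k) * normal_density m ?s x)"
    unfolding normal_density_def s(2) using k by (simp add: fun_eq_iff field_simps real_sqrt_divide)
  show "integrable lborel (\<lambda>x. exp (- k * (x - m) ^ 2))"
    unfolding eq using s(1) by (intro integrable_mult_right integrable_normal_density)
  show "(\<integral>x. exp (- k * (x - m) ^ 2) \<partial>lborel) = sqrt (pi / k)"
    unfolding eq using s(1) by simp
qed

text \<open>Completing the square in the first variable leaves the Schur complement \<open>C - B^2 / A\<close> for the second.\<close>

lemma gaussian_integral_2:
  assumes A: "0 < A" and D: "B ^ 2 < A * C"
    and int: "integrable lborel (\<lambda>z::real \<times> real. exp (- (A * fst z ^ 2 + 2 * B * fst z * snd z + C * snd z ^ 2) / 2))"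
  shows "(\<integral>z. exp (- (A * fst z ^ 2 + 2 * B * fst z * snd z + C * snd z ^ 2) / 2) \<partial>lborel)
    = 2 * pi / sqrt (A * C - B ^ 2)"
proof -
  let ?D = "C - B ^ 2 / A"
  have D0: "0 < ?D" using A D by (simp add: field_simps)
  let ?f = "\<lambda>x y. exp (- (A * x ^ 2 + 2 * B * x * y + C * y ^ 2) / 2)"
  have sq: "?f x y = exp (- (?D / 2) * (y - 0) ^ 2) * exp (- (A / 2) * (x - (- B * y / A)) ^ 2)" for x y :: real
  proof -
    have "- (A * x ^ 2 + 2 * B * x * y + C * y ^ 2) / 2 = - (?D / 2) * (y - 0) ^ 2 + - (A / 2) * (x - (- B * y / A)) ^ 2"
      using A by (simp add: field_simps power2_eq_square)
    then show ?thesis by (simp only: exp_add)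
  qed
  have "(\<integral>z. exp (- (A * fst z ^ 2 + 2 * B * fst z * snd z + C * snd z ^ 2) / 2) \<partial>lborel)
    = integral\<^sup>L (lborel \<Otimes>\<^sub>M lborel) (case_prod ?f)"
    by (simp add: lborel_prod case_prod_unfold)
  also have "\<dots> = (\<integral>y. (\<integral>x. ?f x y \<partial>lborel) \<partial>lborel)"
    by (rule lborel_pair.integral_snd[symmetric]) (use int in \<open>simp add: lborel_prod case_prod_unfold\<close>)
  also have "\<dots> = (\<integral>y. exp (- (?D / 2) * (y - 0) ^ 2) * sqrt (pi / (A / 2)) \<partial>lborel)"
    unfolding sq integral_mult_right_zero using gaussian_integral(2)[of "A / 2"] A
    by (simp only: half_gt_zero_iff)
  also have "\<dots> = sqrt (pi / (?D / 2)) * sqrt (pi / (A / 2))"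
    using gaussian_integral(2)[of "?D / 2" 0] D0 by simp
  also have "\<dots> = sqrt (4 * pi ^ 2 / (A * C - B ^ 2))"
    using A by (simp add: power2_eq_square field_simps flip: real_sqrt_mult)
  also have "\<dots> = 2 * pi / sqrt (A * C - B ^ 2)"
    by (simp add: real_sqrt_divide real_sqrt_mult)
  finally show ?thesis .
qed

section \<open>Infinite q-products and the dilogarithm\<close>

definition qinf :: "real \<Rightarrow> real \<Rightarrow> real" where
  "qinf x q = (\<Prod>n. 1 - x * q ^ n)"

lemma qinf_factor_pos:
  fixes x q :: real
  assumes "0 \<le> x" "x < 1" "0 < q" "q < 1" shows "0 < 1 - x * q ^ n"
proof -
  have "x * q ^ n \<le> x" using assms by (intro mult_left_le) (auto intro: power_le_one)
  then show ?thesis using assms by linarith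
qed

lemma convergent_prod_qinf:
  fixes x q :: real
  assumes "0 < q" "q < 1" shows "convergent_prod (\<lambda>n. 1 - x * q ^ n)"
proof -
  have "summable (\<lambda>n. norm (1 - x * q ^ n - 1))"
    using assms by (simp add: abs_mult power_abs summable_mult)
  then show ?thesis
    by (intro abs_convergent_prod_imp_convergent_prod summable_imp_abs_convergent_prod)
qed

lemma
  assumes "0 \<le> x" "x < 1" "0 < q" "q < 1"
  shows qinf_pos: "0 < qinf x q"
    and ln_qinf_sums: "(\<lambda>n. ln (1 - x * q ^ n)) sums ln (qinf x q)"
proof -
  have pos: "0 < 1 - x * q ^ n" for n by (rule qinf_factor_pos[OF assms])
  note conv = convergent_prod_qinf[OF assms(3,4), of x]
  show "0 < qinf x q" unfolding qinf_def by (rule less_0_prodinf[OF conv pos])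
  show "(\<lambda>n. ln (1 - x * q ^ n)) sums ln (qinf x q)"
    unfolding qinf_def
    using summable_ln_real[OF conv pos] suminf_ln_real[OF conv pos] by (simp add: sums_iff)
qed

lemma qpoch_mult_qinf:
  assumes "0 \<le> x" "x < 1" "0 < q" "q < 1"
  shows "qpoch x q n * qinf (x * q ^ n) q = qinf x q"
proof -
  have "qinf x q = (\<Prod>i. 1 - x * q ^ (i + n)) * (\<Prod>i<n. 1 - x * q ^ i)"
    unfolding qinf_def
    by (rule prodinf_split_initial_segment[OF convergent_prod_qinf])
      (use qinf_factor_pos[OF assms] assms in \<open>auto simp: less_le\<close>)
  then show ?thesis by (simp add: qpoch_def qinf_def power_add mult_ac)
qed

lemma power_exp_eq: "exp (x::real) ^ n = exp (real n * x)"
  by (simp add: exp_of_nat_mult)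

text \<open>Expanding each logarithm of the product in powers of \<open>x\<close> gives a double series with nonnegative terms; summing over the factors
first gives geometric series.\<close>

lemma neg_ln_qinf_sums:
  fixes e x :: real
  assumes "0 < e" "0 \<le> x" "x \<le> 1"
  shows "(\<lambda>k. x ^ k / real k * (1 / (exp (e * k) - 1))) sums (- ln (qinf (x * exp (- e)) (exp (- e))))"
proof -
  let ?q = "exp (- e)"
  have q: "0 < ?q" "?q < 1" using assms by auto
  have xq: "0 \<le> x * ?q" "x * ?q < 1"
    using assms mult_right_mono[of x 1 ?q] q by (simp, linarith)
  define a where "a = (\<lambda>j k. (x * ?q * ?q ^ j) ^ k / real k)"
  have a0: "0 \<le> a j k" for j k using assms by (simp add: a_def)
  have row: "a j sums (- ln (1 - x * ?q * ?q ^ j))" for j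
  proof -
    have "x * ?q * ?q ^ j < 1" using qinf_factor_pos[OF xq q, of j] by simp
    then show ?thesis unfolding a_def using assms by (intro ln_1_minus_sums) auto
  qed
  have row': "(a j has_sum (- ln (1 - x * ?q * ?q ^ j))) UNIV" for j
    by (rule norm_summable_imp_has_sum[OF _ row]) (use row a0 in \<open>auto simp: sums_iff\<close>)
  have rows: "(\<lambda>j. - ln (1 - x * ?q * ?q ^ j)) sums (- ln (qinf (x * ?q) ?q))"
    by (rule sums_minus[OF ln_qinf_sums[OF xq q]])
  have rows0: "0 \<le> - ln (1 - x * ?q * ?q ^ j)" for j
    using qinf_factor_pos[OF xq q, of j] assms by simp
  have rows': "((\<lambda>j. - ln (1 - x * ?q * ?q ^ j)) has_sum (- ln (qinf (x * ?q) ?q))) UNIV"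
    by (rule norm_summable_imp_has_sum[OF _ rows]) (use rows rows0 in \<open>auto simp: sums_iff\<close>)
  have "(\<lambda>(j, k). a j k) summable_on (UNIV \<times> UNIV)"
    by (rule summable_on_SigmaI[where g = "\<lambda>j. - ln (1 - x * ?q * ?q ^ j)"])
      (use row' rows' a0 in \<open>auto simp: summable_on_def\<close>)
  then have sw: "(\<lambda>(k, j). a j k) summable_on (UNIV \<times> UNIV)"
    by (subst summable_on_swap) (simp add: case_prod_unfold)
  have col: "((\<lambda>j. a j k) has_sum (x ^ k / real k * (1 / (exp (e * k) - 1)))) UNIV" for k
  proof (cases "k = 0")
    case True then show ?thesis by (simp add: a_def)
  next
    case False
    have qk: "?q ^ k < 1" using False q by (simp add: power_less_one_iff)
    have g1: "(\<lambda>j. x ^ k / real k * ?q ^ k * (?q ^ k) ^ j) sums (x ^ k / real k * ?q ^ k * (1 / (1 - ?q ^ k)))"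
      using qk q by (intro sums_mult geometric_sums) auto
    have g2: "x ^ k / real k * ?q ^ k * (?q ^ k) ^ j = a j k" for j
      by (simp add: a_def power_mult_distrib mult.commute flip: power_mult)
    have "?q ^ k * (1 / (1 - ?q ^ k)) = 1 / (exp (e * k) - 1)"
      using False assms by (simp add: power_exp_eq exp_minus field_simps)
    then have g3: "x ^ k / real k * ?q ^ k * (1 / (1 - ?q ^ k)) = x ^ k / real k * (1 / (exp (e * k) - 1))"
      by (simp only: mult.assoc)
    have s: "(\<lambda>j. a j k) sums (x ^ k / real k * (1 / (exp (e * k) - 1)))"
      using g1 unfolding g2 g3 .
    then show ?thesis
      by (intro norm_summable_imp_has_sum) (use s a0 in \<open>auto simp: sums_iff\<close>)
  qed
  have "(\<lambda>k. \<Sum>\<^sub>\<infinity>j. a j k) summable_on UNIV"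
    using summable_on_Sigma_banach[OF sw] by simp
  moreover have "(\<Sum>\<^sub>\<infinity>k. \<Sum>\<^sub>\<infinity>j. a j k) = - ln (qinf (x * ?q) ?q)"
    using infsum_swap_banach[OF sw] infsumI[OF row'] infsumI[OF rows'] by simp
  ultimately have "((\<lambda>k. \<Sum>\<^sub>\<infinity>j. a j k) has_sum (- ln (qinf (x * ?q) ?q))) UNIV"
    using has_sum_infsum by fastforce
  then show ?thesis unfolding infsumI[OF col] by (rule has_sum_imp_sums)
qed

text \<open>With \<open>bose_expansion_upper\<close>, the first two terms of the Laurent expansion of \<open>1 / (exp v - 1)\<close> at 0, with an error between 0 and
\<open>v / 4\<close> for all positive \<open>v\<close>.\<close>

lemma bose_expansion_lower: "0 < (v::real) \<Longrightarrow> 0 \<le> 1 / (exp v - 1) - 1 / v + 1 / 2"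
proof -
  assume v: "0 < v"
  let ?N = "\<lambda>v::real. v * (exp v + 1) - 2 * (exp v - 1)"
  have "?N 0 \<le> ?N v"
  proof (rule DERIV_nonneg_imp_nondecreasing[where f = ?N])
    fix x :: real assume "0 \<le> x"
    have "(1 - x) * exp x \<le> exp (- x) * exp x"
      using exp_ge_add_one_self[of "- x"] by (intro mult_right_mono) auto
    then have "0 \<le> 1 + (x - 1) * exp x" by (simp add: algebra_simps flip: exp_add)
    then show "\<exists>y. (?N has_real_derivative y) (at x) \<and> 0 \<le> y"
      by (intro exI[of _ "1 + (x - 1) * exp x"]) (auto intro!: derivative_eq_intros simp: algebra_simps)
  qed (use v in simp)
  then have "0 \<le> ?N v / (2 * v * (exp v - 1))" using v by simp
  also have "\<dots> = 1 / (exp v - 1) - 1 / v + 1 / 2"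
    using v by (simp add: divide_simps) (simp add: algebra_simps)
  finally show ?thesis .
qed

lemma bose_expansion_upper: "0 < (v::real) \<Longrightarrow> 1 / (exp v - 1) - 1 / v + 1 / 2 \<le> v / 4"
proof -
  assume v: "0 < v"
  have "1 / (exp v - 1) \<le> 1 / (v + v ^ 2 / 2)"
    using exp_lower_Taylor_quadratic[of v] v by (intro divide_left_mono mult_pos_pos) (auto simp: add_pos_pos)
  also have "\<dots> \<le> 1 / v - 1 / 2 + v / 4"
  proof -
    have p: "0 < v + v ^ 2 / 2" using v by (simp add: add_pos_pos)
    have "(1 / v - 1 / 2 + v / 4) * (v + v ^ 2 / 2) = 1 + v ^ 3 / 8"
      using v by (simp add: field_simps power2_eq_square power3_eq_cube)
    then have "1 \<le> (1 / v - 1 / 2 + v / 4) * (v + v ^ 2 / 2)" using v by simp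
    then show ?thesis using p by (simp add: pos_divide_le_eq)
  qed
  finally show ?thesis by simp
qed

text \<open>Inserting the expansion of \<open>1 / (exp v - 1)\<close> into \<open>neg_ln_qinf_sums\<close> term by term yields the dilogarithm, a logarithm, and a
geometric series as error bound.\<close>

lemma neg_ln_qinf_approx:
  assumes "0 < e" "0 \<le> x" "x < 1"
  shows "\<bar>- ln (qinf (x * exp (- e)) (exp (- e))) - dilog x / e - ln (1 - x) / 2\<bar> \<le> e / 4 / (1 - x)"
proof -
  let ?t = "\<lambda>k::nat. x ^ k / real k * (1 / (exp (e * k) - 1)) - x ^ k / real k ^ 2 / e + x ^ k / real k / 2"
  have "?t sums (- ln (qinf (x * exp (- e)) (exp (- e))) - dilog x / e + - ln (1 - x) / 2)"
    using assms unfolding dilog_def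
    by (intro sums_add sums_diff sums_divide neg_ln_qinf_sums summable_sums summable_dilog ln_1_minus_sums) auto
  moreover have "(\<lambda>k. e / 4 * x ^ k) sums (e / 4 * (1 / (1 - x)))"
    using assms by (intro sums_mult geometric_sums) auto
  moreover have "norm (?t k) \<le> e / 4 * x ^ k" for k
  proof (cases "k = 0")
    case True then show ?thesis using assms by simp
  next
    case False
    define B where "B = 1 / (exp (e * k) - 1) - 1 / (e * k) + 1 / 2"
    have B: "0 \<le> B" "B \<le> e * k / 4"
      using bose_expansion_lower[of "e * k"] bose_expansion_upper[of "e * k"] False assms by (auto simp: B_def)
    have "?t k = x ^ k / real k * B"
      using False assms by (simp add: B_def power2_eq_square field_simps)
    moreover have "x ^ k / real k * B \<le> x ^ k / real k * (e * k / 4)"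
      using B assms by (intro mult_left_mono) auto
    ultimately show ?thesis using False B assms by (simp add: abs_mult mult.commute)
  qed
  ultimately have "norm (- ln (qinf (x * exp (- e)) (exp (- e))) - dilog x / e + - ln (1 - x) / 2)
      \<le> e / 4 * (1 / (1 - x))"
    by (rule norm_sums_le)
  then show ?thesis by simp
qed

text \<open>In contrast to \<open>neg_ln_qinf_approx\<close> this one-sided bound is uniform up to \<open>x = 1\<close>. It is what dominates the terms of the double series
with small indices.\<close>

lemma dilog_le_neg_ln_qinf:
  assumes "0 < e" "0 \<le> x" "x \<le> 1"
  shows "dilog (x * exp (- e)) / e \<le> - ln (qinf (x * exp (- e)) (exp (- e)))"
proof (rule sums_le)
  show "(\<lambda>k. x ^ k / real k * (1 / (exp (e * k) - 1))) sums (- ln (qinf (x * exp (- e)) (exp (- e))))"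
    by (rule neg_ln_qinf_sums) fact+
  have "x * exp (- e) \<le> 1" using assms mult_mono[of x 1 "exp (- e)" 1] by auto
  then show "(\<lambda>k. (x * exp (- e)) ^ k / real k ^ 2 / e) sums (dilog (x * exp (- e)) / e)"
    unfolding dilog_def using assms by (intro sums_divide summable_sums summable_dilog) auto
  show "(x * exp (- e)) ^ k / real k ^ 2 / e \<le> x ^ k / real k * (1 / (exp (e * k) - 1))" for k
  proof (cases "k = 0")
    case False
    let ?v = "e * k"
    have v: "0 < ?v" using False assms by simp
    have "exp (- ?v) / ?v \<le> 1 / (exp ?v - 1)"
    proof -
      have "1 - exp (- ?v) \<le> ?v" using exp_ge_add_one_self[of "- ?v"] by simp
      then have "exp (- ?v) * (exp ?v - 1) \<le> ?v" by (simp add: algebra_simps flip: exp_add)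
      then show ?thesis using v by (simp add: field_simps)
    qed
    then have "x ^ k / real k * (exp (- ?v) / ?v) \<le> x ^ k / real k * (1 / (exp ?v - 1))"
      using assms by (intro mult_left_mono) auto
    then show ?thesis
      using False by (simp add: power_mult_distrib power_exp_eq power2_eq_square mult_ac)
  qed simp
qed

section \<open>Asymptotics of the Euler product\<close>

lemma sinh_scale_le:
  fixes t b :: real
  assumes "0 \<le> t" "t \<le> 1" "0 \<le> b" shows "sinh (t * b) \<le> t * sinh b"
proof -
  have "convex_on {0..} (sinh :: real \<Rightarrow> real)"
    by (rule f''_ge0_imp_convex[where f' = cosh and f'' = sinh]) (auto intro!: derivative_eq_intros)
  from convex_onD[OF this, of t 0 b] show ?thesis using assms by simp
qed

lemma abs_ln_one_minus_le:
  fixes s r :: real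
  assumes "0 \<le> s" "s \<le> r" "r < 1" shows "\<bar>ln (1 - s)\<bar> \<le> s / (1 - r)"
proof -
  have "- ln (1 - s) = ln (1 / (1 - s))" using assms by (simp add: ln_div)
  also have "\<dots> \<le> 1 / (1 - s) - 1" using assms by (intro ln_le_minus_one) auto
  also have "\<dots> = s / (1 - s)" using assms by (simp add: field_simps)
  also have "\<dots> \<le> s / (1 - r)" using assms by (intro divide_left_mono mult_pos_pos) auto
  finally show ?thesis using assms by simp
qed

lemma ln_quotient:
  fixes a b c :: real
  shows "0 < a \<Longrightarrow> 0 < b \<Longrightarrow> 0 < c \<Longrightarrow> ln (a * b / c ^ 2) = ln a + ln b - 2 * ln c"
  by (simp add: ln_mult_pos ln_div ln_realpow)

text \<open>A symmetric pair of factors \<open>1 - q^(n+x)\<close>, \<open>1 - q^(n-x)\<close> divided by \<open>(1 - q^n)^2\<close> deforms the factor \<open>1 - x^2 / n^2\<close> of Euler's product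
for the sine, with \<open>A = \<epsilon> x / 2\<close> and \<open>B = \<epsilon> n / 2\<close>.\<close>

lemma sine_product_quotient:
  fixes A B n :: real
  assumes "0 < B"
  shows "(1 - exp (- (2 * (B + A)))) * (1 - exp (- (2 * (B - A)))) / (1 - exp (- (2 * B))) ^ 2
    = 1 - (sinh A / sinh B) ^ 2"
proof -
  have e: "1 - exp (- (2 * y)) = 2 * exp (- y) * sinh y" for y :: real
    by (simp add: sinh_def algebra_simps flip: exp_add)
  have "sinh (B + A) * sinh (B - A) = sinh B ^ 2 - sinh A ^ 2"
  proof -
    have "sinh (B + A) * sinh (B - A) = sinh B ^ 2 * cosh A ^ 2 - cosh B ^ 2 * sinh A ^ 2"
      by (simp add: sinh_add sinh_diff power2_eq_square algebra_simps)
    then show ?thesis by (simp add: cosh_square_eq algebra_simps)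
  qed
  moreover have "exp (- (B + A)) * exp (- (B - A)) = exp (- B) ^ 2"
    by (simp add: power2_eq_square flip: exp_add)
  ultimately have "(1 - exp (- (2 * (B + A)))) * (1 - exp (- (2 * (B - A)))) = 4 * exp (- B) ^ 2 * (sinh B ^ 2 - sinh A ^ 2)"
    unfolding e by (simp only: mult_ac) (simp add: mult_ac)
  moreover have "sinh B > 0" using assms by simp
  ultimately show ?thesis unfolding e by (simp add: power_mult_distrib power_divide field_simps)
qed

lemma tendsto_sinh_quotient:
  assumes "0 < (b :: real)"
  shows "((\<lambda>e. sinh (e * a) / sinh (e * b)) \<longlongrightarrow> a / b) (at_right 0)"
proof -
  have "((\<lambda>e. sinh (e * c) / e) \<longlongrightarrow> c) (at_right 0)" for c :: real
  proof -
    have "((\<lambda>e. sinh (e * c)) has_field_derivative c) (at 0 within {0<..})"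
      by (auto intro!: derivative_eq_intros)
    then show ?thesis by (simp add: has_field_derivative_iff)
  qed
  from tendsto_divide[OF this[of a] this[of b]] assms
  have "((\<lambda>e. (sinh (e * a) / e) / (sinh (e * b) / e)) \<longlongrightarrow> a / b) (at_right 0)" by simp
  then show ?thesis
    by (rule filterlim_cong[OF refl refl, THEN iffD1, rotated])
      (auto intro!: eventually_at_rightI[of _ 1])
qed

text \<open>The value \<open>(q; q)\<^sub>\<infinity>\<close> at \<open>q = exp (- e)\<close>.\<close>

definition euler_product :: "real \<Rightarrow> real" where "euler_product e = qinf (exp (- e)) (exp (- e))"

lemma euler_product_pos: "0 < e \<Longrightarrow> 0 < euler_product e"
  unfolding euler_product_def by (rule qinf_pos) auto

lemma qinf_sine_quotient:
  assumes x: "0 < x" "x < 1" and e: "0 < e"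
  shows "(\<lambda>j. ln (1 - (sinh (e * (x / 2)) / sinh (e * (real (Suc j) / 2))) ^ 2)) sums
    (ln (qinf (exp (- (e * x))) (exp (- e)) * qinf (exp (- (e * (1 - x)))) (exp (- e)) / euler_product e ^ 2)
      - ln (1 - exp (- (e * x))))"
proof -
  let ?q = "exp (- e)"
  have q: "0 < ?q" "?q < 1" using e by auto
  have X: "0 \<le> exp (- (e * x))" "exp (- (e * x)) < 1" "0 \<le> exp (- (e * (1 - x)))" "exp (- (e * (1 - x))) < 1"
    using x e by auto
  have s1: "(\<lambda>j. ln (1 - exp (- (e * x)) * ?q ^ Suc j)) sums (ln (qinf (exp (- (e * x))) ?q) - ln (1 - exp (- (e * x))))"
    using ln_qinf_sums[OF X(1,2) q] by (subst sums_Suc_iff) simp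
  have s2: "(\<lambda>j. ln (1 - exp (- (e * (1 - x))) * ?q ^ j)) sums ln (qinf (exp (- (e * (1 - x)))) ?q)"
    by (rule ln_qinf_sums[OF X(3,4) q])
  have s3: "(\<lambda>j. ln (1 - ?q * ?q ^ j)) sums ln (euler_product e)"
    unfolding euler_product_def by (rule ln_qinf_sums) (use q in auto)
  have t: "ln (1 - exp (- (e * x)) * ?q ^ Suc j) + ln (1 - exp (- (e * (1 - x))) * ?q ^ j) - 2 * ln (1 - ?q * ?q ^ j)
     = ln (1 - (sinh (e * (x / 2)) / sinh (e * (real (Suc j) / 2))) ^ 2)" for j
  proof -
    let ?A = "e * (x / 2)" and ?B = "e * (real (Suc j) / 2)"
    have B: "0 < ?B" using e by simp
    have AB: "?A < ?B" using e x by simp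
    have "exp (- (e * x)) * ?q ^ Suc j = exp (- (2 * (?B + ?A)))"
      unfolding power_exp_eq by (simp add: field_simps flip: exp_add)
    moreover have "exp (- (e * (1 - x))) * ?q ^ j = exp (- (2 * (?B - ?A)))"
      unfolding power_exp_eq by (simp add: field_simps flip: exp_add)
    moreover have "?q * ?q ^ j = exp (- (2 * ?B))"
      unfolding power_exp_eq by (simp add: field_simps flip: exp_add)
    moreover have "ln (1 - exp (- (2 * (?B + ?A)))) + ln (1 - exp (- (2 * (?B - ?A)))) - 2 * ln (1 - exp (- (2 * ?B)))
      = ln ((1 - exp (- (2 * (?B + ?A)))) * (1 - exp (- (2 * (?B - ?A)))) / (1 - exp (- (2 * ?B))) ^ 2)"
    proof -
      have A: "0 < ?A" using e x by simp
      have p: "0 < 1 - exp (- y)" if "0 < y" for y :: real using that by simp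
      have "0 < 1 - exp (- (2 * (?B + ?A)))" "0 < 1 - exp (- (2 * (?B - ?A)))" "0 < 1 - exp (- (2 * ?B))"
        using p[of "2 * (?B + ?A)"] p[of "2 * (?B - ?A)"] p[of "2 * ?B"] A B AB by auto
      then show ?thesis by (rule ln_quotient[symmetric])
    qed
    ultimately show ?thesis using sine_product_quotient[OF B, of ?A] by metis
  qed
  have v: "ln (qinf (exp (- (e * x))) ?q) - ln (1 - exp (- (e * x))) + ln (qinf (exp (- (e * (1 - x)))) ?q) - 2 * ln (euler_product e)
    = ln (qinf (exp (- (e * x))) ?q * qinf (exp (- (e * (1 - x)))) ?q / euler_product e ^ 2) - ln (1 - exp (- (e * x)))"
    using qinf_pos[OF X(1,2) q] qinf_pos[OF X(3,4) q] euler_product_pos[OF e] by (simp add: ln_quotient)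
  show ?thesis
    using sums_diff[OF sums_add[OF s1 s2] sums_mult[OF s3, of 2]] unfolding t v .
qed

lemma sine_log_series:
  assumes "0 < x" "x < (1::real)"
  shows "summable (\<lambda>j. ln (1 - (x / real (Suc j)) ^ 2)) \<Longrightarrow>
    exp (\<Sum>j. ln (1 - (x / real (Suc j)) ^ 2)) = sin (pi * x) / (pi * x)"
proof -
  assume s: "summable (\<lambda>j. ln (1 - (x / real (Suc j)) ^ 2))"
  have pos: "0 < 1 - (x / real (Suc j)) ^ 2" for j
  proof -
    have "x / real (Suc j) \<le> x / 1" using assms by (intro divide_left_mono) auto
    then have "(x / real (Suc j)) ^ 2 \<le> x ^ 2" using assms by (intro power_mono) auto
    also have "\<dots> < 1" using assms by (simp add: power_less_one_iff)
    finally show ?thesis by simp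
  qed
  have "exp (\<Sum>j<n. ln (1 - (x / real (Suc j)) ^ 2)) = (\<Prod>k=1..n. 1 - x ^ 2 / real k ^ 2)" for n
  proof -
    have "exp (\<Sum>j<n. ln (1 - (x / real (Suc j)) ^ 2)) = (\<Prod>j<n. 1 - (x / real (Suc j)) ^ 2)"
      using pos by (simp add: exp_sum del: of_nat_Suc)
    also have "\<dots> = (\<Prod>k=1..n. 1 - x ^ 2 / real k ^ 2)"
      by (rule prod.reindex_bij_witness[of _ "\<lambda>k. k - 1" Suc]) (auto simp: power_divide)
    finally show ?thesis .
  qed
  moreover have "(\<lambda>n. exp (\<Sum>j<n. ln (1 - (x / real (Suc j)) ^ 2))) \<longlonglongrightarrow> exp (\<Sum>j. ln (1 - (x / real (Suc j)) ^ 2))"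
    by (intro tendsto_exp summable_LIMSEQ s)
  ultimately show ?thesis
    using sin_product_formula_real'[of x] assms LIMSEQ_unique by auto
qed

text \<open>The logarithm of the quotient is a series to which Tannery's theorem applies: convexity of \<open>sinh\<close> gives
\<open>sinh A / sinh B \<le> A / B\<close> for \<open>A \<le> B\<close>, so the \<open>n\<close>-th term is at most a constant times \<open>x^2 / n^2\<close>. The first factor
\<open>1 - q^x\<close> has no partner and accounts for the division by \<open>e\<close>.\<close>

lemma tendsto_qinf_sine:
  assumes x: "0 < x" "x < 1"
  shows "((\<lambda>e. qinf (exp (- (e * x))) (exp (- e)) * qinf (exp (- (e * (1 - x)))) (exp (- e)) / euler_product e ^ 2 / e)
    \<longlongrightarrow> sin (pi * x) / pi) (at_right 0)"
proof -
  let ?a = "\<lambda>j e. ln (1 - (sinh (e * (x / 2)) / sinh (e * (real (Suc j) / 2))) ^ 2)"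
  let ?b = "\<lambda>j. ln (1 - (x / real (Suc j)) ^ 2)"
  let ?M = "\<lambda>j. (x / real (Suc j)) ^ 2 / (1 - x ^ 2)"
  have x2: "x ^ 2 < 1" using x by (simp add: power_less_one_iff)
  have le: "(x / real (Suc j)) ^ 2 \<le> x ^ 2" for j
  proof -
    have "x / real (Suc j) \<le> x / 1" using x by (intro divide_left_mono) auto
    then show ?thesis using x by (intro power_mono) auto
  qed
  have lim: "((?a j) \<longlongrightarrow> ?b j) (at_right 0)" for j
  proof -
    have "((\<lambda>e. sinh (e * (x / 2)) / sinh (e * (real (Suc j) / 2))) \<longlongrightarrow> (x / 2) / (real (Suc j) / 2)) (at_right 0)"
      by (rule tendsto_sinh_quotient) simp
    then have "((\<lambda>e. sinh (e * (x / 2)) / sinh (e * (real (Suc j) / 2))) \<longlongrightarrow> x / real (Suc j)) (at_right 0)"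
      by simp
    then have "((\<lambda>e. 1 - (sinh (e * (x / 2)) / sinh (e * (real (Suc j) / 2))) ^ 2) \<longlongrightarrow> 1 - (x / real (Suc j)) ^ 2) (at_right 0)"
      by (intro tendsto_diff tendsto_const tendsto_power)
    then show ?thesis using le[of j] x2 by (intro tendsto_ln) auto
  qed
  have bound: "norm (?a j e) \<le> ?M j" if e: "0 < e" for j e
  proof -
    define s where "s = (sinh (e * (x / 2)) / sinh (e * (real (Suc j) / 2))) ^ 2"
    have sp: "0 < sinh (e * (real (Suc j) / 2))" using e by simp
    have "sinh (x / real (Suc j) * (e * (real (Suc j) / 2))) \<le> x / real (Suc j) * sinh (e * (real (Suc j) / 2))"
      by (rule sinh_scale_le) (use x e in \<open>auto simp: divide_simps\<close>)
    then have "sinh (e * (x / 2)) / sinh (e * (real (Suc j) / 2)) \<le> x / real (Suc j)"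
      using sp by (simp add: pos_divide_le_eq mult_ac del: of_nat_Suc)
    then have "s \<le> (x / real (Suc j)) ^ 2"
      unfolding s_def using e x sp by (intro power_mono divide_nonneg_pos) auto
    with le[of j] have s: "0 \<le> s" "s \<le> x ^ 2" "s \<le> (x / real (Suc j)) ^ 2" by (auto simp: s_def)
    have "\<bar>ln (1 - s)\<bar> \<le> s / (1 - x ^ 2)" by (rule abs_ln_one_minus_le) (use s x2 in auto)
    also have "\<dots> \<le> ?M j" using s x2 by (intro divide_right_mono) auto
    finally show ?thesis by (simp add: s_def)
  qed
  have "summable (\<lambda>j. x ^ 2 / (1 - x ^ 2) * (1 / real (Suc j) ^ 2))"
    by (intro summable_mult) (use summable_inverse_squares_real in \<open>subst summable_Suc_iff\<close>)
  then have M: "summable ?M" by (simp add: power_divide field_simps)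
  have "eventually (\<lambda>(k, e). norm (?a k e) \<le> ?M k) (at_top \<times>\<^sub>F at_right 0)"
  proof -
    have "eventually (\<lambda>e::real. 0 < e) (at_right 0)" by (rule eventually_at_right_less)
    then have "eventually (\<lambda>p::nat \<times> real. 0 < snd p) (at_top \<times>\<^sub>F at_right 0)"
      by (intro eventually_prodI[of "\<lambda>_. True" _ "\<lambda>e. 0 < e", simplified]) auto
    then show ?thesis by (rule eventually_mono) (use bound in auto)
  qed
  note T = tannerys_theorem[OF lim this M]
  have S: "summable ?b" "((\<lambda>e. \<Sum>j. ?a j e) \<longlongrightarrow> suminf ?b) (at_right 0)"
    using T by (auto intro: summable_norm_cancel)
  have "((\<lambda>e. exp (\<Sum>j. ?a j e) * ((1 - exp (- (e * x))) / e)) \<longlongrightarrow> exp (suminf ?b) * x) (at_right 0)"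
  proof (intro tendsto_intros S(2))
    have "((\<lambda>e. 1 - exp (- (e * x))) has_field_derivative x) (at 0 within {0<..})"
      by (auto intro!: derivative_eq_intros)
    then show "((\<lambda>e. (1 - exp (- (e * x))) / e) \<longlongrightarrow> x) (at_right 0)"
      by (simp add: has_field_derivative_iff)
  qed
  moreover have "exp (suminf ?b) * x = sin (pi * x) / pi"
    using sine_log_series[OF x S(1)] x by simp
  moreover have "eventually (\<lambda>e. exp (\<Sum>j. ?a j e) * ((1 - exp (- (e * x))) / e) =
     qinf (exp (- (e * x))) (exp (- e)) * qinf (exp (- (e * (1 - x)))) (exp (- e)) / euler_product e ^ 2 / e) (at_right 0)"
    using eventually_at_right_less
  proof eventually_elim
    case (elim e)
    have p: "0 < qinf (exp (- (e * x))) (exp (- e))" "0 < qinf (exp (- (e * (1 - x)))) (exp (- e))"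
      using elim x by (auto intro!: qinf_pos)
    have "0 < 1 - exp (- (e * x))" using elim x by simp
    then show ?case
      using sums_unique[OF qinf_sine_quotient[OF x elim], symmetric] p euler_product_pos[OF elim] x
      by (simp add: exp_diff)
  qed
  ultimately show ?thesis using tendsto_cong by fastforce
qed

text \<open>The integrand is only assumed to be continuous on the open half-line, with a bound that is decreasing and integrable: each sample point
lies to the right of its cell, so the same bound dominates the step functions.\<close>

lemma riemann_sum_tendsto:
  fixes \<phi> :: "real \<Rightarrow> real"
  assumes [measurable]: "\<phi> \<in> borel_measurable borel"
    and cont: "\<And>v. 0 < v \<Longrightarrow> isCont \<phi> v"
    and bound: "\<And>v. 0 < v \<Longrightarrow> \<bar>\<phi> v\<bar> \<le> C / (1 + v ^ 2)"
  shows "\<exists>I. ((\<lambda>e. \<Sum>k. e * \<phi> (e * real (Suc k))) \<longlongrightarrow> I) (at_right 0)"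
proof -
  define f where "f = (\<lambda>e (n::int). if 0 \<le> n then e * \<phi> (e * (of_int n + 1)) else 0)"
  define s where "s = (\<lambda>e v. if 0 \<le> \<lfloor>v / e\<rfloor> then \<phi> (e * (of_int \<lfloor>v / e\<rfloor> + 1)) else 0)"
  define f0 where "f0 = (\<lambda>v. if 0 \<le> v then \<phi> v else 0)"
  have C: "0 \<le> C" using bound[of 1] by auto
  have dom: "\<bar>s e v\<bar> \<le> C * inverse (1 + v ^ 2)" if e: "0 < e" "e < 1" for e v
  proof (cases "0 \<le> \<lfloor>v / e\<rfloor>")
    case True
    then have v: "0 \<le> v" using e by (simp add: zero_le_divide_iff)
    let ?u = "e * (of_int \<lfloor>v / e\<rfloor> + 1)"
    have "v / e < of_int \<lfloor>v / e\<rfloor> + 1" by linarith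
    then have u: "v < ?u" using e by (simp add: field_simps)
    have "\<bar>s e v\<bar> \<le> C / (1 + ?u ^ 2)" using True bound[of ?u] u v by (simp add: s_def)
    also have "\<dots> \<le> C / (1 + v ^ 2)"
      using C u v by (intro divide_left_mono add_left_mono power_mono mult_pos_pos) (auto intro: add_pos_nonneg)
    finally show ?thesis by (simp add: divide_inverse)
  qed (use C in \<open>simp add: s_def\<close>)
  have int: "integrable lborel (\<lambda>v::real. C * inverse (1 + v ^ 2))"
    using integrable_inverse_1_plus_square by (simp add: set_integrable_def)
  have lim: "AE v in lborel. ((\<lambda>e. s e v) \<longlongrightarrow> f0 v) (at_right 0)"
    using AE_lborel_singleton[of "0::real"]
  proof eventually_elim
    case (elim v)
    show ?case
    proof (cases "0 < v")
      case True
      have "((\<lambda>e. e * of_int \<lfloor>v / e\<rfloor> + e) \<longlongrightarrow> v + 0) (at_right 0)"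
        by (intro tendsto_add tendsto_floor_scaled tendsto_ident_at)
      then have "((\<lambda>e. e * (of_int \<lfloor>v / e\<rfloor> + 1)) \<longlongrightarrow> v) (at_right 0)" by (simp add: algebra_simps)
      then have "((\<lambda>e. \<phi> (e * (of_int \<lfloor>v / e\<rfloor> + 1))) \<longlongrightarrow> \<phi> v) (at_right 0)"
        by (rule isCont_tendsto_compose[OF cont[OF True]])
      moreover have "\<forall>\<^sub>F e in at_right 0. \<phi> (e * (of_int \<lfloor>v / e\<rfloor> + 1)) = s e v"
        using eventually_at_right_less by eventually_elim (use True in \<open>auto simp: s_def zero_le_divide_iff\<close>)
      ultimately have "((\<lambda>e. s e v) \<longlongrightarrow> \<phi> v) (at_right 0)"
        by (rule Lim_transform_eventually)
      then show ?thesis using True by (simp add: f0_def)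
    next
      case False
      with elim have v: "v < 0" by auto
      have "\<forall>\<^sub>F e in at_right 0. s e v = f0 v"
        using eventually_at_right_less by eventually_elim (use v in \<open>auto simp: s_def f0_def zero_le_divide_iff\<close>)
      then show ?thesis by (rule tendsto_eventually)
    qed
  qed
  have meas: "s e \<in> borel_measurable lborel" "f0 \<in> borel_measurable lborel" for e
    by (simp_all add: s_def f0_def)
  note conv = tendsto_integral_at_right_0[OF meas(2,1) int lim dom zero_less_one, unfolded]
  have "(\<Sum>k. e * \<phi> (e * real (Suc k))) = integral\<^sup>L lborel (s e)" if e: "0 < e" "e < 1" for e
  proof -
    have eq: "s e = (\<lambda>v. f e \<lfloor>0 + (1 / e) *\<^sub>R v\<rfloor> / e)" using e by (auto simp: s_def f_def fun_eq_iff)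
    have "integrable lborel (\<lambda>v. e * s e v)" using conv(2) e by blast
    moreover have "(\<lambda>v. e * s e v) = (\<lambda>v. f e \<lfloor>0 + (1 / e) *\<^sub>R v\<rfloor>)"
      using e by (simp add: eq)
    ultimately have i: "integrable lborel (\<lambda>v::real. f e \<lfloor>0 + (1 / e) *\<^sub>R v\<rfloor>)" by simp
    note A = lborel_integral_affine[where f = "\<lambda>v::real. f e \<lfloor>v\<rfloor>" and t = 0 and c = "1 / e", OF _ _ i]
    have "(f e has_sum (\<integral>v. f e \<lfloor>v::real\<rfloor> \<partial>lborel)) UNIV"
      by (rule has_sum_floor_integral[OF A(1)]) (use e in auto)
    also have "(\<integral>v. f e \<lfloor>v::real\<rfloor> \<partial>lborel) = integral\<^sup>L lborel (s e)"
      using A(2) e unfolding eq by simp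
    finally have "(\<lambda>n. f e (int n)) sums integral\<^sup>L lborel (s e)"
      by (rule has_sum_int_imp_sums) (simp add: f_def)
    then show ?thesis by (simp add: f_def sums_iff add.commute)
  qed
  then have "\<forall>\<^sub>F e in at_right 0. integral\<^sup>L lborel (s e) = (\<Sum>k. e * \<phi> (e * real (Suc k)))"
    by (auto intro!: eventually_at_rightI[of _ 1])
  with conv(1) have "((\<lambda>e. \<Sum>k. e * \<phi> (e * real (Suc k))) \<longlongrightarrow> integral\<^sup>L lborel f0) (at_right 0)"
    by (rule Lim_transform_eventually)
  then show ?thesis ..
qed

text \<open>The term \<open>exp (-v) / 2\<close> in place of \<open>1 / 2\<close> keeps the remainder integrable at infinity without changing its order at 0.\<close>

lemma bose_remainder_bound:
  fixes v :: real
  assumes v: "0 < v"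
  shows "\<bar>(1 / (exp v - 1) - 1 / v + exp (- v) / 2) / v\<bar> \<le> 2 / (1 + v ^ 2)"
proof (cases "v \<le> 1")
  case True
  have "0 \<le> 1 - exp (- v)" "1 - exp (- v) \<le> v" using v exp_ge_add_one_self[of "- v"] by auto
  then have "\<bar>1 / (exp v - 1) - 1 / v + exp (- v) / 2\<bar> \<le> v / 2"
    unfolding abs_le_iff using bose_expansion_lower[OF v] bose_expansion_upper[OF v] v by linarith
  then have "\<bar>(1 / (exp v - 1) - 1 / v + exp (- v) / 2) / v\<bar> \<le> 1 / 2"
    using v by (simp add: pos_divide_le_eq)
  also have "\<dots> \<le> 2 / (1 + v ^ 2)"
    using True v power_le_one[of v 2] by (simp add: pos_le_divide_eq add_pos_nonneg)
  finally show ?thesis .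
next
  case False
  have e: "v \<le> exp v - 1" using exp_ge_add_one_self[of v] by linarith
  from e have 1: "1 / (exp v - 1) \<le> 1 / v" by (rule divide_left_mono) (use v in auto)
  have 0: "0 \<le> 1 / (exp v - 1)" using v by simp
  have "v * exp (- v) \<le> exp v * exp (- v)"
    using e by (intro mult_right_mono) (linarith, simp)
  then have 2: "exp (- v) \<le> 1 / v" using v by (simp add: field_simps flip: exp_add)
  have "\<bar>1 / (exp v - 1) - 1 / v + exp (- v) / 2\<bar> \<le> 1 / v"
    unfolding abs_le_iff using 0 1 2 exp_gt_zero[of "- v"] by linarith
  then have "\<bar>(1 / (exp v - 1) - 1 / v + exp (- v) / 2) / v\<bar> \<le> 1 / v / v"
    using v by (simp only: abs_divide abs_of_pos) (rule divide_right_mono, simp_all)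
  also have "\<dots> \<le> 2 / (1 + v ^ 2)"
  proof -
    have "1 \<le> v ^ 2" using False by (simp add: one_le_power)
    then have "1 * (1 + v ^ 2) \<le> 2 * v ^ 2" by simp
    then show ?thesis using v by (simp add: divide_simps power2_eq_square add_pos_nonneg)
  qed
  finally show ?thesis .
qed

text \<open>At \<open>x = 1\<close> the terms \<open>1 / (2 k)\<close> in the expansion of the Lambert series are not summable. With
\<open>exp (- e k) / (2 k)\<close> in their place they sum to \<open>- ln (1 - q) / 2\<close>, and what is left is a Riemann sum.\<close>

lemma neg_ln_euler_product_tendsto:
  "\<exists>c. ((\<lambda>e. - ln (euler_product e) - pi ^ 2 / 6 / e - ln e / 2) \<longlongrightarrow> c) (at_right 0)"
proof -
  define \<phi> where "\<phi> = (\<lambda>v::real. (1 / (exp v - 1) - 1 / v + exp (- v) / 2) / v)"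
  have "\<exists>I. ((\<lambda>e. \<Sum>k. e * \<phi> (e * real (Suc k))) \<longlongrightarrow> I) (at_right 0)"
  proof (rule riemann_sum_tendsto)
    show "\<phi> \<in> borel_measurable borel" by (simp add: \<phi>_def)
    show "isCont \<phi> v" if "0 < v" for v
      using that unfolding \<phi>_def by (intro continuous_intros) auto
    show "\<bar>\<phi> v\<bar> \<le> 2 / (1 + v ^ 2)" if "0 < v" for v
      using bose_remainder_bound[OF that] by (simp add: \<phi>_def)
  qed
  then obtain I where I: "((\<lambda>e. \<Sum>k. e * \<phi> (e * real (Suc k))) \<longlongrightarrow> I) (at_right 0)" ..
  have eq: "- ln (euler_product e) - pi ^ 2 / 6 / e - ln e / 2 =
      (\<Sum>k. e * \<phi> (e * real (Suc k))) + ln ((1 - exp (- e)) / e) / 2" if e: "0 < e" for e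
  proof -
    have q: "\<bar>exp (- e)\<bar> < 1" using e by simp
    have "(\<lambda>k. 1 ^ k / real k * (1 / (exp (e * k) - 1)) - 1 ^ k / real k ^ 2 / e + exp (- e) ^ k / real k / 2)
      sums (- ln (qinf (1 * exp (- e)) (exp (- e))) - dilog 1 / e + - ln (1 - exp (- e)) / 2)"
      unfolding dilog_def
      by (intro sums_add sums_diff sums_divide neg_ln_qinf_sums summable_sums summable_dilog ln_1_minus_sums q) (use e in auto)
    also have "(\<lambda>k. 1 ^ k / real k * (1 / (exp (e * k) - 1)) - 1 ^ k / real k ^ 2 / e + exp (- e) ^ k / real k / 2)
      = (\<lambda>k. e * \<phi> (e * real k))"
    proof
      fix k show "1 ^ k / real k * (1 / (exp (e * k) - 1)) - 1 ^ k / real k ^ 2 / e + exp (- e) ^ k / real k / 2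
        = e * \<phi> (e * real k)"
        using e by (cases "k = 0") (simp_all add: \<phi>_def power_exp_eq field_simps power2_eq_square)
    qed
    finally have "(\<lambda>k. e * \<phi> (e * real (Suc k))) sums (- ln (euler_product e) - pi ^ 2 / 6 / e + - ln (1 - exp (- e)) / 2)"
      by (subst sums_Suc_iff) (simp add: euler_product_def dilog_1 \<phi>_def)
    moreover have "ln ((1 - exp (- e)) / e) = ln (1 - exp (- e)) - ln e"
      using e by (simp add: ln_div)
    ultimately show ?thesis by (simp add: sums_iff field_simps)
  qed
  have "((\<lambda>e::real. ln ((1 - exp (- e)) / e) / 2) \<longlongrightarrow> 0) (at_right 0)" by real_asymp
  from tendsto_add[OF I this]
  have sum: "((\<lambda>e. (\<Sum>k. e * \<phi> (e * real (Suc k))) + ln ((1 - exp (- e)) / e) / 2) \<longlongrightarrow> I) (at_right 0)"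
    by simp
  have "\<forall>\<^sub>F e in at_right 0. (\<Sum>k. e * \<phi> (e * real (Suc k))) + ln ((1 - exp (- e)) / e) / 2
      = - ln (euler_product e) - pi ^ 2 / 6 / e - ln e / 2"
    using eventually_at_right_less by eventually_elim (rule eq[symmetric])
  with sum have "((\<lambda>e. - ln (euler_product e) - pi ^ 2 / 6 / e - ln e / 2) \<longlongrightarrow> I) (at_right 0)"
    by (rule Lim_transform_eventually)
  then show ?thesis by blast
qed

lemma qinf_duplication:
  assumes "0 \<le> x" "x < 1" "0 < q" "q < 1"
  shows "ln (qinf x q) = ln (qinf x (q ^ 2)) + ln (qinf (x * q) (q ^ 2))"
proof -
  have q2: "0 < q ^ 2" "q ^ 2 < 1" using assms by (auto simp: power_less_one_iff)
  have "x * q < 1 * 1" using assms by (intro mult_strict_mono) auto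
  then have xq: "0 \<le> x * q" "x * q < 1" using assms by auto
  have "(\<lambda>n. sum (\<lambda>n. ln (1 - x * q ^ n)) {n * 2..<n * 2 + 2}) sums ln (qinf x q)"
    by (rule sums_group[OF ln_qinf_sums[OF assms]]) simp
  moreover have "sum (\<lambda>n. ln (1 - x * q ^ n)) {n * 2..<n * 2 + 2} = ln (1 - x * (q ^ 2) ^ n) + ln (1 - x * q * (q ^ 2) ^ n)" for n
  proof -
    have "sum (\<lambda>n. ln (1 - x * q ^ n)) {m..<m + 2} = ln (1 - x * q ^ m) + ln (1 - x * q ^ Suc m)" for m
      by (simp add: numeral_2_eq_2)
    moreover have "(q ^ 2) ^ n = q ^ (n * 2)" by (simp only: power_mult[symmetric] mult.commute)
    ultimately show ?thesis by (simp add: mult.assoc)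
  qed
  moreover have "(\<lambda>n. ln (1 - x * (q ^ 2) ^ n) + ln (1 - x * q * (q ^ 2) ^ n)) sums (ln (qinf x (q ^ 2)) + ln (qinf (x * q) (q ^ 2)))"
    by (intro sums_add ln_qinf_sums assms q2 xq)
  ultimately show ?thesis using sums_unique2 by simp
qed

text \<open>If \<open>h(e)\<close> denotes the negated expression, with limit \<open>c\<close>, then the duplication formula expresses the logarithm of
\<open>((q; q^2) / (q^2; q^2))^2 / (2 e)\<close> as \<open>- 2 h(e) + 4 h(2 e) + ln 2\<close>. Its limit is \<open>- ln \<pi>\<close> by
\<open>tendsto_qinf_sine\<close> at \<open>x = 1 / 2\<close>, hence \<open>2 c + ln 2 = - ln \<pi>\<close>.\<close>

lemma ln_euler_product_tendsto:
  "((\<lambda>e. ln (euler_product e) + pi ^ 2 / 6 / e + ln e / 2) \<longlongrightarrow> ln (2 * pi) / 2) (at_right 0)"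
proof -
  define h where "h = (\<lambda>e. - ln (euler_product e) - pi ^ 2 / 6 / e - ln e / 2)"
  obtain c where c: "(h \<longlongrightarrow> c) (at_right 0)" using neg_ln_euler_product_tendsto unfolding h_def by blast
  have c2: "((\<lambda>e. h (2 * e)) \<longlongrightarrow> c) (at_right 0)"
    by (rule filterlim_compose[OF c filterlim_scale_at_right_0]) simp
  let ?W = "\<lambda>e. qinf (exp (- (e * (1/2)))) (exp (- e)) * qinf (exp (- (e * (1 - 1/2)))) (exp (- e)) / euler_product e ^ 2 / e"
  have "(?W \<longlongrightarrow> sin (pi * (1/2)) / pi) (at_right 0)" by (rule tendsto_qinf_sine) auto
  from filterlim_compose[OF this filterlim_scale_at_right_0[of 2]]
  have "((\<lambda>e. ?W (2 * e)) \<longlongrightarrow> 1 / pi) (at_right 0)" by simp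
  then have "((\<lambda>e. ln (?W (2 * e))) \<longlongrightarrow> ln (1 / pi)) (at_right 0)" by (rule tendsto_ln) simp
  moreover have "\<forall>\<^sub>F e in at_right 0. ln (?W (2 * e)) = - 2 * h e + 4 * h (2 * e) + ln 2"
    using eventually_at_right_less
  proof eventually_elim
    case (elim e)
    let ?q = "exp (- e)"
    have q: "0 < ?q" "?q < 1" using elim by auto
    have q2: "?q ^ 2 = exp (- (2 * e))" by (simp add: power_exp_eq)
    have p: "0 < qinf ?q (exp (- (2 * e)))" by (rule qinf_pos) (use elim in auto)
    have dup: "ln (euler_product e) = ln (qinf ?q (exp (- (2 * e)))) + ln (euler_product (2 * e))"
      using qinf_duplication[of ?q ?q] q unfolding euler_product_def q2[symmetric] by (simp add: power2_eq_square)
    have "?W (2 * e) = qinf ?q (exp (- (2 * e))) * qinf ?q (exp (- (2 * e))) / euler_product (2 * e) ^ 2 / (2 * e)"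
      by simp
    then have W: "ln (?W (2 * e)) = 2 * ln (qinf ?q (exp (- (2 * e)))) - 2 * ln (euler_product (2 * e)) - ln (2 * e)"
      using ln_quotient[OF p p euler_product_pos[of "2 * e"]] p euler_product_pos[of "2 * e"] elim
        ln_divide_pos[of "qinf ?q (exp (- (2 * e))) * qinf ?q (exp (- (2 * e))) / euler_product (2 * e) ^ 2" "2 * e"]
      by simp
    have "ln (2 * e) = ln 2 + ln e" "pi ^ 2 / 6 / (2 * e) = pi ^ 2 / 6 / e / 2"
      using elim by (simp_all add: ln_mult_pos)
    then show ?case unfolding W dup h_def by (simp add: algebra_simps)
  qed
  ultimately have "((\<lambda>e. - 2 * h e + 4 * h (2 * e) + ln 2) \<longlongrightarrow> ln (1 / pi)) (at_right 0)"
    by (rule Lim_transform_eventually)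
  moreover have "((\<lambda>e. - 2 * h e + 4 * h (2 * e) + ln 2) \<longlongrightarrow> - 2 * c + 4 * c + ln 2) (at_right 0)"
    by (intro tendsto_intros c c2)
  ultimately have "- 2 * c + 4 * c + ln 2 = ln (1 / pi)"
    by (intro tendsto_unique[of "at_right (0::real)"]) auto
  then have "- c = ln (2 * pi) / 2" by (simp add: ln_div ln_mult_pos)
  then have "((\<lambda>e. - h e) \<longlongrightarrow> ln (2 * pi) / 2) (at_right 0)" using tendsto_minus[OF c] by (simp only:)
  then show ?thesis by (simp add: h_def algebra_simps)
qed

section \<open>Leading amplitudes of the products\<close>

lemma leading_amplitudeI:
  assumes "((\<lambda>e. G (exp (- e)) * exp (- (Lam / e))) \<longlongrightarrow> K) (at_right 0)" "K \<noteq> 0"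
  shows "leading_amplitude G K"
proof -
  have "((\<lambda>e. G (exp (- e)) * exp (- (Lam / e)) / K) \<longlongrightarrow> K / K) (at_right 0)"
    by (intro tendsto_divide assms tendsto_const)
  then have "((\<lambda>e. G (exp (- e)) / (K * exp (Lam / e))) \<longlongrightarrow> 1) (at_right 0)"
    using assms(2) by (simp add: exp_minus field_simps)
  then show ?thesis unfolding leading_amplitude_def by (rule asymp_equivI')
qed

text \<open>The limit \<open>tendsto_qinf_sine\<close> multiplied by the square of the asymptotics of \<open>(q; q)\<^sub>\<infinity>\<close>.\<close>

lemma tendsto_qinf_pair:
  assumes x: "0 < x" "x < 1"
  shows "((\<lambda>e. qinf (exp (- (e * x))) (exp (- e)) * qinf (exp (- (e * (1 - x)))) (exp (- e)) * exp (pi ^ 2 / 3 / e))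
    \<longlongrightarrow> 2 * sin (pi * x)) (at_right 0)"
proof -
  let ?P = "\<lambda>e. qinf (exp (- (e * x))) (exp (- e)) * qinf (exp (- (e * (1 - x)))) (exp (- e))"
  have "((\<lambda>e. ?P e / euler_product e ^ 2 / e * exp (2 * (ln (euler_product e) + pi ^ 2 / 6 / e + ln e / 2)))
      \<longlongrightarrow> sin (pi * x) / pi * exp (2 * (ln (2 * pi) / 2))) (at_right 0)"
    by (intro tendsto_intros tendsto_qinf_sine x ln_euler_product_tendsto)
  moreover have "sin (pi * x) / pi * exp (2 * (ln (2 * pi) / 2)) = 2 * sin (pi * x)" by simp
  moreover have "\<forall>\<^sub>F e in at_right 0. ?P e / euler_product e ^ 2 / e * exp (2 * (ln (euler_product e) + pi ^ 2 / 6 / e + ln e / 2))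
     = ?P e * exp (pi ^ 2 / 3 / e)"
    using eventually_at_right_less
  proof eventually_elim
    case (elim e)
    have "exp (2 * (ln (euler_product e) + pi ^ 2 / 6 / e + ln e / 2))
      = exp (ln (euler_product e) + ln (euler_product e) + ln e + pi ^ 2 / 3 / e)"
      by (simp add: algebra_simps)
    also have "\<dots> = euler_product e ^ 2 * e * exp (pi ^ 2 / 3 / e)"
      unfolding exp_add power2_eq_square using elim euler_product_pos[OF elim] by simp
    finally show ?case using elim euler_product_pos[OF elim] by simp
  qed
  ultimately show ?thesis by (rule tendsto_transfer)
qed

text \<open>The four residues form two pairs \<open>k, 13 - k\<close>, and \<open>tendsto_qinf_pair\<close> applies to each of them with \<open>13 e\<close> for \<open>e\<close> and
\<open>x = k / 13\<close>.\<close>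

lemma leading_amplitude_product:
  assumes "0 < a" "a < 13" "0 < b" "b < 13"
    and G: "\<And>q. 0 < q \<Longrightarrow> q < 1 \<Longrightarrow> G q = inverse (qpoch_inf [q ^ a, q ^ b, q ^ (13 - b), q ^ (13 - a)] (q ^ 13))"
  shows "leading_amplitude G (1 / (4 * sin (a * pi / 13) * sin (b * pi / 13)))"
proof (rule leading_amplitudeI)
  let ?P = "\<lambda>x e. qinf (exp (- (e * x))) (exp (- e)) * qinf (exp (- (e * (1 - x)))) (exp (- e)) * exp (pi ^ 2 / 3 / e)"
  have sin: "0 < sin (pi * (k / 13))" if "0 < k" "k < 13" for k :: nat
    using that by (intro sin_gt_zero) auto
  have P: "((\<lambda>e. ?P (k / 13) (13 * e)) \<longlongrightarrow> 2 * sin (pi * (k / 13))) (at_right 0)" if "0 < k" "k < 13" for k :: nat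
    by (rule filterlim_compose[OF tendsto_qinf_pair filterlim_scale_at_right_0]) (use that in auto)
  have "((\<lambda>e. inverse (?P (a / 13) (13 * e) * ?P (b / 13) (13 * e)))
     \<longlongrightarrow> inverse ((2 * sin (pi * (a / 13))) * (2 * sin (pi * (b / 13))))) (at_right 0)"
    using sin[of a] sin[of b] assms by (intro tendsto_inverse tendsto_mult P) auto
  moreover have "inverse ((2 * sin (pi * (a / 13))) * (2 * sin (pi * (b / 13)))) = 1 / (4 * sin (a * pi / 13) * sin (b * pi / 13))"
    by (simp add: field_simps)
  moreover have "\<forall>\<^sub>F e in at_right 0. inverse (?P (a / 13) (13 * e) * ?P (b / 13) (13 * e)) = G (exp (- e)) * exp (- (Lam / e))"
    using eventually_at_right_less
  proof eventually_elim
    case (elim e)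
    have pw: "exp (- e) ^ k = exp (- (13 * e * (k / 13)))" "exp (- e) ^ (13 - k) = exp (- (13 * e * (1 - k / 13)))"
      if "k < 13" for k :: nat
      using that by (simp_all add: power_exp_eq of_nat_diff algebra_simps)
    have "G (exp (- e)) = inverse (qpoch_inf [exp (- e) ^ a, exp (- e) ^ b, exp (- e) ^ (13 - b), exp (- e) ^ (13 - a)] (exp (- (13 * e))))"
      using G[of "exp (- e)"] elim by (simp add: power_exp_eq[of _ 13])
    also have "\<dots> = inverse ((qinf (exp (- (13 * e * (a / 13)))) (exp (- (13 * e))) * qinf (exp (- (13 * e * (1 - a / 13)))) (exp (- (13 * e))))
       * (qinf (exp (- (13 * e * (b / 13)))) (exp (- (13 * e))) * qinf (exp (- (13 * e * (1 - b / 13)))) (exp (- (13 * e)))))"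
      unfolding pw[OF assms(2)] pw[OF assms(4)] qpoch_inf_def qinf_def by (simp add: mult_ac)
    finally have g: "G (exp (- e)) = \<dots>" .
    have "exp (pi ^ 2 / 3 / (13 * e)) * exp (pi ^ 2 / 3 / (13 * e)) = inverse (exp (- (Lam / e)))"
      by (simp add: Lam_def exp_minus flip: exp_add)
    then have l: "exp (- (Lam / e)) = inverse (exp (pi ^ 2 / 3 / (13 * e)) * exp (pi ^ 2 / 3 / (13 * e)))"
      by simp
    show ?case unfolding g l by (simp only: inverse_mult_distrib mult_ac)
  qed
  ultimately show "((\<lambda>e. G (exp (- e)) * exp (- (Lam / e))) \<longlongrightarrow> 1 / (4 * sin (a * pi / 13) * sin (b * pi / 13))) (at_right 0)"
    by (rule tendsto_transfer)
  show "1 / (4 * sin (a * pi / 13) * sin (b * pi / 13)) \<noteq> 0"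
    using sin[of a] sin[of b] assms by (simp add: mult.commute)
qed

lemma inverse_eq_div_sqrt_13:
  assumes "x ^ 2 * s ^ 2 = 13" "0 < x" "0 < s" shows "1 / s = x / sqrt 13"
proof -
  have "x * s = sqrt 13" using assms by (intro real_sqrt_unique[symmetric]) (auto simp: power_mult_distrib)
  then show ?thesis using assms by (auto simp: field_simps)
qed

lemma leading_amplitude_P:
  "leading_amplitude P0 (alpha / sqrt 13)" "leading_amplitude P1 (beta / sqrt 13)" "leading_amplitude P2 (gamma / sqrt 13)"
proof -
  have sin: "0 < sin (k * pi / 13)" if "0 < k" "k < 13" for k :: real
    using that by (intro sin_gt_zero) (auto simp: field_simps)
  have s: "0 < 4 * sin (i * pi / 13) * sin (j * pi / 13)" if "0 < i" "i < 13" "0 < j" "j < 13" for i j :: real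
    using sin[of i] sin[of j] that by simp
  have p: "0 < alpha" "0 < beta" "0 < gamma"
    using beta_less_alpha by (auto simp: gamma_eq rho)
  have 0: "1 / (4 * sin (pi / 13) * sin (5 * pi / 13)) = alpha / sqrt 13"
    by (rule inverse_eq_div_sqrt_13[OF period_difference_norms(1)]) (use p s[of 1 5] in auto)
  have 1: "1 / (4 * sin (2 * pi / 13) * sin (3 * pi / 13)) = beta / sqrt 13"
    by (rule inverse_eq_div_sqrt_13[OF period_difference_norms(2)]) (use p s[of 2 3] in auto)
  have 2: "1 / (4 * sin (4 * pi / 13) * sin (6 * pi / 13)) = gamma / sqrt 13"
    by (rule inverse_eq_div_sqrt_13[OF period_difference_norms(3)]) (use p s[of 4 6] in auto)
  show "leading_amplitude P0 (alpha / sqrt 13)"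
    using leading_amplitude_product[of 1 5 P0] by (simp add: P0_def 0)
  show "leading_amplitude P1 (beta / sqrt 13)"
    using leading_amplitude_product[of 2 3 P1] by (simp add: P1_def 1)
  show "leading_amplitude P2 (gamma / sqrt 13)"
    using leading_amplitude_product[of 4 6 P2] by (simp add: P2_def 2)
qed

section \<open>The saddle point\<close>

text \<open>The coordinates \<open>(U, V)\<close> of the critical point, as the limits of \<open>\<epsilon> r\<close> and \<open>13 \<epsilon> s\<close>.\<close>

definition saddle_r :: real where "saddle_r = - ln rho"

definition saddle_s :: real where "saddle_s = - ln sigma0"

lemma saddle_pos: "0 < saddle_r" "0 < saddle_s"
  using rho sigma0_bounds by (auto simp: saddle_r_def saddle_s_def ln_less_zero)

lemma exp_saddle: "exp (- saddle_r) = rho" "exp (- saddle_s) = sigma0"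
  using rho sigma0_bounds by (auto simp: saddle_r_def saddle_s_def)

lemma saddle_equations:
  "ln (1 - rho) = - (4 * saddle_r + saddle_s)" "ln (1 - sigma0) = - (13 * saddle_r + 4 * saddle_s)"
proof -
  have p: "0 < rho" "0 < sigma0" using rho sigma0_bounds by auto
  show "ln (1 - rho) = - (4 * saddle_r + saddle_s)"
    unfolding rho_4_sigma0[symmetric] using p by (simp add: ln_mult_pos ln_realpow saddle_r_def saddle_s_def)
  show "ln (1 - sigma0) = - (13 * saddle_r + 4 * saddle_s)"
    unfolding rho_13_sigma0[symmetric] using p by (simp add: ln_mult_pos ln_realpow saddle_r_def saddle_s_def)
qed

text \<open>The logarithms in Rogers' dilogarithm are linear in \<open>U\<close> and \<open>V\<close> by \<open>saddle_equations\<close>, so \<open>rogers_identity\<close> becomes a statement about the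
critical value of the exponent.\<close>

lemma saddle_value:
  "2 * saddle_r ^ 2 + saddle_r * saddle_s + 2 / 13 * saddle_s ^ 2 + dilog rho + dilog sigma0 / 13
     = pi ^ 2 / 6 + pi ^ 2 / 6 / 13 - Lam"
proof -
  have ln: "ln rho = - saddle_r" "ln sigma0 = - saddle_s" by (simp_all add: saddle_r_def saddle_s_def)
  show ?thesis
    using rogers_identity unfolding rogers_def saddle_equations Lam_def ln
    by (simp add: field_simps power2_eq_square)
qed

text \<open>The expression under the third root is the determinant of the negated Hessian of the exponent in the variables \<open>r, s\<close>, divided by
\<open>\<epsilon>^2\<close>. The first two factors come from the half-logarithms in \<open>neg_ln_qinf_approx\<close>.\<close>

lemma hessian_constant:
  "sqrt (1 - rho) * sqrt (1 - sigma0) * sqrt ((4 + rho / (1 - rho)) * (52 + 13 * (sigma0 / (1 - sigma0))) - 13 ^ 2)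
    = 13 * (1 - rho) / rho"
proof -
  have p: "0 < 1 - rho" "0 < 1 - sigma0" "0 < rho" using rho sigma0_bounds by auto
  have "(1 - rho) * (1 - sigma0) * ((4 + rho / (1 - rho)) * (52 + 13 * (sigma0 / (1 - sigma0))) - 13 ^ 2)
    = ((1 - rho) * (4 + rho / (1 - rho))) * ((1 - sigma0) * (52 + 13 * (sigma0 / (1 - sigma0)))) - 169 * (1 - rho) * (1 - sigma0)"
  proof -
    have "a * b * (x * y - 13 ^ 2) = (a * x) * (b * y) - 169 * a * b" for a b x y :: real
      by (simp add: algebra_simps)
    then show ?thesis .
  qed
  also have "(1 - rho) * (4 + rho / (1 - rho)) = 4 - 3 * rho"
    using p by (simp add: distrib_left)
  also have "(1 - sigma0) * (52 + 13 * (sigma0 / (1 - sigma0))) = 13 * (4 - 3 * sigma0)"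
    using p by (simp add: distrib_left)
  finally have E: "(1 - rho) * (1 - sigma0) * ((4 + rho / (1 - rho)) * (52 + 13 * (sigma0 / (1 - sigma0))) - 13 ^ 2)
    = (4 - 3 * rho) * (13 * (4 - 3 * sigma0)) - 169 * (1 - rho) * (1 - sigma0)" .
  have "rho ^ 2 * ((1 - rho) * (1 - sigma0) * ((4 + rho / (1 - rho)) * (52 + 13 * (sigma0 / (1 - sigma0))) - 13 ^ 2))
    = 13 * (rho ^ 2 * ((4 - 3 * rho) * (4 - 3 * sigma0) - 13 * (1 - rho) * (1 - sigma0)))"
    unfolding E by (simp add: algebra_simps)
  also have "\<dots> = (13 * (1 - rho)) ^ 2" unfolding kappa_hessian by (simp only: power2_eq_square mult_ac)
  finally have "(1 - rho) * (1 - sigma0) * ((4 + rho / (1 - rho)) * (52 + 13 * (sigma0 / (1 - sigma0))) - 13 ^ 2)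
    = (13 * (1 - rho) / rho) ^ 2"
    using p by (simp add: power_divide nonzero_eq_divide_eq mult.commute)
  then have "sqrt ((1 - rho) * (1 - sigma0) * ((4 + rho / (1 - rho)) * (52 + 13 * (sigma0 / (1 - sigma0))) - 13 ^ 2))
    = 13 * (1 - rho) / rho"
    using p by (simp only: real_sqrt_abs) simp
  then show ?thesis by (simp only: real_sqrt_mult)
qed

lemma has_field_derivative_dilog_exp:
  "0 < u \<Longrightarrow> ((\<lambda>u. dilog (exp (- u))) has_field_derivative ln (1 - exp (- u))) (at u)"
  by (auto intro!: derivative_eq_intros)

lemma dilog_exp_above_tangent:
  assumes "0 < u" "0 < U"
  shows "dilog (exp (- U)) + (u - U) * ln (1 - exp (- U)) \<le> dilog (exp (- u))"
proof -
  have "convex_on {0<..} (\<lambda>u. dilog (exp (- u)))"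
    by (rule convex_on_realI[where f' = "\<lambda>u. ln (1 - exp (- u))"])
      (use has_field_derivative_dilog_exp in auto)
  from convex_on_imp_above_tangent[OF this, of U u "ln (1 - exp (- U))"]
  show ?thesis
    using assms has_field_derivative_dilog_exp[of U]
    by (auto simp: interior_open has_field_derivative_at_within mult.commute)
qed

lemma dilog_exp_taylor:
  assumes U: "0 < U"
  shows "((\<lambda>d. (dilog (exp (- (U + d))) - dilog (exp (- U)) - d * ln (1 - exp (- U))) / d ^ 2)
    \<longlongrightarrow> exp (- U) / (1 - exp (- U)) / 2) (at 0)"
proof (rule lhopital)
  let ?f = "\<lambda>d. dilog (exp (- (U + d))) - dilog (exp (- U)) - d * ln (1 - exp (- U))"
  have near: "\<forall>\<^sub>F d in at 0. 0 < U + d"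
  proof -
    have "((\<lambda>d. U + d) \<longlongrightarrow> U + 0) (at 0)" by (intro tendsto_intros)
    from order_tendstoD(1)[OF this, of 0] U show ?thesis by simp
  qed
  have deriv: "(?f has_field_derivative (ln (1 - exp (- (U + d))) - ln (1 - exp (- U)))) (at d)" if "0 < U + d" for d
  proof -
    have "((\<lambda>d. dilog (exp (- (U + d)))) has_field_derivative ln (1 - exp (- (U + d))) * 1) (at d)"
      by (rule DERIV_chain2[where f = "\<lambda>u. dilog (exp (- u))" and g = "\<lambda>d. U + d",
            OF has_field_derivative_dilog_exp[OF that]]) (auto intro!: derivative_eq_intros)
    from DERIV_diff[OF DERIV_diff[OF this DERIV_const[of "dilog (exp (- U))"]]
        DERIV_cmult_right[OF DERIV_ident, of "ln (1 - exp (- U))"]]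
    show ?thesis by simp
  qed
  show "\<forall>\<^sub>F d in at 0. DERIV ?f d :> ln (1 - exp (- (U + d))) - ln (1 - exp (- U))"
    using near by eventually_elim (rule deriv)
  have "isCont ?f 0" using deriv[of 0] U by (intro DERIV_isCont) auto
  then show "(?f \<longlongrightarrow> 0) (at 0)" by (simp add: isCont_def)
  show "((\<lambda>d. d ^ 2) \<longlongrightarrow> 0) (at (0::real))" by (auto intro!: tendsto_eq_intros)
  show "\<forall>\<^sub>F d in at 0. d ^ 2 \<noteq> (0::real)" "\<forall>\<^sub>F d in at 0. 2 * d \<noteq> (0::real)"
    by (auto simp: eventually_at_filter)
  show "\<forall>\<^sub>F d in at 0. DERIV (\<lambda>d. d ^ 2) d :> 2 * (d::real)"
    by (intro always_eventually allI) (auto intro!: derivative_eq_intros)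
  have "((\<lambda>u. ln (1 - exp (- u))) has_field_derivative exp (- U) / (1 - exp (- U))) (at U)"
    using U by (auto intro!: derivative_eq_intros)
  then have "((\<lambda>d. (ln (1 - exp (- (U + d))) - ln (1 - exp (- U))) / d) \<longlongrightarrow> exp (- U) / (1 - exp (- U))) (at 0)"
    by (simp add: DERIV_def)
  from tendsto_divide[OF this tendsto_const[of 2]]
  show "((\<lambda>d. (ln (1 - exp (- (U + d))) - ln (1 - exp (- U))) / (2 * d)) \<longlongrightarrow> exp (- U) / (1 - exp (- U)) / 2) (at 0)"
    by (simp add: field_simps)
qed

text \<open>The displacement from the critical point has order \<open>\<surd>e\<close>, so the second-order remainder is of the order of \<open>e\<close> and survives the division
by \<open>e\<close>.\<close>

lemma dilog_exp_taylor_scaled: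
  assumes U: "0 < U" and X: "((\<lambda>e. (u e - U) / sqrt e) \<longlongrightarrow> x) (at_right 0)"
  shows "((\<lambda>e. (dilog (exp (- u e)) - dilog (exp (- U)) - (u e - U) * ln (1 - exp (- U))) / e)
    \<longlongrightarrow> exp (- U) / (1 - exp (- U)) / 2 * x ^ 2) (at_right 0)"
    and "(u \<longlongrightarrow> U) (at_right 0)"
proof -
  let ?c = "exp (- U) / (1 - exp (- U)) / 2"
  define S where "S = (\<lambda>d. if d = 0 then ?c else (dilog (exp (- (U + d))) - dilog (exp (- U)) - d * ln (1 - exp (- U))) / d ^ 2)"
  have "(S \<longlongrightarrow> ?c) (at 0)"
    by (rule Lim_transform_eventually[OF dilog_exp_taylor[OF U]])
      (auto simp: S_def eventually_at_filter)
  then have S: "isCont S 0" by (simp add: isCont_def S_def)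
  have s0: "((\<lambda>e::real. sqrt e) \<longlongrightarrow> 0) (at_right 0)"
    by (rule tendsto_eq_intros | simp)+
  have "((\<lambda>e. (u e - U) / sqrt e * sqrt e) \<longlongrightarrow> x * 0) (at_right 0)"
    by (intro tendsto_mult X s0)
  then have d0: "((\<lambda>e. u e - U) \<longlongrightarrow> 0) (at_right 0)"
  proof (rule tendsto_transfer)
    show "\<forall>\<^sub>F e in at_right 0. (u e - U) / sqrt e * sqrt e = u e - U"
      using eventually_at_right_less by eventually_elim simp
  qed simp
  from tendsto_add[OF d0 tendsto_const[of U]] show "(u \<longlongrightarrow> U) (at_right 0)" by simp
  have "((\<lambda>e. S (u e - U) * ((u e - U) / sqrt e) ^ 2) \<longlongrightarrow> S 0 * x ^ 2) (at_right 0)"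
    by (intro tendsto_intros X isCont_tendsto_compose[OF S] d0)
  then show "((\<lambda>e. (dilog (exp (- u e)) - dilog (exp (- U)) - (u e - U) * ln (1 - exp (- U))) / e)
    \<longlongrightarrow> ?c * x ^ 2) (at_right 0)"
  proof (rule tendsto_transfer)
    show "\<forall>\<^sub>F e in at_right 0. S (u e - U) * ((u e - U) / sqrt e) ^ 2
      = (dilog (exp (- u e)) - dilog (exp (- U)) - (u e - U) * ln (1 - exp (- U))) / e"
      using eventually_at_right_less
      by eventually_elim (simp add: S_def power_divide)
  qed (simp add: S_def)
qed

text \<open>The product \<open>(q^(r+1); q)\<^sub>\<infinity>\<close> at \<open>u = e r\<close>, divided by the exponential of the tangent at \<open>U\<close> of its leading exponent. After this
normalisation it is bounded uniformly in \<open>u\<close> and \<open>e\<close>, and its limit carries both the Gaussian factor and the square root.\<close>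

definition normalized_tail :: "real \<Rightarrow> real \<Rightarrow> real \<Rightarrow> real" where
  "normalized_tail U e u = qinf (exp (- u) * exp (- e)) (exp (- e))
    * exp ((dilog (exp (- U)) + (u - U) * ln (1 - exp (- U))) / e)"

lemma qinf_shift_pos: "0 < e \<Longrightarrow> 0 \<le> u \<Longrightarrow> 0 < qinf (exp (- u) * exp (- e)) (exp (- e))"
  by (rule qinf_pos) (auto simp flip: exp_add)

text \<open>The tangent at \<open>U\<close> of the convex function \<open>u \<mapsto> Li(exp (-u))\<close> is evaluated at \<open>u + e\<close>; the shift by \<open>e\<close> costs the factor
\<open>1 / (1 - exp (- U))\<close>.\<close>

lemma normalized_tail_bounds:
  assumes e: "0 < e" and u: "0 \<le> u" and U: "0 < U"
  shows "0 \<le> normalized_tail U e u" "normalized_tail U e u \<le> 1 / (1 - exp (- U))"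
proof -
  let ?q = "qinf (exp (- u) * exp (- e)) (exp (- e))"
  note pos = qinf_shift_pos[OF e u]
  show "0 \<le> normalized_tail U e u" using pos by (simp add: normalized_tail_def)
  have "dilog (exp (- U)) + (u + e - U) * ln (1 - exp (- U)) \<le> dilog (exp (- (u + e)))"
    by (rule dilog_exp_above_tangent) (use e u U in auto)
  moreover have "dilog (exp (- (u + e))) / e \<le> - ln ?q"
    using dilog_le_neg_ln_qinf[of e "exp (- u)"] e u by (simp flip: exp_add)
  ultimately have "(dilog (exp (- U)) + (u + e - U) * ln (1 - exp (- U))) / e \<le> - ln ?q"
    using e by (meson divide_right_mono less_imp_le order_trans)
  moreover have "(dilog (exp (- U)) + (u + e - U) * ln (1 - exp (- U))) / e
    = (dilog (exp (- U)) + (u - U) * ln (1 - exp (- U))) / e + ln (1 - exp (- U))"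
    using e by (simp add: field_simps)
  ultimately have "ln ?q + (dilog (exp (- U)) + (u - U) * ln (1 - exp (- U))) / e \<le> - ln (1 - exp (- U))"
    by linarith
  then have "exp (ln ?q + (dilog (exp (- U)) + (u - U) * ln (1 - exp (- U))) / e) \<le> exp (- ln (1 - exp (- U)))"
    by simp
  note le = this
  show "normalized_tail U e u \<le> 1 / (1 - exp (- U))"
  proof -
    have inv: "exp (- ln y) = 1 / y" if "0 < y" for y :: real
      using that by (simp add: exp_minus divide_inverse)
    show ?thesis using le pos inv[of "1 - exp (- U)"] U by (simp add: normalized_tail_def exp_add)
  qed
qed

lemma normalized_tail_tendsto:
  assumes U: "0 < U" and c: "0 < c" and X: "((\<lambda>e. (u e - U) / sqrt e) \<longlongrightarrow> x) (at_right 0)"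
  shows "((\<lambda>e. normalized_tail U (c * e) (u e)) \<longlongrightarrow>
    exp (- (exp (- U) / (1 - exp (- U)) / 2 * x ^ 2 / c)) / sqrt (1 - exp (- U))) (at_right 0)"
proof -
  let ?q = "\<lambda>e. qinf (exp (- u e) * exp (- (c * e))) (exp (- (c * e)))"
  let ?l = "ln (1 - exp (- U))" and ?k = "exp (- U) / (1 - exp (- U)) / 2"
  note T = dilog_exp_taylor_scaled(1)[OF U X] and uU = dilog_exp_taylor_scaled(2)[OF U X]
  have u0: "\<forall>\<^sub>F e in at_right 0. 0 < u e" using order_tendstoD(1)[OF uU U] .
  have U1: "exp (- U) < 1" using U by simp
  have l1: "((\<lambda>e. - ln (?q e) - dilog (exp (- u e)) / (c * e) - ln (1 - exp (- u e)) / 2) \<longlongrightarrow> 0) (at_right 0)"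
  proof (rule Lim_null_comparison)
    have "((\<lambda>e. c * e / 4 / (1 - exp (- u e))) \<longlongrightarrow> c * 0 / 4 / (1 - exp (- U))) (at_right 0)"
      using U1 by (intro tendsto_intros uU) auto
    then show "((\<lambda>e. c * e / 4 / (1 - exp (- u e))) \<longlongrightarrow> 0) (at_right 0)" by simp
    show "\<forall>\<^sub>F e in at_right 0. norm (- ln (?q e) - dilog (exp (- u e)) / (c * e) - ln (1 - exp (- u e)) / 2)
      \<le> c * e / 4 / (1 - exp (- u e))"
      using u0 eventually_at_right_less
    proof eventually_elim
      case (elim e)
      then show ?case using neg_ln_qinf_approx[of "c * e" "exp (- u e)"] c by simp
    qed
  qed
  have l2: "((\<lambda>e. ln (1 - exp (- u e)) / 2) \<longlongrightarrow> ?l / 2) (at_right 0)"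
    using U1 by (intro tendsto_intros uU) auto
  have l3: "((\<lambda>e. (dilog (exp (- u e)) - dilog (exp (- U)) - (u e - U) * ?l) / e / c) \<longlongrightarrow> ?k * x ^ 2 / c) (at_right 0)"
    by (intro tendsto_divide T tendsto_const) (use c in auto)
  have "((\<lambda>e. exp (- ((- ln (?q e) - dilog (exp (- u e)) / (c * e) - ln (1 - exp (- u e)) / 2)
     + ln (1 - exp (- u e)) / 2 + (dilog (exp (- u e)) - dilog (exp (- U)) - (u e - U) * ?l) / e / c)))
     \<longlongrightarrow> exp (- (0 + ?l / 2 + ?k * x ^ 2 / c))) (at_right 0)"
    by (intro tendsto_exp tendsto_minus tendsto_add l1 l2 l3)
  then show ?thesis
  proof (rule tendsto_transfer)
    have A1: "exp (- (0 + ?l / 2 + ?k * x ^ 2 / c)) = exp (- (?k * x ^ 2 / c)) * inverse (exp (?l / 2))"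
    proof -
      have "- (0 + ?l / 2 + ?k * x ^ 2 / c) = - (?k * x ^ 2 / c) + - (?l / 2)" by simp
      then show ?thesis by (simp only: exp_add exp_minus[of "?l / 2"])
    qed
    have A2: "exp (?l / 2) = sqrt (1 - exp (- U))"
      using U1 by (intro real_sqrt_unique[symmetric]) (auto simp: power2_eq_square simp flip: exp_add)
    show "exp (- (0 + ?l / 2 + ?k * x ^ 2 / c)) = exp (- (?k * x ^ 2 / c)) / sqrt (1 - exp (- U))"
      unfolding A1 A2 by (rule divide_inverse[symmetric])
    show "\<forall>\<^sub>F e in at_right 0. exp (- ((- ln (?q e) - dilog (exp (- u e)) / (c * e) - ln (1 - exp (- u e)) / 2)
     + ln (1 - exp (- u e)) / 2 + (dilog (exp (- u e)) - dilog (exp (- U)) - (u e - U) * ?l) / e / c)) = normalized_tail U (c * e) (u e)"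
      using u0 eventually_at_right_less
    proof eventually_elim
      case (elim e)
      have "- ((- ln (?q e) - dilog (exp (- u e)) / (c * e) - ln (1 - exp (- u e)) / 2)
     + ln (1 - exp (- u e)) / 2 + (dilog (exp (- u e)) - dilog (exp (- U)) - (u e - U) * ?l) / e / c)
       = ln (?q e) + (dilog (exp (- U)) + (u e - U) * ?l) / (c * e)"
      proof -
        have "- ((- L - D / (c * e) - m / 2) + m / 2 + (D - D0 - t) / e / c) = L + (D0 + t) / (c * e)"
          for L D m D0 t :: real
          by (simp add: add_divide_distrib diff_divide_distrib mult.commute)
        then show ?thesis .
      qed
      then have eq: "exp (- ((- ln (?q e) - dilog (exp (- u e)) / (c * e) - ln (1 - exp (- u e)) / 2)
     + ln (1 - exp (- u e)) / 2 + (dilog (exp (- u e)) - dilog (exp (- U)) - (u e - U) * ?l) / e / c))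
        = exp (ln (?q e)) * exp ((dilog (exp (- U)) + (u e - U) * ?l) / (c * e))" by (simp only: exp_add)
      have "0 < ?q e" using qinf_shift_pos[of "c * e" "u e"] elim c by simp
      then show ?case unfolding eq normalized_tail_def by simp
    qed
  qed
qed

section \<open>Laplace summation of the double series\<close>

text \<open>The factor \<open>1 / ((q; q)\<^sub>\<infinity> (q^13; q^13)\<^sub>\<infinity>)\<close> without its exponential growth.\<close>

definition prefactor :: "real \<Rightarrow> real" where
  "prefactor e = exp (- (pi ^ 2 / 6 / e)) / euler_product e * (exp (- (pi ^ 2 / 6 / (13 * e))) / euler_product (13 * e))"

lemma prefactor_tendsto: "((\<lambda>e. prefactor e / e) \<longlongrightarrow> sqrt 13 / (2 * pi)) (at_right 0)"
proof -
  have E: "((\<lambda>e. exp (- (ln (euler_product e) + pi ^ 2 / 6 / e + ln e / 2))) \<longlongrightarrow> exp (- (ln (2 * pi) / 2))) (at_right 0)"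
    by (intro tendsto_exp tendsto_minus ln_euler_product_tendsto)
  have E13: "((\<lambda>e. exp (- (ln (euler_product (13 * e)) + pi ^ 2 / 6 / (13 * e) + ln (13 * e) / 2))) \<longlongrightarrow> exp (- (ln (2 * pi) / 2))) (at_right 0)"
    by (rule filterlim_compose[OF E filterlim_scale_at_right_0]) simp
  have half: "exp (- (ln y / 2)) = 1 / sqrt y" if "0 < y" for y :: real
  proof -
    have "exp (ln y / 2) = sqrt y"
      using that by (intro real_sqrt_unique[symmetric]) (auto simp: power2_eq_square simp flip: exp_add)
    then show ?thesis by (simp only: exp_minus divide_inverse mult_1)
  qed
  have trm: "exp (- (ln (euler_product e) + pi ^ 2 / 6 / e + ln e / 2)) = exp (- (pi ^ 2 / 6 / e)) / euler_product e / sqrt e" if e: "0 < e" for e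
  proof -
    have "- (ln (euler_product e) + pi ^ 2 / 6 / e + ln e / 2) = - (pi ^ 2 / 6 / e) + - ln (euler_product e) + - (ln e / 2)" by simp
    then have "exp (- (ln (euler_product e) + pi ^ 2 / 6 / e + ln e / 2)) = exp (- (pi ^ 2 / 6 / e)) * exp (- ln (euler_product e)) * exp (- (ln e / 2))"
      by (simp only: exp_add)
    also have "exp (- ln (euler_product e)) = 1 / euler_product e"
      using euler_product_pos[OF e] by (simp add: exp_minus divide_inverse)
    finally show ?thesis using half[OF e] by simp
  qed
  have "((\<lambda>e. sqrt 13 * (exp (- (ln (euler_product e) + pi ^ 2 / 6 / e + ln e / 2))
      * exp (- (ln (euler_product (13 * e)) + pi ^ 2 / 6 / (13 * e) + ln (13 * e) / 2))))
      \<longlongrightarrow> sqrt 13 * (exp (- (ln (2 * pi) / 2)) * exp (- (ln (2 * pi) / 2)))) (at_right 0)"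
    by (intro tendsto_mult tendsto_const E E13)
  then show ?thesis
  proof (rule tendsto_transfer)
    show "sqrt 13 * (exp (- (ln (2 * pi) / 2)) * exp (- (ln (2 * pi) / 2))) = sqrt 13 / (2 * pi)"
      using half[of "2 * pi"] by simp
    show "\<forall>\<^sub>F e in at_right 0. sqrt 13 * (exp (- (ln (euler_product e) + pi ^ 2 / 6 / e + ln e / 2))
      * exp (- (ln (euler_product (13 * e)) + pi ^ 2 / 6 / (13 * e) + ln (13 * e) / 2))) = prefactor e / e"
      using eventually_at_right_less
    proof eventually_elim
      case (elim e)
      have e13: "0 < 13 * e" using elim by simp
      have "sqrt (13 * e) = sqrt 13 * sqrt e" "sqrt e * sqrt e = e"
        using elim by (simp_all add: real_sqrt_mult)
      then show ?case
        unfolding trm[OF elim] trm[OF e13] prefactor_def using elim by simp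
    qed
  qed
qed

text \<open>The remaining part of the general term at \<open>u = e r\<close>, \<open>v = 13 e s\<close>, as a function of real arguments. Only the quadratic form around the
critical point is left in the exponent, because the value and the linear terms cancel (\<open>F_term_eq\<close>).\<close>

definition summand :: "real \<Rightarrow> real \<Rightarrow> real \<Rightarrow> real \<Rightarrow> real \<Rightarrow> real" where
  "summand a b e u v = exp (- (2 * (u - saddle_r) ^ 2 + (u - saddle_r) * (v - saddle_s) + 2 / 13 * (v - saddle_s) ^ 2) / e
      - a * u - b * (v / 13)) * normalized_tail saddle_r e u * normalized_tail saddle_s (13 * e) v"

text \<open>Expanding the quadratic form around the critical point, the linear terms are those of the two tangents by \<open>saddle_equations\<close>, and
the constant term is \<open>\<Lambda>\<close> by \<open>saddle_value\<close>.\<close>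

lemma F_term_eq:
  assumes e: "0 < e"
  shows "exp (- e) powr (2 * real r ^ 2 + 13 * real r * real s + 26 * real s ^ 2 + a * real r + b * real s)
       / (qpoch (exp (- e)) (exp (- e)) r * qpoch (exp (- e) ^ 13) (exp (- e) ^ 13) s) * exp (- (Lam / e))
    = prefactor e * summand a b e (e * r) (13 * e * s)"
proof -
  let ?u = "e * r" and ?v = "13 * e * s"
  let ?H = "qinf (exp (- ?u) * exp (- e)) (exp (- e))" and ?K = "qinf (exp (- ?v) * exp (- (13 * e))) (exp (- (13 * e)))"
  have H: "0 < ?H" and K: "0 < ?K" using qinf_shift_pos[of e ?u] qinf_shift_pos[of "13 * e" ?v] e by simp_all
  have q: "qpoch (exp (- e')) (exp (- e')) n = euler_product e' / qinf (exp (- (e' * n)) * exp (- e')) (exp (- e'))"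
    if "0 < e'" for e' :: real and n :: nat
  proof -
    have "exp (- e') * exp (- e') ^ n = exp (- (e' * n)) * exp (- e')"
      by (simp add: power_exp_eq mult.commute)
    moreover have "0 < qinf (exp (- (e' * n)) * exp (- e')) (exp (- e'))" using that by (intro qinf_shift_pos) auto
    ultimately show ?thesis
      using qpoch_mult_qinf[of "exp (- e')" "exp (- e')" n] that
      by (simp add: euler_product_def nonzero_eq_divide_eq mult.commute)
  qed
  have e13: "0 < 13 * e" using e by simp
  have 13: "exp (- e) ^ 13 = exp (- (13 * e))" by (simp add: power_exp_eq)
  have pw: "exp (- e) powr x = exp (- (e * x))" for x by (simp add: powr_def mult.commute)
  have exponent: "- (e * (2 * real r ^ 2 + 13 * real r * real s + 26 * real s ^ 2 + a * real r + b * real s)) - Lam / e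
    = - (2 * (?u - saddle_r) ^ 2 + (?u - saddle_r) * (?v - saddle_s) + 2 / 13 * (?v - saddle_s) ^ 2) / e
      - a * ?u - b * (?v / 13) + (dilog rho + (?u - saddle_r) * ln (1 - rho)) / e
      + (dilog sigma0 + (?v - saddle_s) * ln (1 - sigma0)) / (13 * e) - pi ^ 2 / 6 / e - pi ^ 2 / 6 / (13 * e)" (is "?L = ?R")
  proof -
    have L: "Lam = pi ^ 2 / 6 + pi ^ 2 / 6 / 13 - (2 * saddle_r ^ 2 + saddle_r * saddle_s + 2 / 13 * saddle_s ^ 2 + dilog rho + dilog sigma0 / 13)"
      using saddle_value by simp
    have i: "z / (13 * e) = z / 13 / e" for z :: real by simp
    have "2 * ?u ^ 2 + ?u * ?v + 2 / 13 * ?v ^ 2 = e * (2 * real r ^ 2 + 13 * real r * real s + 26 * real s ^ 2) * e"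
      by (simp add: power2_eq_square algebra_simps)
    then have Z: "(2 * ?u ^ 2 + ?u * ?v + 2 / 13 * ?v ^ 2) / e = e * (2 * real r ^ 2 + 13 * real r * real s + 26 * real s ^ 2)"
      using e by simp
    have "- (N + M) / e = - (N / e) - M / e" for N M :: real by (simp add: diff_divide_distrib)
    then have "- (2 * ?u ^ 2 + ?u * ?v + 2 / 13 * ?v ^ 2 + Lam) / e
        = - (e * (2 * real r ^ 2 + 13 * real r * real s + 26 * real s ^ 2)) - Lam / e"
      unfolding Z[symmetric] .
    then have "?L = - (2 * ?u ^ 2 + ?u * ?v + 2 / 13 * ?v ^ 2 + Lam) / e - a * ?u - b * (?v / 13)"
      by (simp only:) (simp add: algebra_simps)
    also have "2 * ?u ^ 2 + ?u * ?v + 2 / 13 * ?v ^ 2 + Lam =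
      (2 * (?u - saddle_r) ^ 2 + (?u - saddle_r) * (?v - saddle_s) + 2 / 13 * (?v - saddle_s) ^ 2)
      - (dilog rho + (?u - saddle_r) * ln (1 - rho)) - (dilog sigma0 + (?v - saddle_s) * ln (1 - sigma0)) / 13
      + pi ^ 2 / 6 + pi ^ 2 / 6 / 13"
      unfolding L saddle_equations by (simp add: field_simps power2_eq_square)
    finally show ?thesis unfolding i by (simp add: add_divide_distrib diff_divide_distrib)
  qed
  let ?A = "- (2 * (?u - saddle_r) ^ 2 + (?u - saddle_r) * (?v - saddle_s) + 2 / 13 * (?v - saddle_s) ^ 2) / e
      - a * ?u - b * (?v / 13)"
    and ?B = "(dilog rho + (?u - saddle_r) * ln (1 - rho)) / e"
    and ?C = "(dilog sigma0 + (?v - saddle_s) * ln (1 - sigma0)) / (13 * e)"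
  have "?L = ?A + ?B + ?C + - (pi ^ 2 / 6 / e) + - (pi ^ 2 / 6 / (13 * e))"
    unfolding exponent by simp
  moreover have "?L = - (e * (2 * real r ^ 2 + 13 * real r * real s + 26 * real s ^ 2 + a * real r + b * real s)) + - (Lam / e)"
    by simp
  ultimately have ex: "exp (- (e * (2 * real r ^ 2 + 13 * real r * real s + 26 * real s ^ 2 + a * real r + b * real s))) * exp (- (Lam / e))
    = exp ?A * exp ?B * exp ?C * exp (- (pi ^ 2 / 6 / e)) * exp (- (pi ^ 2 / 6 / (13 * e)))"
    by (simp only: exp_add[symmetric])
  have "exp (- e) powr (2 * real r ^ 2 + 13 * real r * real s + 26 * real s ^ 2 + a * real r + b * real s)
       / (qpoch (exp (- e)) (exp (- e)) r * qpoch (exp (- e) ^ 13) (exp (- e) ^ 13) s) * exp (- (Lam / e))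
    = exp (- (e * (2 * real r ^ 2 + 13 * real r * real s + 26 * real s ^ 2 + a * real r + b * real s)))
       / (euler_product e / ?H * (euler_product (13 * e) / ?K)) * exp (- (Lam / e))"
    unfolding 13 q[OF e] q[OF e13] pw ..
  also have "\<dots> = (exp (- (e * (2 * real r ^ 2 + 13 * real r * real s + 26 * real s ^ 2 + a * real r + b * real s))) * exp (- (Lam / e)))
      * ?H * ?K / (euler_product e * euler_product (13 * e))"
    by simp
  also have "\<dots> = prefactor e * summand a b e ?u ?v"
    unfolding ex prefactor_def summand_def normalized_tail_def exp_saddle by simp
  finally show ?thesis .
qed

text \<open>The lattice point of index \<open>x / \<surd>e\<close> relative to the critical point, in rescaled coordinates. The factor \<open>c\<close> is 1 for \<open>r\<close> and 13 for \<open>s\<close>.\<close>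

lemma floor_scaled_window:
  assumes c: "0 < c"
  shows "0 < e \<Longrightarrow> c * x - c * sqrt e < (c * e * of_int \<lfloor>U / (c * e) + x / sqrt e\<rfloor> - U) / sqrt e"
    and "0 < e \<Longrightarrow> (c * e * of_int \<lfloor>U / (c * e) + x / sqrt e\<rfloor> - U) / sqrt e \<le> c * x"
    and "((\<lambda>e. (c * e * of_int \<lfloor>U / (c * e) + x / sqrt e\<rfloor> - U) / sqrt e) \<longlongrightarrow> c * x) (at_right 0)"
proof -
  have A: "c * x - c * sqrt e < (c * e * of_int \<lfloor>U / (c * e) + x / sqrt e\<rfloor> - U) / sqrt e
    \<and> (c * e * of_int \<lfloor>U / (c * e) + x / sqrt e\<rfloor> - U) / sqrt e \<le> c * x" if e: "0 < e" for e
  proof -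
    have ce: "0 < c * e" using c e by simp
    have se: "e = sqrt e * sqrt e" "0 < sqrt e" using e by auto
    have "U / (c * e) + x / sqrt e = (U + c * x * sqrt e) / (c * e)"
      using c e by (simp add: field_simps)
    then have "U + c * x * sqrt e - c * e < c * e * of_int \<lfloor>U / (c * e) + x / sqrt e\<rfloor>"
      "c * e * of_int \<lfloor>U / (c * e) + x / sqrt e\<rfloor> \<le> U + c * x * sqrt e"
      using floor_scaled_bounds[OF ce, of "U + c * x * sqrt e"] by simp_all
    moreover have "(c * x - c * sqrt e) * sqrt e = c * x * sqrt e - c * e"
      using se(1) by (simp add: algebra_simps)
    ultimately show ?thesis using se(2) by (simp add: pos_less_divide_eq pos_divide_le_eq)
  qed
  then show "0 < e \<Longrightarrow> c * x - c * sqrt e < (c * e * of_int \<lfloor>U / (c * e) + x / sqrt e\<rfloor> - U) / sqrt e"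
    "0 < e \<Longrightarrow> (c * e * of_int \<lfloor>U / (c * e) + x / sqrt e\<rfloor> - U) / sqrt e \<le> c * x" by auto
  show "((\<lambda>e. (c * e * of_int \<lfloor>U / (c * e) + x / sqrt e\<rfloor> - U) / sqrt e) \<longlongrightarrow> c * x) (at_right 0)"
  proof (rule real_tendsto_sandwich)
    have "((\<lambda>e. c * x - c * sqrt e) \<longlongrightarrow> c * x - c * sqrt 0) (at_right 0)" by (intro tendsto_intros)
    then show "((\<lambda>e. c * x - c * sqrt e) \<longlongrightarrow> c * x) (at_right 0)" by simp
    show "\<forall>\<^sub>F e in at_right 0. c * x - c * sqrt e \<le> (c * e * of_int \<lfloor>U / (c * e) + x / sqrt e\<rfloor> - U) / sqrt e"
      using eventually_at_right_less by eventually_elim (use A in \<open>auto simp: less_imp_le\<close>)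
    show "\<forall>\<^sub>F e in at_right 0. (c * e * of_int \<lfloor>U / (c * e) + x / sqrt e\<rfloor> - U) / sqrt e \<le> c * x"
      using eventually_at_right_less by eventually_elim (use A in auto)
  qed auto
qed

lemma summand_nonneg: "0 < e \<Longrightarrow> 0 \<le> u \<Longrightarrow> 0 \<le> v \<Longrightarrow> 0 \<le> summand a b e u v"
  using normalized_tail_bounds(1)[of e u saddle_r] normalized_tail_bounds(1)[of "13 * e" v saddle_s] saddle_pos
  by (simp add: summand_def)

lemma square_shift_le:
  fixes x X :: real assumes "\<bar>x - X\<bar> \<le> 1" shows "x ^ 2 / 2 - 1 \<le> X ^ 2"
proof -
  have "(x - X) ^ 2 \<le> 1" using assms by (simp add: abs_square_le_1)
  moreover have "0 \<le> (x - 2 * X) ^ 2" by simp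
  ultimately show ?thesis by (simp add: power2_eq_square algebra_simps)
qed

lemma linear_le_quadratic: "\<bar>a\<bar> * \<bar>x\<bar> \<le> x ^ 2 / 12 + 3 * a ^ 2" for a x :: real
proof -
  have "0 \<le> (\<bar>x\<bar> / 6 - \<bar>a\<bar>) ^ 2" by simp
  then have "0 \<le> x ^ 2 / 36 + a ^ 2 - \<bar>a\<bar> * \<bar>x\<bar> / 3"
    by (simp add: power2_eq_square algebra_simps)
  then show ?thesis by simp
qed

text \<open>The quadratic form \<open>2 X^2 + 13 X Y + 26 Y^2\<close> is at least \<open>(X^2 + Y^2) / 3\<close>. Half of this is spent on moving from the lattice point to
\<open>(x, y)\<close> and half of the rest on absorbing the linear terms from \<open>a\<close> and \<open>b\<close>, which leaves the exponent \<open>- (x^2 + y^2) / 12\<close>.\<close>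

lemma summand_dominated:
  assumes e: "0 < e" "e < 1" and u: "0 \<le> u" and v: "0 \<le> v"
    and X: "\<bar>x - (u - saddle_r) / sqrt e\<bar> \<le> 1" and Y: "\<bar>y - (v - saddle_s) / (13 * sqrt e)\<bar> \<le> 1"
  shows "summand a b e u v \<le>
    exp (2 / 3 + \<bar>a\<bar> * (saddle_r + 1) + \<bar>b\<bar> * (saddle_s + 1) + 3 * a ^ 2 + 3 * b ^ 2) / ((1 - rho) * (1 - sigma0))
      * (exp (- (1 / 12) * (x - 0) ^ 2) * exp (- (1 / 12) * (y - 0) ^ 2))"
proof -
  define X' Y' where "X' = (u - saddle_r) / sqrt e" and "Y' = (v - saddle_s) / (13 * sqrt e)"
  have se: "sqrt e * sqrt e = e" "0 < sqrt e" "sqrt e \<le> 1" using e by auto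
  have uX: "u - saddle_r = sqrt e * X'" and vY: "v - saddle_s = 13 * sqrt e * Y'"
    using se by (simp_all add: X'_def Y'_def)
  have "(2 * (u - saddle_r) ^ 2 + (u - saddle_r) * (v - saddle_s) + 2 / 13 * (v - saddle_s) ^ 2)
    = (sqrt e * sqrt e) * (2 * X' ^ 2 + 13 * X' * Y' + 26 * Y' ^ 2)"
  proof -
    have "2 * (w * X') ^ 2 + (w * X') * (13 * w * Y') + 2 / 13 * (13 * w * Y') ^ 2
      = (w * w) * (2 * X' ^ 2 + 13 * X' * Y' + 26 * Y' ^ 2)" for w :: real
      by (simp add: power2_eq_square algebra_simps)
    then show ?thesis unfolding uX vY .
  qed
  then have quad: "- (2 * (u - saddle_r) ^ 2 + (u - saddle_r) * (v - saddle_s) + 2 / 13 * (v - saddle_s) ^ 2) / e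
    = - (2 * X' ^ 2 + 13 * X' * Y' + 26 * Y' ^ 2)" using se(1) e by simp
  have pd: "(X' ^ 2 + Y' ^ 2) / 3 \<le> 2 * X' ^ 2 + 13 * X' * Y' + 26 * Y' ^ 2"
  proof -
    \<comment> \<open>Completing the square in \<open>(5 / 3) X^2 + 13 X Y + (77 / 3) Y^2\<close>.\<close>
    have "0 \<le> 5 / 3 * (X' + 39 / 10 * Y') ^ 2 + (77 / 3 - 5 / 3 * (39 / 10) ^ 2) * Y' ^ 2"
      by (intro add_nonneg_nonneg mult_nonneg_nonneg) (auto simp: power2_eq_square)
    then show ?thesis by (simp add: power2_eq_square algebra_simps)
  qed
  have sq: "x ^ 2 / 2 - 1 \<le> X' ^ 2" "y ^ 2 / 2 - 1 \<le> Y' ^ 2"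
    using X Y by (auto intro!: square_shift_le simp: X'_def Y'_def)
  have "\<bar>X'\<bar> \<le> \<bar>x\<bar> + 1" "\<bar>Y'\<bar> \<le> \<bar>y\<bar> + 1" using X Y unfolding X'_def Y'_def by linarith+
  then have "sqrt e * \<bar>X'\<bar> \<le> 1 * (\<bar>x\<bar> + 1)" "sqrt e * \<bar>Y'\<bar> \<le> 1 * (\<bar>y\<bar> + 1)"
    using mult_mono[of "sqrt e" 1 "\<bar>X'\<bar>"] mult_mono[of "sqrt e" 1 "\<bar>Y'\<bar>"] se by simp_all
  moreover have "\<bar>sqrt e * X'\<bar> = sqrt e * \<bar>X'\<bar>" "\<bar>sqrt e * Y'\<bar> = sqrt e * \<bar>Y'\<bar>" using se by (auto simp: abs_mult)
  ultimately have XY: "\<bar>sqrt e * X'\<bar> \<le> \<bar>x\<bar> + 1" "\<bar>sqrt e * Y'\<bar> \<le> \<bar>y\<bar> + 1" by simp_all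
  have "u = saddle_r + sqrt e * X'" "v / 13 = saddle_s / 13 + sqrt e * Y'" using uX vY by simp_all
  then have uv: "\<bar>u\<bar> \<le> saddle_r + \<bar>x\<bar> + 1" "\<bar>v / 13\<bar> \<le> saddle_s + \<bar>y\<bar> + 1"
    using XY saddle_pos abs_triangle_ineq[of saddle_r "sqrt e * X'"] abs_triangle_ineq[of "saddle_s / 13" "sqrt e * Y'"]
    by (simp_all only: abs_divide abs_numeral) (simp_all)
  have "\<bar>a\<bar> * \<bar>u\<bar> \<le> \<bar>a\<bar> * (saddle_r + \<bar>x\<bar> + 1)" "\<bar>b\<bar> * \<bar>v / 13\<bar> \<le> \<bar>b\<bar> * (saddle_s + \<bar>y\<bar> + 1)"
    by (fact mult_left_mono[OF uv(1) abs_ge_zero] mult_left_mono[OF uv(2) abs_ge_zero])+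
  moreover have "- (a * u) \<le> \<bar>a\<bar> * \<bar>u\<bar>" "- (b * (v / 13)) \<le> \<bar>b\<bar> * \<bar>v / 13\<bar>"
    using abs_ge_minus_self[of "a * u"] abs_ge_minus_self[of "b * (v / 13)"] by (simp_all only: abs_mult)
  ultimately have lin: "- (a * u) \<le> \<bar>a\<bar> * (saddle_r + 1) + \<bar>a\<bar> * \<bar>x\<bar>" "- (b * (v / 13)) \<le> \<bar>b\<bar> * (saddle_s + 1) + \<bar>b\<bar> * \<bar>y\<bar>"
    by (simp_all add: algebra_simps)
  have "- (2 * X' ^ 2 + 13 * X' * Y' + 26 * Y' ^ 2) - a * u - b * (v / 13)
    \<le> (2 / 3 + \<bar>a\<bar> * (saddle_r + 1) + \<bar>b\<bar> * (saddle_s + 1) + 3 * a ^ 2 + 3 * b ^ 2) + (- (1 / 12) * (x - 0) ^ 2 + - (1 / 12) * (y - 0) ^ 2)"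
    using pd sq lin linear_le_quadratic[of a x] linear_le_quadratic[of b y] by simp
  then have E: "exp (- (2 * X' ^ 2 + 13 * X' * Y' + 26 * Y' ^ 2) - a * u - b * (v / 13))
    \<le> exp (2 / 3 + \<bar>a\<bar> * (saddle_r + 1) + \<bar>b\<bar> * (saddle_s + 1) + 3 * a ^ 2 + 3 * b ^ 2) * (exp (- (1 / 12) * (x - 0) ^ 2) * exp (- (1 / 12) * (y - 0) ^ 2))"
    by (simp only: exp_add[symmetric] exp_le_cancel_iff)
  have t: "0 \<le> normalized_tail saddle_r e u" "normalized_tail saddle_r e u \<le> 1 / (1 - rho)"
    "0 \<le> normalized_tail saddle_s (13 * e) v" "normalized_tail saddle_s (13 * e) v \<le> 1 / (1 - sigma0)"
    using normalized_tail_bounds[OF e(1) u saddle_pos(1)] normalized_tail_bounds[of "13 * e" v saddle_s] e v saddle_pos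
    by (auto simp: exp_saddle)
  have "summand a b e u v \<le> exp (2 / 3 + \<bar>a\<bar> * (saddle_r + 1) + \<bar>b\<bar> * (saddle_s + 1) + 3 * a ^ 2 + 3 * b ^ 2) * (exp (- (1 / 12) * (x - 0) ^ 2) * exp (- (1 / 12) * (y - 0) ^ 2))
    * (1 / (1 - rho)) * (1 / (1 - sigma0))"
    unfolding summand_def quad
    by (intro mult_mono E t mult_nonneg_nonneg) (use rho in auto)
  then show ?thesis by (simp add: mult_ac)
qed

definition limit_integrand :: "real \<times> real \<Rightarrow> real" where
  "limit_integrand z = exp (- ((4 + rho / (1 - rho)) * fst z ^ 2 + 2 * 13 * fst z * snd z
     + (52 + 13 * (sigma0 / (1 - sigma0))) * snd z ^ 2) / 2)"

text \<open>The limits of those factors of the summand that do not vary on the scale \<open>\<surd>e\<close> around the critical point.\<close>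

definition weight :: "real \<Rightarrow> real \<Rightarrow> real" where
  "weight a b = exp (- a * saddle_r - b * (saddle_s / 13)) / (sqrt (1 - rho) * sqrt (1 - sigma0))"

text \<open>The quadratic form contributes the matrix with entries \<open>4, 13, 52\<close> to the Gaussian, and the two normalised products add
\<open>\<rho> / (1 - \<rho>)\<close> and \<open>13 \<sigma> / (1 - \<sigma>)\<close> on the diagonal.\<close>

lemma summand_tendsto:
  assumes X: "((\<lambda>e. (u e - saddle_r) / sqrt e) \<longlongrightarrow> x) (at_right 0)"
    and Y: "((\<lambda>e. (v e - saddle_s) / sqrt e) \<longlongrightarrow> 13 * y) (at_right 0)"
  shows "((\<lambda>e. summand a b e (u e) (v e)) \<longlongrightarrow> weight a b * limit_integrand (x, y)) (at_right 0)"
proof -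
  let ?X = "\<lambda>e. (u e - saddle_r) / sqrt e" and ?Y = "\<lambda>e. (v e - saddle_s) / sqrt e"
  note nU = normalized_tail_tendsto[OF saddle_pos(1) zero_less_one X, unfolded exp_saddle]
    and nV = normalized_tail_tendsto[OF saddle_pos(2) _ Y, of 13, unfolded exp_saddle]
  note u = dilog_exp_taylor_scaled(2)[OF saddle_pos(1) X] and v = dilog_exp_taylor_scaled(2)[OF saddle_pos(2) Y]
  have "((\<lambda>e. exp (- (2 * ?X e ^ 2 + ?X e * ?Y e + 2 / 13 * ?Y e ^ 2) - a * u e - b * (v e / 13))
     * normalized_tail saddle_r (1 * e) (u e) * normalized_tail saddle_s (13 * e) (v e)) \<longlongrightarrow>
    exp (- (2 * x ^ 2 + x * (13 * y) + 2 / 13 * (13 * y) ^ 2) - a * saddle_r - b * (saddle_s / 13))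
     * (exp (- (rho / (1 - rho) / 2 * x ^ 2 / 1)) / sqrt (1 - rho))
     * (exp (- (sigma0 / (1 - sigma0) / 2 * (13 * y) ^ 2 / 13)) / sqrt (1 - sigma0))) (at_right 0)"
    by (intro tendsto_mult tendsto_exp tendsto_diff tendsto_minus tendsto_add tendsto_power tendsto_divide tendsto_const X Y u v nU nV) simp_all
  then show ?thesis
  proof (rule tendsto_transfer)
    have "- (2 * x ^ 2 + x * (13 * y) + 2 / 13 * (13 * y) ^ 2) - a * saddle_r - b * (saddle_s / 13)
        + - (k / 2 * x ^ 2 / 1) + - (l / 2 * (13 * y) ^ 2 / 13)
      = (- a * saddle_r - b * (saddle_s / 13)) + - ((4 + k) * x ^ 2 + 2 * 13 * x * y + (52 + 13 * l) * y ^ 2) / 2" for k l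
      by (simp add: field_simps power2_eq_square)
    from this[of "rho / (1 - rho)" "sigma0 / (1 - sigma0)"]
    have "exp (- (2 * x ^ 2 + x * (13 * y) + 2 / 13 * (13 * y) ^ 2) - a * saddle_r - b * (saddle_s / 13))
      * exp (- (rho / (1 - rho) / 2 * x ^ 2 / 1)) * exp (- (sigma0 / (1 - sigma0) / 2 * (13 * y) ^ 2 / 13))
      = exp (- a * saddle_r - b * (saddle_s / 13)) * limit_integrand (x, y)"
      unfolding limit_integrand_def fst_conv snd_conv by (simp only: exp_add[symmetric])
    then show "exp (- (2 * x ^ 2 + x * (13 * y) + 2 / 13 * (13 * y) ^ 2) - a * saddle_r - b * (saddle_s / 13))
     * (exp (- (rho / (1 - rho) / 2 * x ^ 2 / 1)) / sqrt (1 - rho))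
     * (exp (- (sigma0 / (1 - sigma0) / 2 * (13 * y) ^ 2 / 13)) / sqrt (1 - sigma0)) = weight a b * limit_integrand (x, y)"
      unfolding weight_def by (simp only: times_divide_eq_left times_divide_eq_right divide_divide_eq_left mult.commute[of "sqrt (1 - sigma0)"])
    show "\<forall>\<^sub>F e in at_right 0. exp (- (2 * ?X e ^ 2 + ?X e * ?Y e + 2 / 13 * ?Y e ^ 2) - a * u e - b * (v e / 13))
     * normalized_tail saddle_r (1 * e) (u e) * normalized_tail saddle_s (13 * e) (v e) = summand a b e (u e) (v e)"
      using eventually_at_right_less
    proof eventually_elim
      case (elim e)
      have s: "sqrt e * sqrt e = e" using elim by simp
      have "(p / w) ^ 2 = p ^ 2 / (w * w)" "(p / w) * (r / w) = p * r / (w * w)" for p r w :: real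
        by (simp_all add: power2_eq_square)
      then have q: "2 * ?X e ^ 2 + ?X e * ?Y e + 2 / 13 * ?Y e ^ 2
        = (2 * (u e - saddle_r) ^ 2 + (u e - saddle_r) * (v e - saddle_s) + 2 / 13 * (v e - saddle_s) ^ 2) / e"
        by (simp only: s add_divide_distrib times_divide_eq_right)
      show ?case unfolding summand_def q minus_divide_left mult_1 ..
    qed
  qed
qed

text \<open>Laplace's method: the series is the integral of the step function \<open>S e\<close> times \<open>prefactor e / e\<close>, and dominated convergence replaces the
step function by a Gaussian. The critical point has positive coordinates, so near it the restriction to nonnegative indices is void.\<close>

lemma F_tendsto:
  "((\<lambda>e. F a b (exp (- e)) * exp (- (Lam / e))) \<longlongrightarrow> kappa * rho powr a * sigma0 powr (b / 13)) (at_right 0)"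
proof -
  define W where "W = (\<lambda>e (p :: int \<times> int). if 0 \<le> fst p \<and> 0 \<le> snd p
    then summand a b e (e * of_int (fst p)) (13 * e * of_int (snd p)) else 0)"
  define S where "S = (\<lambda>e (z :: real \<times> real). W e (\<lfloor>saddle_r / e + fst z / sqrt e\<rfloor>, \<lfloor>saddle_s / (13 * e) + snd z / sqrt e\<rfloor>))"
  define u where "u = (\<lambda>e (z :: real \<times> real). e * of_int \<lfloor>saddle_r / e + fst z / sqrt e\<rfloor>)"
  define v where "v = (\<lambda>e (z :: real \<times> real). 13 * e * of_int \<lfloor>saddle_s / (13 * e) + snd z / sqrt e\<rfloor>)"
  define c where "c = exp (2 / 3 + \<bar>a\<bar> * (saddle_r + 1) + \<bar>b\<bar> * (saddle_s + 1) + 3 * a ^ 2 + 3 * b ^ 2) / ((1 - rho) * (1 - sigma0))"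
  define w where "w = (\<lambda>z :: real \<times> real. c * (exp (- (1 / 12) * (fst z - 0) ^ 2) * exp (- (1 / 12) * (snd z - 0) ^ 2)))"
  have c0: "0 \<le> c" unfolding c_def using rho sigma0_bounds by simp
  have S_eq: "S e z = (if 0 \<le> u e z \<and> 0 \<le> v e z then summand a b e (u e z) (v e z) else 0)" if "0 < e" for e z
    using that by (simp add: S_def W_def u_def v_def zero_le_mult_iff)
  have wu: "((\<lambda>e. (u e z - saddle_r) / sqrt e) \<longlongrightarrow> fst z) (at_right 0)"
    "0 < e \<Longrightarrow> fst z - sqrt e < (u e z - saddle_r) / sqrt e" "0 < e \<Longrightarrow> (u e z - saddle_r) / sqrt e \<le> fst z" for e z
    using floor_scaled_window[of 1, where x = "fst z" and U = saddle_r] by (simp_all add: u_def)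
  have wv: "((\<lambda>e. (v e z - saddle_s) / sqrt e) \<longlongrightarrow> 13 * snd z) (at_right 0)"
    "0 < e \<Longrightarrow> 13 * snd z - 13 * sqrt e < (v e z - saddle_s) / sqrt e" "0 < e \<Longrightarrow> (v e z - saddle_s) / sqrt e \<le> 13 * snd z" for e z
    using floor_scaled_window[of 13, where x = "snd z" and U = saddle_s] by (simp_all add: v_def)
  have meas_floor: "(\<lambda>z::real \<times> real. W e (\<lfloor>fst z\<rfloor>, \<lfloor>snd z\<rfloor>)) \<in> borel_measurable borel" for e
    by (rule measurable_compose[where g = "W e", OF measurable_floor_prod]) simp
  have shift: "S e = (\<lambda>z. (\<lambda>z. W e (\<lfloor>fst z\<rfloor>, \<lfloor>snd z\<rfloor>)) ((saddle_r / e, saddle_s / (13 * e)) + (1 / sqrt e) *\<^sub>R z))" for e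
    by (simp add: S_def fun_eq_iff)
  have meas: "S e \<in> borel_measurable lborel" for e
  proof -
    have "(\<lambda>z. (saddle_r / e, saddle_s / (13 * e)) + (1 / sqrt e) *\<^sub>R z) \<in> borel_measurable borel" by simp
    from measurable_compose[OF this meas_floor[of e]] show ?thesis unfolding shift by simp
  qed
  have meas_f: "(\<lambda>z. weight a b * limit_integrand z) \<in> borel_measurable lborel"
    by (simp add: limit_integrand_def borel_prod[symmetric])
  have int_w: "integrable lborel w"
  proof -
    have "integrable (lborel \<Otimes>\<^sub>M lborel) (\<lambda>z :: real \<times> real. exp (- (1 / 12) * (fst z - 0) ^ 2) * exp (- (1 / 12) * (snd z - 0) ^ 2))"
    proof (rule lborel_pair.Fubini_integrable)
      show "integrable lborel (\<lambda>x::real. \<integral>y. norm (exp (- (1 / 12) * (fst (x, y) - 0) ^ 2) * exp (- (1 / 12) * (snd (x, y) - 0) ^ 2)) \<partial>lborel)"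
        using gaussian_integral(1)[of "1 / 12" 0] by (simp add: abs_mult)
      show "AE x in lborel. integrable lborel (\<lambda>y. exp (- (1 / 12) * (fst (x::real, y::real) - 0) ^ 2) * exp (- (1 / 12) * (snd (x, y) - 0) ^ 2))"
        using gaussian_integral(1)[of "1 / 12" 0] by simp
    qed simp
    then show ?thesis unfolding w_def lborel_prod by (rule integrable_mult_right)
  qed
  have lim: "((\<lambda>e. S e z) \<longlongrightarrow> weight a b * limit_integrand z) (at_right 0)" for z
  proof -
    have "((\<lambda>e. summand a b e (u e z) (v e z)) \<longlongrightarrow> weight a b * limit_integrand z) (at_right 0)"
      using summand_tendsto[OF wu(1)[of z] wv(1)[of z]] by simp
    then show ?thesis
    proof (rule Lim_transform_eventually)
      have "\<forall>\<^sub>F e in at_right 0. 0 < u e z" "\<forall>\<^sub>F e in at_right 0. 0 < v e z"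
        using order_tendstoD(1)[OF dilog_exp_taylor_scaled(2)[OF saddle_pos(1) wu(1)] saddle_pos(1)]
          order_tendstoD(1)[OF dilog_exp_taylor_scaled(2)[OF saddle_pos(2) wv(1)] saddle_pos(2)] by auto
      then show "\<forall>\<^sub>F e in at_right 0. summand a b e (u e z) (v e z) = S e z"
        using eventually_at_right_less by eventually_elim (simp add: S_eq)
    qed
  qed
  have dom: "\<bar>S e z\<bar> \<le> w z" if e: "0 < e" "e < 1" for e z
  proof (cases "0 \<le> u e z \<and> 0 \<le> v e z")
    case True
    have se: "sqrt e < 1" using e by simp
    have "\<bar>fst z - (u e z - saddle_r) / sqrt e\<bar> \<le> 1" using wu(2,3)[OF e(1), of z] se by linarith
    moreover have "\<bar>snd z - (v e z - saddle_s) / (13 * sqrt e)\<bar> \<le> 1"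
    proof -
      have "(v e z - saddle_s) / (13 * sqrt e) = (v e z - saddle_s) / sqrt e / 13" by simp
      then show ?thesis using wv(2,3)[OF e(1), of z] se by linarith
    qed
    ultimately have "summand a b e (u e z) (v e z) \<le> w z"
      unfolding w_def c_def using True e by (intro summand_dominated) auto
    then show ?thesis using True e summand_nonneg[of e "u e z" "v e z" a b] by (simp add: S_eq)
  next
    case False
    then have "S e z = 0" unfolding S_eq[OF e(1)] by (rule if_not_P)
    then show ?thesis using c0 by (simp add: w_def)
  qed
  have conv: "((\<lambda>e. integral\<^sup>L lborel (S e)) \<longlongrightarrow> (\<integral>z. weight a b * limit_integrand z \<partial>lborel)) (at_right 0)"
    and intS: "\<And>e. 0 < e \<Longrightarrow> e < 1 \<Longrightarrow> integrable lborel (S e)"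
    and intf: "integrable lborel (\<lambda>z. weight a b * limit_integrand z)"
    using tendsto_integral_at_right_0[OF meas_f meas int_w AE_I2[OF lim] dom zero_less_one] by blast+
  have F_eq: "F a b (exp (- e)) * exp (- (Lam / e)) = prefactor e / e * integral\<^sup>L lborel (S e)" if e: "0 < e" "e < 1" for e
  proof -
    note A = lborel_integral_affine[where t = "(saddle_r / e, saddle_s / (13 * e))" and c = "1 / sqrt e",
        OF _ meas_floor intS[OF e, unfolded shift]]
    have "(W e has_sum (\<integral>z. W e (\<lfloor>fst (z :: real \<times> real)\<rfloor>, \<lfloor>snd z\<rfloor>) \<partial>lborel)) UNIV"
      by (rule has_sum_floor_integral_prod[OF A(1)]) (use e in auto)
    also have "(\<integral>z. W e (\<lfloor>fst (z :: real \<times> real)\<rfloor>, \<lfloor>snd z\<rfloor>) \<partial>lborel) = integral\<^sup>L lborel (S e) / e"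
      using A(2) e unfolding shift by (simp add: power_divide)
    finally have "((\<lambda>(r, s). W e (int r, int s)) has_sum (integral\<^sup>L lborel (S e) / e)) UNIV"
      by (rule has_sum_int_prod_imp_nat) (auto simp: W_def)
    then have "((\<lambda>p. prefactor e * (case p of (r, s) \<Rightarrow> W e (int r, int s))) has_sum (prefactor e * (integral\<^sup>L lborel (S e) / e))) UNIV"
      by (rule has_sum_cmult_right)
    moreover have "prefactor e * (case p of (r, s) \<Rightarrow> W e (int r, int s)) =
      (case p of (r, s) \<Rightarrow> exp (- e) powr (2 * real r ^ 2 + 13 * real r * real s + 26 * real s ^ 2 + a * real r + b * real s)
       / (qpoch (exp (- e)) (exp (- e)) r * qpoch (exp (- e) ^ 13) (exp (- e) ^ 13) s)) * exp (- (Lam / e))" for p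
      by (cases p) (simp only: prod.case F_term_eq[OF e(1)], simp add: W_def)
    ultimately have "(\<Sum>\<^sub>\<infinity>p. (case p of (r, s) \<Rightarrow> exp (- e) powr (2 * real r ^ 2 + 13 * real r * real s + 26 * real s ^ 2 + a * real r + b * real s)
       / (qpoch (exp (- e)) (exp (- e)) r * qpoch (exp (- e) ^ 13) (exp (- e) ^ 13) s)) * exp (- (Lam / e)))
       = prefactor e * (integral\<^sup>L lborel (S e) / e)"
      by (simp only: infsumI)
    then show ?thesis by (simp add: F_def infsum_cmult_left')
  qed
  have "((\<lambda>e. prefactor e / e * integral\<^sup>L lborel (S e)) \<longlongrightarrow> sqrt 13 / (2 * pi) * (\<integral>z. weight a b * limit_integrand z \<partial>lborel)) (at_right 0)"
    by (intro tendsto_mult prefactor_tendsto conv)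
  then show ?thesis
  proof (rule tendsto_transfer)
    show "\<forall>\<^sub>F e in at_right 0. prefactor e / e * integral\<^sup>L lborel (S e) = F a b (exp (- e)) * exp (- (Lam / e))"
      by (rule eventually_at_rightI[of _ 1]) (use F_eq in auto)
    let ?A = "4 + rho / (1 - rho)" and ?C = "52 + 13 * (sigma0 / (1 - sigma0))"
    have A: "4 \<le> ?A" "52 \<le> ?C" using rho sigma0_bounds by auto
    have "weight a b \<noteq> 0" using rho sigma0_bounds by (simp add: weight_def)
    then have "integrable lborel limit_integrand" using intf by simp
    then have "integral\<^sup>L lborel limit_integrand = 2 * pi / sqrt (?A * ?C - 13 ^ 2)"
      unfolding limit_integrand_def using A mult_mono[of 4 ?A 52 ?C]
      by (intro gaussian_integral_2) auto
    then have "sqrt 13 / (2 * pi) * (\<integral>z. weight a b * limit_integrand z \<partial>lborel)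
      = exp (- a * saddle_r - b * (saddle_s / 13)) * (sqrt 13 / (sqrt (1 - rho) * sqrt (1 - sigma0) * sqrt (?A * ?C - 13 ^ 2)))"
      by (simp add: weight_def mult_ac)
    also have "sqrt 13 / (sqrt (1 - rho) * sqrt (1 - sigma0) * sqrt (?A * ?C - 13 ^ 2)) = kappa"
    proof -
      have "s / (s * s * w / r) = r / (w * s)" if "s \<noteq> 0" "w \<noteq> 0" "r \<noteq> 0" for s w r :: real
        using that by (simp add: divide_simps)
      from this[of "sqrt 13" "1 - rho" rho] show ?thesis
        unfolding hessian_constant kappa_eq using rho by simp
    qed
    also have "exp (- a * saddle_r - b * (saddle_s / 13)) = rho powr a * sigma0 powr (b / 13)"
      using rho sigma0_bounds by (simp add: powr_def saddle_r_def saddle_s_def flip: exp_add)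
    finally show "sqrt 13 / (2 * pi) * (\<integral>z. weight a b * limit_integrand z \<partial>lborel) = kappa * rho powr a * sigma0 powr (b / 13)"
      by simp
  qed
qed

lemma leading_amplitude_F_combination:
  assumes "kappa * (rho powr a * sigma0 powr (b / 13) + rho powr a' * sigma0 powr (b' / 13)) = K" "K \<noteq> 0"
  shows "leading_amplitude (\<lambda>q. F a b q + q ^ n * F a' b' q) K"
proof (rule leading_amplitudeI[OF _ assms(2)])
  have "((\<lambda>e. F a b (exp (- e)) * exp (- (Lam / e)) + exp (- e) ^ n * (F a' b' (exp (- e)) * exp (- (Lam / e))))
    \<longlongrightarrow> kappa * rho powr a * sigma0 powr (b / 13) + exp (- 0) ^ n * (kappa * rho powr a' * sigma0 powr (b' / 13))) (at_right 0)"
    by (intro tendsto_intros F_tendsto)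
  moreover have "kappa * rho powr a * sigma0 powr (b / 13) + exp (- 0) ^ n * (kappa * rho powr a' * sigma0 powr (b' / 13)) = K"
    using assms(1) by (simp add: algebra_simps)
  ultimately show "((\<lambda>e. (F a b (exp (- e)) + exp (- e) ^ n * F a' b' (exp (- e))) * exp (- (Lam / e))) \<longlongrightarrow> K) (at_right 0)"
    by (simp add: algebra_simps)
qed

theorem proposition6p3:
  "(\<forall>a b :: real. (\<lambda>\<epsilon>. F a b (exp (- \<epsilon>))) \<sim>[at_right 0]
      (\<lambda>\<epsilon>. kappa * rho powr a * sigma0 powr (b / 13) * exp (Lam / \<epsilon>)))
   \<and> leading_amplitude (\<lambda>q. F 0 0 q + q * F 2 13 q) (alpha / sqrt 13)
   \<and> leading_amplitude (\<lambda>q. F 0 0 q + q ^ 6 * F 7 26 q) (beta / sqrt 13)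
   \<and> leading_amplitude (\<lambda>q. F 4 13 q + q ^ 4 * F 6 26 q) (gamma / sqrt 13)
   \<and> leading_amplitude P0 (alpha / sqrt 13)
   \<and> leading_amplitude P1 (beta / sqrt 13)
   \<and> leading_amplitude P2 (gamma / sqrt 13)"
proof (intro conjI allI)
  have pos: "0 < alpha" "0 < beta" "0 < gamma" using beta_less_alpha by (auto simp: period_differences)
  have r: "rho powr 0 = 1" "rho powr 2 = rho ^ 2" "rho powr 4 = rho ^ 4" "rho powr 6 = rho ^ 6" "rho powr 7 = rho ^ 7"
    using rho(1) by (simp_all add: powr_numeral)
  have s: "sigma0 powr (0 / 13) = 1" "sigma0 powr (13 / 13) = sigma0" "sigma0 powr (26 / 13) = sigma0 ^ 2"
    using sigma0_bounds(1) by (simp_all add: powr_numeral)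
  show "leading_amplitude (\<lambda>q. F 0 0 q + q * F 2 13 q) (alpha / sqrt 13)"
    using leading_amplitude_F_combination[of 0 0 2 13 "alpha / sqrt 13" 1] amplitude_identities(1) pos
    unfolding r s by simp
  show "leading_amplitude (\<lambda>q. F 0 0 q + q ^ 6 * F 7 26 q) (beta / sqrt 13)"
    by (rule leading_amplitude_F_combination) (use amplitude_identities(2) pos in \<open>simp_all only: r s, simp_all\<close>)
  show "leading_amplitude (\<lambda>q. F 4 13 q + q ^ 4 * F 6 26 q) (gamma / sqrt 13)"
    by (rule leading_amplitude_F_combination) (use amplitude_identities(3) pos in \<open>simp_all only: r s, simp_all\<close>)
  show "leading_amplitude P0 (alpha / sqrt 13)" "leading_amplitude P1 (beta / sqrt 13)" "leading_amplitude P2 (gamma / sqrt 13)"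
    by (fact leading_amplitude_P)+
  fix a b :: real
  have K: "kappa * rho powr a * sigma0 powr (b / 13) \<noteq> 0"
    using rho sigma0_bounds by (simp add: kappa_eq)
  have "leading_amplitude (F a b) (kappa * rho powr a * sigma0 powr (b / 13))"
    by (rule leading_amplitudeI[OF F_tendsto K])
  then show "(\<lambda>\<epsilon>. F a b (exp (- \<epsilon>))) \<sim>[at_right 0] (\<lambda>\<epsilon>. kappa * rho powr a * sigma0 powr (b / 13) * exp (Lam / \<epsilon>))"
    by (simp add: leading_amplitude_def)
qed

end
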